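(* Let $M$ be a $3$-connected matroid such that $r(M),r^*(M)\ge 4$, and let $N$ be a $3$-connected minor of $M$. Let $(X,\{e\},Y)$ be a vertical $3$-separation of $M$ such that $M/e$ has an $N$-minor and $|X\cap E(N)|\le 1$, and let $(X',\{e'\},Y')$ be a vertical $3$-separation of $M$ such that $Y\cup\{e\}\subseteq Y'\cup\{e'\}$ and $Y'\cup\{e'\}$ is maximal. Suppose that $X'\cup\{e'\}$ is a $4$-element fan $F=(f_1,f_2,f_3,f_4)$ with $e'=f_1$. Then: (i) if $F$ extends to a fan of size at least six, then $F$ contains no elastic elements of $M$; (ii) if $F$ extends to a fan of size five but not to a fan of size six, then either $F$ contains exactly one elastic element, namely $f_3$, and this element is $N$-elastic, or $F$ contains no elastic elements; (iii) if $F$ does not extend to a fan with more elements, then either $F$ contains exactly two elastic elements, namely $f_2$ and $f_3$, and both are $N$-elastic, or $F$ contains no elastic elements. Moreover, if $F$ contains no elastic elements, then, up to duality, $M$ has a swirl-like flower $(A,\{f_1,f_2\},\{f_3,f_4\},B)$, or there are elements $e$ and $g$ such that $M|(F\cup\{e,g\})\cong M(K_4)$.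
   Context: $\lambda_M(X)=r(X)+r(E(M)-X)-r(M)$; $X$ is $k$-separating if $\lambda_M(X)\le k-1$; $(X,E-X)$ is a $k$-separation if also $\min\{|X|,|E-X|\}\ge k$, and vertical if $\min\{r(X),r(E-X)\}\ge k$. A partition $(X,\{e\},Y)$ of $E(M)$ is a vertical $3$-separation if $(X\cup\{e\},Y)$ and $(X,Y\cup\{e\})$ are both vertical $3$-separations and $e\in{\rm cl}(X)\cap{\rm cl}(Y)$; $Y\cup\{e\}$ is maximal if there is no vertical $3$-separation $(X'',\{e''\},Y'')$ with $Y\cup\{e\}\subsetneq Y''\cup\{e''\}$. An element $x$ of a $3$-connected matroid $M$ is elastic if ${\rm si}(M/x)$ and ${\rm co}(M\backslash x)$ (simplification, cosimplification) are $3$-connected; it is $N$-elastic if in addition each of them has an $N$-minor. A fan of a $3$-connected matroid is a set with an ordering $(f_1,\dots,f_k)$, $k\ge3$, such that each consecutive triple $\{f_i,f_{i+1},f_{i+2}\}$ is a triangle or triad, alternately triangles and triads; "$F$ extends to a fan of size $m$" means $F$ is contained (as a consecutive ordered portion) in a fan with $m$ elements. A flower of $M$ is a partition $(P_1,\dots,P_n)$ of $E(M)$ with $|P_i|\ge2$ and $P_i$ and $P_i\cup P_{i+1}$ $3$-separating for all $i$ (indices mod $n$). It is swirl-like if $n\ge4$, $\sqcap(P_i,P_j)=1$ for consecutive $i,j$ and $\sqcap(P_i,P_j)=0$ for non-consecutive $i,j$, where $\sqcap(P,Q)=r(P)+r(Q)-r(P\cup Q)$.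
   Formalization: Labels corrected: in (ii) the elastic element is the middle of the 5-fan; the flower uses the first four elements of each longer fan (maximal 5-fan or size ≥6), or (f1,f2,f3,f4) or (f1,f3,f2,f4) if F does not extend. E(N) is the ground set of an N-copy in M/e. *)

theory Defs
  imports Main
begin

section \<open>Finite matroids\<close>

text \<open>
  The independent sets are kept as a set of subsets of the ground set, so that record equality is
  equality of matroids.
\<close>

record 'a matroid =
  ground :: "'a set"
  indep :: "'a set set"

locale matroid =
  fixes M :: "'a matroid"
  assumes finite_ground: "finite (ground M)"
    and indep_subset_ground: "I \<in> indep M \<Longrightarrow> I \<subseteq> ground M"
    and empty_indep: "{} \<in> indep M"
    and indep_subset: "I \<in> indep M \<Longrightarrow> J \<subseteq> I \<Longrightarrow> J \<in> indep M"
    and augment: "I \<in> indep M \<Longrightarrow> J \<in> indep M \<Longrightarrow> card I < card J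
      \<Longrightarrow> \<exists>x \<in> J - I. insert x I \<in> indep M"

definition basis :: "'a matroid \<Rightarrow> 'a set \<Rightarrow> bool" where
  "basis M B \<longleftrightarrow> B \<in> indep M \<and> (\<forall>I \<in> indep M. B \<subseteq> I \<longrightarrow> I = B)"

definition circuit :: "'a matroid \<Rightarrow> 'a set \<Rightarrow> bool" where
  "circuit M C \<longleftrightarrow> C \<subseteq> ground M \<and> C \<notin> indep M \<and> (\<forall>D. D \<subset> C \<longrightarrow> D \<in> indep M)"

definition rk :: "'a matroid \<Rightarrow> 'a set \<Rightarrow> nat" where
  "rk M X = Max (card ` {I \<in> indep M. I \<subseteq> X})"

definition cl :: "'a matroid \<Rightarrow> 'a set \<Rightarrow> 'a set" where
  "cl M X = {x \<in> ground M. rk M (insert x X) = rk M X}"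

definition dual :: "'a matroid \<Rightarrow> 'a matroid" where
  "dual M = \<lparr>ground = ground M, indep = {I. \<exists>B. basis M B \<and> I \<subseteq> ground M - B}\<rparr>"

definition delete :: "'a matroid \<Rightarrow> 'a set \<Rightarrow> 'a matroid" where
  "delete M D = \<lparr>ground = ground M - D, indep = {I \<in> indep M. I \<inter> D = {}}\<rparr>"

definition contract :: "'a matroid \<Rightarrow> 'a set \<Rightarrow> 'a matroid" where
  "contract M C = dual (delete (dual M) C)"

definition restrict :: "'a matroid \<Rightarrow> 'a set \<Rightarrow> 'a matroid" where
  "restrict M X = delete M (ground M - X)"

definition matroid_iso :: "'a matroid \<Rightarrow> 'b matroid \<Rightarrow> bool" where
  "matroid_iso M N \<longleftrightarrow> (\<exists>f. bij_betw f (ground M) (ground N)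
     \<and> (\<forall>I \<subseteq> ground M. I \<in> indep M \<longleftrightarrow> f ` I \<in> indep N))"

definition is_minor :: "'a matroid \<Rightarrow> 'a matroid \<Rightarrow> bool" where
  "is_minor N M \<longleftrightarrow> (\<exists>C D. C \<subseteq> ground M \<and> D \<subseteq> ground M \<and> C \<inter> D = {}
     \<and> N = delete (contract M C) D)"

text \<open>``\<open>M\<close> has an \<open>N\<close>-minor'': some minor of \<open>M\<close> is isomorphic to \<open>N\<close>.\<close>

definition has_minor :: "'a matroid \<Rightarrow> 'b matroid \<Rightarrow> bool" where
  "has_minor M N \<longleftrightarrow> (\<exists>N'. is_minor N' M \<and> matroid_iso N' N)"


section \<open>Simplification and cosimplification\<close>

definition parallel :: "'a matroid \<Rightarrow> 'a \<Rightarrow> 'a \<Rightarrow> bool" where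
  "parallel M x y \<longleftrightarrow> {x} \<in> indep M \<and> {y} \<in> indep M \<and> (x = y \<or> {x, y} \<notin> indep M)"

text \<open>
  A simplification deletes all loops and all but one element of every parallel class; it is unique
  up to isomorphism, and \<open>si\<close> picks one.
\<close>

definition parallel_transversal :: "'a matroid \<Rightarrow> 'a set \<Rightarrow> bool" where
  "parallel_transversal M T \<longleftrightarrow> T \<subseteq> ground M \<and> (\<forall>t \<in> T. {t} \<in> indep M)
     \<and> (\<forall>x \<in> ground M. {x} \<in> indep M \<longrightarrow> (\<exists>!t. t \<in> T \<and> parallel M x t))"

definition si :: "'a matroid \<Rightarrow> 'a matroid" where
  "si M = restrict M (SOME T. parallel_transversal M T)"

definition co :: "'a matroid \<Rightarrow> 'a matroid" where
  "co M = dual (si (dual M))"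


section \<open>Connectivity\<close>

definition conn :: "'a matroid \<Rightarrow> 'a set \<Rightarrow> int" where
  "conn M X = int (rk M X) + int (rk M (ground M - X)) - int (rk M (ground M))"

definition separating :: "'a matroid \<Rightarrow> nat \<Rightarrow> 'a set \<Rightarrow> bool" where
  "separating M k X \<longleftrightarrow> X \<subseteq> ground M \<and> conn M X \<le> int k - 1"

definition separation :: "'a matroid \<Rightarrow> nat \<Rightarrow> 'a set \<Rightarrow> 'a set \<Rightarrow> bool" where
  "separation M k X Y \<longleftrightarrow> X \<union> Y = ground M \<and> X \<inter> Y = {} \<and> separating M k X
     \<and> min (card X) (card Y) \<ge> k"

definition vertical_separation :: "'a matroid \<Rightarrow> nat \<Rightarrow> 'a set \<Rightarrow> 'a set \<Rightarrow> bool" where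
  "vertical_separation M k X Y \<longleftrightarrow> separation M k X Y \<and> min (rk M X) (rk M Y) \<ge> k"

definition n_connected :: "nat \<Rightarrow> 'a matroid \<Rightarrow> bool" where
  "n_connected n M \<longleftrightarrow> (\<forall>k X Y. 1 \<le> k \<and> k < n \<longrightarrow> \<not> separation M k X Y)"

abbreviation three_connected :: "'a matroid \<Rightarrow> bool" where
  "three_connected M \<equiv> n_connected 3 M"

definition vertical_3_separation :: "'a matroid \<Rightarrow> 'a set \<Rightarrow> 'a \<Rightarrow> 'a set \<Rightarrow> bool" where
  "vertical_3_separation M X e Y \<longleftrightarrow>
     X \<union> {e} \<union> Y = ground M \<and> e \<notin> X \<and> e \<notin> Y \<and> X \<inter> Y = {}
     \<and> vertical_separation M 3 (X \<union> {e}) Y \<and> vertical_separation M 3 X (Y \<union> {e})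
     \<and> e \<in> cl M X \<inter> cl M Y"

definition maximal_side :: "'a matroid \<Rightarrow> 'a \<Rightarrow> 'a set \<Rightarrow> bool" where
  "maximal_side M e Y \<longleftrightarrow>
     \<not> (\<exists>X'' e'' Y''. vertical_3_separation M X'' e'' Y'' \<and> Y \<union> {e} \<subset> Y'' \<union> {e''})"


section \<open>Elastic elements\<close>

definition elastic :: "'a matroid \<Rightarrow> 'a \<Rightarrow> bool" where
  "elastic M x \<longleftrightarrow> x \<in> ground M
     \<and> three_connected (si (contract M {x})) \<and> three_connected (co (delete M {x}))"

definition N_elastic :: "'b matroid \<Rightarrow> 'a matroid \<Rightarrow> 'a \<Rightarrow> bool" where
  "N_elastic N M x \<longleftrightarrow> elastic M x
     \<and> has_minor (si (contract M {x})) N \<and> has_minor (co (delete M {x})) N"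

definition elastic_elements :: "'a matroid \<Rightarrow> 'a set \<Rightarrow> 'a set" where
  "elastic_elements M F = {x \<in> F. elastic M x}"


section \<open>Fans\<close>

definition triangle :: "'a matroid \<Rightarrow> 'a set \<Rightarrow> bool" where
  "triangle M T \<longleftrightarrow> circuit M T \<and> card T = 3"

definition triad :: "'a matroid \<Rightarrow> 'a set \<Rightarrow> bool" where
  "triad M T \<longleftrightarrow> triangle (dual M) T"

definition fan_triple :: "'a list \<Rightarrow> nat \<Rightarrow> 'a set" where
  "fan_triple fs i = {fs ! i, fs ! (i + 1), fs ! (i + 2)}"

definition fan :: "'a matroid \<Rightarrow> 'a list \<Rightarrow> bool" where
  "fan M fs \<longleftrightarrow> distinct fs \<and> set fs \<subseteq> ground M \<and> length fs \<ge> 3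
     \<and> (\<forall>i. i + 2 < length fs \<longrightarrow> triangle M (fan_triple fs i) \<or> triad M (fan_triple fs i))
     \<and> (\<forall>i. i + 3 < length fs \<longrightarrow>
          (triangle M (fan_triple fs i) \<longrightarrow> triad M (fan_triple fs (i + 1)))
        \<and> (triad M (fan_triple fs i) \<longrightarrow> triangle M (fan_triple fs (i + 1))))"

text \<open>
  \<open>fan_extension M F gs\<close>: the set \<open>F\<close> is a consecutive portion \<open>bs\<close> of the fan \<open>gs\<close>.  A fan is a
  set that has some fan ordering, so \<open>gs\<close> need not order \<open>F\<close> in any prescribed way: if
  \<open>(f1, f2, f3, f4)\<close> is a fan ordering then so is \<open>(f1, f3, f2, f4)\<close>, and it can happen that only one of
  the two prolongs to a longer fan.
\<close>

definition fan_extension :: "'a matroid \<Rightarrow> 'a set \<Rightarrow> 'a list \<Rightarrow> bool" where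
  "fan_extension M F gs \<longleftrightarrow> fan M gs \<and> (\<exists>as bs cs. gs = as @ bs @ cs \<and> set bs = F)"

definition extends_to_fan_of_size :: "'a matroid \<Rightarrow> 'a set \<Rightarrow> nat \<Rightarrow> bool" where
  "extends_to_fan_of_size M F m \<longleftrightarrow> (\<exists>gs. fan_extension M F gs \<and> length gs = m)"


section \<open>Flowers\<close>

definition local_conn :: "'a matroid \<Rightarrow> 'a set \<Rightarrow> 'a set \<Rightarrow> int" where
  "local_conn M P Q = int (rk M P) + int (rk M Q) - int (rk M (P \<union> Q))"

definition flower :: "'a matroid \<Rightarrow> 'a set list \<Rightarrow> bool" where
  "flower M Ps \<longleftrightarrow> (let n = length Ps in
     \<Union> (set Ps) = ground M
     \<and> (\<forall>i < n. \<forall>j < n. i \<noteq> j \<longrightarrow> Ps ! i \<inter> Ps ! j = {})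
     \<and> (\<forall>i < n. card (Ps ! i) \<ge> 2 \<and> separating M 3 (Ps ! i)
          \<and> separating M 3 (Ps ! i \<union> Ps ! (Suc i mod n))))"

definition swirl_like_flower :: "'a matroid \<Rightarrow> 'a set list \<Rightarrow> bool" where
  "swirl_like_flower M Ps \<longleftrightarrow> (let n = length Ps in
     flower M Ps \<and> n \<ge> 4
     \<and> (\<forall>i < n. \<forall>j < n. i \<noteq> j \<longrightarrow>
          local_conn M (Ps ! i) (Ps ! j) = (if j = Suc i mod n \<or> i = Suc j mod n then 1 else 0)))"

text \<open>
  For an ordered sequence starting with \<open>f1, f2, f3, f4\<close>: up to duality, there is a swirl-like
  flower \<open>(A, {f1, f2}, {f3, f4}, B)\<close>.  (Lists are indexed from \<open>0\<close>.)
\<close>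

definition swirl_like_along :: "'a matroid \<Rightarrow> 'a list \<Rightarrow> bool" where
  "swirl_like_along M fs \<longleftrightarrow> (\<exists>M' \<in> {M, dual M}. \<exists>A B.
     swirl_like_flower M' [A, {fs ! 0, fs ! 1}, {fs ! 2, fs ! 3}, B])"


section \<open>The cycle matroid of \<open>K\<^sub>4\<close>\<close>

definition cycle_edges :: "'v list \<Rightarrow> 'v set set" where
  "cycle_edges vs = {{vs ! i, vs ! (Suc i mod length vs)} | i. i < length vs}"

definition cycle_matroid :: "'v set set \<Rightarrow> 'v set matroid" where
  "cycle_matroid G = \<lparr>ground = G, indep = {I. I \<subseteq> G
     \<and> \<not> (\<exists>vs. distinct vs \<and> length vs \<ge> 3 \<and> cycle_edges vs \<subseteq> I)}\<rparr>"

definition complete_graph :: "nat \<Rightarrow> nat set set" where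
  "complete_graph n = {e. e \<subseteq> {..<n} \<and> card e = 2}"

text \<open>Up to duality, \<open>M|(F \<union> {g, h}) \<cong> M(K\<^sub>4)\<close> for some elements \<open>g, h\<close>.\<close>

definition K4_restriction :: "'a matroid \<Rightarrow> 'a set \<Rightarrow> bool" where
  "K4_restriction M F \<longleftrightarrow> (\<exists>M' \<in> {M, dual M}. \<exists>g \<in> ground M. \<exists>h \<in> ground M.
     matroid_iso (restrict M' (F \<union> {g, h})) (cycle_matroid (complete_graph 4)))"

end

theory Submission
  imports Defs
begin

text \<open>
  Let \<open>{a, b, c}\<close> be the triangle and \<open>{b, c, d}\<close> the triad of a 4-element fan.  The ends \<open>a\<close> and \<open>d\<close> are
  never elastic, since \<open>({b, c, d}, a, E - F)\<close> is a vertical 3-separation of \<open>M\<close> and the dual statement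
  holds for \<open>d\<close>; this settles every element of a longer fan except the middle one of a 5-element fan.
  If \<open>si (M / b)\<close> is not 3-connected, there is a vertical 3-separation \<open>(P, b, Q)\<close>, and orthogonality
  forces \<open>a, c \<in> P\<close> and \<open>d \<in> Q\<close>.  Either \<open>P\<close> is a triad \<open>{a, c, g}\<close>, which extends the fan, or
  \<open>(P - {a, c}, {a, c}, {b, d}, Q - {d})\<close> is a swirl-like flower; in the latter case \<open>(P - {c}, c, Q \<union> {b})\<close>
  is a vertical 3-separation of the dual, so \<open>c\<close> is not elastic either.  For the middle element of a
  5-element fan the same analysis in the dual leaves only \<open>P = {b, d, h}\<close> with \<open>{b, d, h}\<close> a triangle,
  which gives \<open>M(K\<^sub>4)\<close>.

  The hyperplane \<open>E - {b, c, d}\<close> contains \<open>Y \<union> {e}\<close>, so \<open>b\<close> is not parallel to the basepoint of the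
  2-separation \<open>(X, Y)\<close> of \<open>M / e\<close>, and \<open>M / b\<close> keeps the minor \<open>N\<close>.  If \<open>b\<close> were in series with that
  basepoint, then \<open>(X - {b}, b, Y \<union> {e})\<close> would be a vertical 3-separation of the dual or \<open>b\<close> would be the
  end of a fan.
\<close>

section \<open>Rank functions\<close>

text \<open>Simplification, cosimplification and minors up to isomorphism are not canonical, so each
  is replaced by rank equations. For 3-connected \<open>M\<close> with at least four elements,
  \<open>si (contract M {x})\<close> fails to be 3-connected exactly when \<open>x\<close> is the
  middle of a vertical 3-separation, whose rank bound is then forced to be an equation; the
  condition on \<open>co (delete M {x})\<close> is the same one for the dual. Minors are carried
  along by an injection with a prescribed shift of rank, which leaves room to trade an element for a
  parallel one. Passing to a simplification this way requires \<open>N\<close> to be simple. With at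
  least four elements 3-connectivity ensures that, for the dual as well; with fewer,
  \<open>N\<close> or its dual is a circuit and occurs in every 3-connected matroid with at least
  four elements. A four-element fan has two symmetries: exchange of its middle elements, and duality
  with exchange of its ends. Everything is therefore proved for one middle element. The exchange
  changes the fan ordering, which is why the flower may follow \<open>f1, f3, f2, f4\<close> and why
  the ordering that prolongs may be this one.\<close>

context matroid
begin

lemma finite_subset_ground: "X \<subseteq> ground M \<Longrightarrow> finite X"
  using finite_ground finite_subset by blast

lemma finite_indep_subsets: "finite {I \<in> indep M. I \<subseteq> X}"
  by (rule finite_subset[of _ "Pow (ground M)"]) (use indep_subset_ground finite_ground in auto)

lemma card_le_rk: "I \<in> indep M \<Longrightarrow> I \<subseteq> X \<Longrightarrow> card I \<le> rk M X"
  unfolding rk_def using finite_indep_subsets by (intro Max_ge) auto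

lemma rk_attained: "\<exists>I \<in> indep M. I \<subseteq> X \<and> card I = rk M X"
proof -
  have "rk M X \<in> card ` {I \<in> indep M. I \<subseteq> X}"
    unfolding rk_def using finite_indep_subsets empty_indep by (intro Max_in) auto
  then show ?thesis by auto
qed

lemma rk_le_card: "finite X \<Longrightarrow> rk M X \<le> card X"
  using rk_attained[of X] card_mono by metis

lemma rk_mono: "X \<subseteq> Y \<Longrightarrow> rk M X \<le> rk M Y"
  using rk_attained[of X] card_le_rk by (metis order_trans)

lemma rk_indep: "I \<in> indep M \<Longrightarrow> rk M I = card I"
  by (meson card_le_rk finite_subset_ground indep_subset_ground le_antisym order_refl rk_le_card)

lemma indep_iff_rk: "I \<in> indep M \<longleftrightarrow> I \<subseteq> ground M \<and> rk M I = card I"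
  using rk_indep indep_subset_ground rk_attained[of I] finite_subset_ground card_subset_eq
  by metis

lemma rk_empty [simp]: "rk M {} = 0"
  using rk_indep[OF empty_indep] by simp

lemma indep_extend:
  assumes "I \<in> indep M" "I \<subseteq> X"
  shows "\<exists>J \<in> indep M. I \<subseteq> J \<and> J \<subseteq> X \<and> card J = rk M X"
  using assms
proof (induction "rk M X - card I" arbitrary: I rule: less_induct)
  case less
  show ?case
  proof (cases "card I = rk M X")
    case True
    then show ?thesis using less by auto
  next
    case False
    obtain K where K: "K \<in> indep M" "K \<subseteq> X" "card K = rk M X"
      using rk_attained by blast
    have lt: "card I < rk M X"
      using card_le_rk[OF less.prems] False by simp
    then obtain x where x: "x \<in> K - I" "insert x I \<in> indep M"
      using augment[OF less.prems(1) K(1)] K(3) by auto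
    have "card (insert x I) = Suc (card I)"
      using x(1) finite_subset_ground[OF indep_subset_ground[OF less.prems(1)]] by simp
    then have "rk M X - card (insert x I) < rk M X - card I" using lt by simp
    then obtain J where "J \<in> indep M" "insert x I \<subseteq> J" "J \<subseteq> X" "card J = rk M X"
      using less.hyps[of "insert x I"] x K(2) less.prems(2) by auto
    then show ?thesis by blast
  qed
qed

text \<open>A basis I of the intersection, extended to a basis J of the union, meets the
  intersection in nothing more, by maximality of I. The traces of J on X and on Y are independent
  and overlap exactly in I.\<close>

lemma rk_submodular: "rk M (X \<union> Y) + rk M (X \<inter> Y) \<le> rk M X + rk M Y"
proof -
  obtain I where I: "I \<in> indep M" "I \<subseteq> X \<inter> Y" "card I = rk M (X \<inter> Y)"
    using rk_attained by blast
  obtain J where J: "J \<in> indep M" "I \<subseteq> J" "J \<subseteq> X \<union> Y" "card J = rk M (X \<union> Y)"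
    using indep_extend[OF I(1), of "X \<union> Y"] I(2) by blast
  have fin: "finite J" using J(1) finite_subset_ground indep_subset_ground by blast
  have "J \<inter> (X \<inter> Y) = I"
  proof -
    have "card (J \<inter> (X \<inter> Y)) \<le> card I"
      unfolding I(3) using indep_subset[OF J(1)] by (intro card_le_rk) auto
    moreover have "I \<subseteq> J \<inter> (X \<inter> Y)" using I(2) J(2) by blast
    ultimately show ?thesis using fin card_seteq by (metis finite_Int)
  qed
  then have *: "(J \<inter> X) \<inter> (J \<inter> Y) = I" by blast
  have "(J \<inter> X) \<union> (J \<inter> Y) = J" using J(3) by blast
  then have "card J + card I = card (J \<inter> X) + card (J \<inter> Y)"
    using card_Un_Int[of "J \<inter> X" "J \<inter> Y"] fin * by simp
  moreover have "card (J \<inter> X) \<le> rk M X" "card (J \<inter> Y) \<le> rk M Y"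
    using indep_subset[OF J(1)] by (auto intro!: card_le_rk)
  ultimately show ?thesis using I(3) J(4) by linarith
qed

text \<open>With A and B only included in the union and the intersection, each application needs set
  inclusions instead of identities, and \<open>auto\<close> can discharge them.\<close>

lemma rk_submodular':
  "A \<subseteq> X \<union> Y \<Longrightarrow> B \<subseteq> X \<Longrightarrow> B \<subseteq> Y \<Longrightarrow> rk M A + rk M B \<le> rk M X + rk M Y"
  using rk_submodular[of X Y] rk_mono[of A "X \<union> Y"] rk_mono[of B "X \<inter> Y"] by force

lemma rk_Un_le: "rk M (X \<union> Y) \<le> rk M X + rk M Y"
  using rk_submodular[of X Y] by linarith

lemma rk_singleton_le: "rk M {x} \<le> 1"
  using rk_le_card[of "{x}"] by simp

lemma rk_insert_le: "rk M (insert x X) \<le> rk M X + 1"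
  using rk_Un_le[of X "{x}"] rk_singleton_le[of x] by simp

lemma rk_Un_le_card: "finite Y \<Longrightarrow> rk M (X \<union> Y) \<le> rk M X + card Y"
  using rk_Un_le[of X Y] rk_le_card[of Y] by linarith

lemma rk_Un_absorb:
  assumes "finite Y" "\<And>y. y \<in> Y \<Longrightarrow> rk M (insert y X) = rk M X"
  shows "rk M (X \<union> Y) = rk M X"
  using assms
proof (induction Y)
  case (insert y Y)
  then have "rk M (X \<union> Y) = rk M X" "rk M (insert y X) = rk M X" by auto
  moreover have "rk M (X \<union> insert y Y) + rk M X \<le> rk M (X \<union> Y) + rk M (insert y X)"
    by (rule rk_submodular') auto
  moreover have "rk M X \<le> rk M (X \<union> insert y Y)" by (rule rk_mono) auto
  ultimately show ?case by linarith
qed simp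

text \<open>Monotonicity of closure. Spanning is expressed by an insertion that leaves the rank
  unchanged, which feeds directly into rank arithmetic.\<close>

lemma rk_spanned_mono:
  assumes "rk M (insert x X) = rk M X" "X \<subseteq> Y"
  shows "rk M (insert x Y) = rk M Y"
proof -
  have "rk M (insert x Y) + rk M X \<le> rk M Y + rk M (insert x X)"
    by (rule rk_submodular') (use assms in auto)
  moreover have "rk M Y \<le> rk M (insert x Y)" by (rule rk_mono) auto
  ultimately show ?thesis using assms by linarith
qed

lemma rk_same_span:
  assumes "A \<subseteq> B" "rk M A = rk M B"
  shows "rk M (A \<union> C) = rk M (B \<union> C)"
proof -
  have "rk M (B \<union> C) + rk M A \<le> rk M (A \<union> C) + rk M B"
    by (rule rk_submodular') (use assms in auto)
  moreover have "rk M (A \<union> C) \<le> rk M (B \<union> C)" by (rule rk_mono) (use assms in auto)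
  ultimately show ?thesis using assms by linarith
qed

lemma basis_iff: "basis M B \<longleftrightarrow> B \<in> indep M \<and> card B = rk M (ground M)"
proof
  assume B: "basis M B"
  then have "B \<in> indep M" by (simp add: basis_def)
  then obtain J where "J \<in> indep M" "B \<subseteq> J" "card J = rk M (ground M)"
    using indep_extend[of B "ground M"] indep_subset_ground by blast
  then show "B \<in> indep M \<and> card B = rk M (ground M)"
    using B by (auto simp: basis_def)
next
  assume B: "B \<in> indep M \<and> card B = rk M (ground M)"
  have "I = B" if I: "I \<in> indep M" "B \<subseteq> I" for I
  proof -
    have "card I \<le> rk M (ground M)" by (rule card_le_rk) (use I indep_subset_ground in auto)
    then show ?thesis
      using card_seteq[of I B] I B finite_subset_ground[OF indep_subset_ground[OF I(1)]] by simp
  qed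
  then show "basis M B" using B by (simp add: basis_def)
qed

end

section \<open>Matroids given by a rank function\<close>

locale rank_function =
  fixes E :: "'a set" and r :: "'a set \<Rightarrow> nat"
  assumes fin: "finite E"
    and r_le_card: "X \<subseteq> E \<Longrightarrow> r X \<le> card X"
    and r_mono: "X \<subseteq> Y \<Longrightarrow> Y \<subseteq> E \<Longrightarrow> r X \<le> r Y"
    and r_submodular: "X \<subseteq> E \<Longrightarrow> Y \<subseteq> E \<Longrightarrow> r (X \<union> Y) + r (X \<inter> Y) \<le> r X + r Y"
begin

text \<open>Deletion and duality are both obtained from this construction, so the independence
  axioms are checked once, for all minors and duals.\<close>

definition of_rank :: "'a matroid" where
  "of_rank = \<lparr>ground = E, indep = {I. I \<subseteq> E \<and> r I = card I}\<rparr>"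

lemma r_Un_le: "X \<subseteq> E \<Longrightarrow> Y \<subseteq> E \<Longrightarrow> r (X \<union> Y) \<le> r X + card Y"
  using r_submodular[of X Y] r_le_card[of Y] by linarith

lemma r_absorb:
  assumes "Y \<subseteq> E" "X \<subseteq> E" "\<And>y. y \<in> Y \<Longrightarrow> r (insert y X) = r X"
  shows "r (X \<union> Y) = r X"
proof -
  have "finite Y" using assms(1) fin finite_subset by blast
  then show ?thesis using assms
  proof (induction Y)
    case (insert y Y)
    have sub: "insert y (X \<union> Y) \<subseteq> E" using insert.prems by auto
    have "(X \<union> Y) \<union> insert y X = insert y (X \<union> Y)" by auto
    moreover have "r X \<le> r ((X \<union> Y) \<inter> insert y X)" by (rule r_mono) (use sub in auto)
    moreover have "r ((X \<union> Y) \<union> insert y X) + r ((X \<union> Y) \<inter> insert y X) \<le> r (X \<union> Y) + r (insert y X)"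
      by (rule r_submodular) (use sub in auto)
    moreover have "r (X \<union> Y) = r X" "r (insert y X) = r X" using insert by auto
    moreover have "r X \<le> r (insert y (X \<union> Y))" by (rule r_mono) (use sub in auto)
    ultimately show ?case by auto
  qed simp
qed

text \<open>Augmentation holds because otherwise every element of J would be spanned by I, giving
  r(J) \<le> r(I), although both sets have rank equal to their size.\<close>

lemma matroid_of_rank: "matroid of_rank"
proof
  show "finite (ground of_rank)" by (simp add: of_rank_def fin)
  show "I \<in> indep of_rank \<Longrightarrow> I \<subseteq> ground of_rank" for I by (simp add: of_rank_def)
  show "{} \<in> indep of_rank" using r_le_card[of "{}"] by (simp add: of_rank_def)
  show "J \<in> indep of_rank" if I: "I \<in> indep of_rank" "J \<subseteq> I" for I J
  proof -
    have IE: "I \<subseteq> E" "r I = card I" using I by (auto simp: of_rank_def)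
    have fI: "finite I" using IE fin finite_subset by blast
    have "r I \<le> r J + card (I - J)"
      using r_Un_le[of J "I - J"] IE I(2) by (auto simp: Un_absorb1)
    moreover have "card I = card J + card (I - J)"
      using fI I(2) by (metis card_Diff_subset card_mono finite_subset le_add_diff_inverse)
    moreover have "r J \<le> card J" using r_le_card[of J] IE I(2) by auto
    ultimately show ?thesis using IE I(2) by (auto simp: of_rank_def)
  qed
  show "\<exists>x \<in> J - I. insert x I \<in> indep of_rank"
    if I: "I \<in> indep of_rank" and J: "J \<in> indep of_rank" and less: "card I < card J" for I J
  proof (rule ccontr)
    assume neg: "\<not> ?thesis"
    have IE: "I \<subseteq> E" "r I = card I" "J \<subseteq> E" "r J = card J" using I J by (auto simp: of_rank_def)
    have fI: "finite I" using IE fin finite_subset by blast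
    have "r (insert x I) = r I" if x: "x \<in> J" for x
    proof (cases "x \<in> I")
      case True
      then show ?thesis by (simp add: insert_absorb)
    next
      case False
      then have "r (insert x I) \<noteq> card (insert x I)"
        using neg x IE by (auto simp: of_rank_def)
      moreover have "r (insert x I) \<le> card (insert x I)" using r_le_card[of "insert x I"] x IE by auto
      moreover have "r I \<le> r (insert x I)" using r_mono[of I "insert x I"] x IE by auto
      ultimately show ?thesis using False fI IE by simp
    qed
    then have "r (I \<union> J) = r I" using r_absorb[of J I] IE by auto
    moreover have "r J \<le> r (I \<union> J)" using r_mono[of J "I \<union> J"] IE by auto
    ultimately show False using IE less by simp
  qed
qed

lemma ground_of_rank [simp]: "ground of_rank = E"
  by (simp add: of_rank_def)

lemma rk_of_rank:
  assumes X: "X \<subseteq> E"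
  shows "rk of_rank X = r X"
proof -
  interpret N: matroid of_rank by (rule matroid_of_rank)
  obtain I where I: "I \<in> indep of_rank" "I \<subseteq> X" "card I = rk of_rank X" using N.rk_attained by blast
  have IE: "I \<subseteq> E" "r I = card I" using I by (auto simp: of_rank_def)
  have fI: "finite I" using IE fin finite_subset by blast
  have "r (insert x I) = r I" if x: "x \<in> X" for x
  proof (cases "x \<in> I")
    case True
    then show ?thesis by (simp add: insert_absorb)
  next
    case False
    have "insert x I \<notin> indep of_rank"
      using N.card_le_rk[of "insert x I" X] False fI I(2,3) x by auto
    then have "r (insert x I) \<noteq> card (insert x I)" using x IE X by (auto simp: of_rank_def)
    moreover have "r (insert x I) \<le> card (insert x I)" using r_le_card[of "insert x I"] x IE X by auto
    moreover have "r I \<le> r (insert x I)" using r_mono[of I "insert x I"] x IE X by auto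
    ultimately show ?thesis using False fI IE by simp
  qed
  then have "r (I \<union> X) = r I" using r_absorb[of X I] IE X by auto
  then show ?thesis using I IE by (simp add: Un_absorb1)
qed

end

lemma matroid_eqI:
  assumes "matroid M" "matroid N" "ground M = ground N"
    and "\<And>X. X \<subseteq> ground M \<Longrightarrow> rk M X = rk N X"
  shows "M = N"
proof -
  have "indep M = indep N"
    using assms matroid.indep_iff_rk[OF assms(1)] matroid.indep_iff_rk[OF assms(2)]
    by (intro set_eqI) auto
  then show ?thesis using assms(3) by simp
qed


section \<open>Duals and minors\<close>

context matroid
begin

lemma rank_function_delete: "rank_function (ground M - D) (rk M)"
  proof
  show "rk M X \<le> card X" if "X \<subseteq> ground M - D" for X
    using that finite_subset_ground[of X] rk_le_card[of X] by blast
qed (use finite_ground rk_mono rk_submodular in auto)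

lemma delete_eq: "delete M D = rank_function.of_rank (ground M - D) (rk M)"
  unfolding delete_def rank_function.of_rank_def[OF rank_function_delete]
  using indep_iff_rk by auto

lemma matroid_delete: "matroid (delete M D)"
  unfolding delete_eq using rank_function.matroid_of_rank[OF rank_function_delete] .

lemma rk_delete: "X \<subseteq> ground M - D \<Longrightarrow> rk (delete M D) X = rk M X"
  unfolding delete_eq using rank_function.rk_of_rank[OF rank_function_delete] .

text \<open>This makes the subtraction of natural numbers in the dual rank formula exact.\<close>

lemma rank_complement: "X \<subseteq> ground M \<Longrightarrow> rk M (ground M) \<le> card X + rk M (ground M - X)"
  using rk_Un_le_card[of X "ground M - X"] finite_subset_ground[of X]
  by (simp add: Un_absorb2 add.commute)

lemma rank_function_dual:
  "rank_function (ground M) (\<lambda>X. card X + rk M (ground M - X) - rk M (ground M))"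
proof
  let ?E = "ground M"
  show "finite ?E" by (rule finite_ground)
  show "card X + rk M (?E - X) - rk M ?E \<le> card X" if "X \<subseteq> ?E" for X
    using rk_mono[of "?E - X" ?E] by auto
  show "card X + rk M (?E - X) - rk M ?E \<le> card Y + rk M (?E - Y) - rk M ?E"
    if XY: "X \<subseteq> Y" "Y \<subseteq> ?E" for X Y
  proof -
    have "rk M ((?E - Y) \<union> (Y - X)) \<le> rk M (?E - Y) + card (Y - X)"
      by (rule rk_Un_le_card) (use finite_subset_ground XY in blast)
    moreover have "(?E - Y) \<union> (Y - X) = ?E - X" using XY by auto
    moreover have "card Y = card X + card (Y - X)"
      using XY finite_subset_ground by (metis card_Diff_subset card_mono finite_subset le_add_diff_inverse)
    ultimately show ?thesis by simp
  qed
  show "card (X \<union> Y) + rk M (?E - (X \<union> Y)) - rk M ?E + (card (X \<inter> Y) + rk M (?E - X \<inter> Y) - rk M ?E)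
      \<le> card X + rk M (?E - X) - rk M ?E + (card Y + rk M (?E - Y) - rk M ?E)"
    if XY: "X \<subseteq> ?E" "Y \<subseteq> ?E" for X Y
  proof -
    have "card X + card Y = card (X \<union> Y) + card (X \<inter> Y)"
      using card_Un_Int finite_subset_ground XY by blast
    moreover have "rk M (?E - X \<inter> Y) + rk M (?E - (X \<union> Y)) \<le> rk M (?E - X) + rk M (?E - Y)"
      by (rule rk_submodular') auto
    moreover have "rk M ?E \<le> card X + rk M (?E - X)" "rk M ?E \<le> card Y + rk M (?E - Y)"
      using rank_complement XY by auto
    moreover have "rk M ?E \<le> card (X \<union> Y) + rk M (?E - (X \<union> Y))"
        "rk M ?E \<le> card (X \<inter> Y) + rk M (?E - X \<inter> Y)"
      by (rule rank_complement, use XY in auto)+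
    ultimately show ?thesis by linarith
  qed
qed

lemma dual_eq:
  "dual M = rank_function.of_rank (ground M) (\<lambda>X. card X + rk M (ground M - X) - rk M (ground M))"
proof -
  let ?E = "ground M"
  have "(\<exists>B. basis M B \<and> I \<subseteq> ?E - B) \<longleftrightarrow> I \<subseteq> ?E \<and> card I + rk M (?E - I) - rk M ?E = card I" for I
  proof
    assume "\<exists>B. basis M B \<and> I \<subseteq> ?E - B"
    then obtain B where B: "B \<in> indep M" "card B = rk M ?E" "I \<subseteq> ?E - B" using basis_iff by blast
    have "B \<subseteq> ?E - I" using B indep_subset_ground by blast
    then have "rk M ?E \<le> rk M (?E - I)" using B card_le_rk by metis
    then show "I \<subseteq> ?E \<and> card I + rk M (?E - I) - rk M ?E = card I"
      using B(3) rk_mono[of "?E - I" ?E] by auto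
  next
    assume I: "I \<subseteq> ?E \<and> card I + rk M (?E - I) - rk M ?E = card I"
    then have "rk M (?E - I) = rk M ?E" using rank_complement[of I] rk_mono[of "?E - I" ?E] by linarith
    then obtain B where "B \<in> indep M" "B \<subseteq> ?E - I" "card B = rk M ?E" using rk_attained[of "?E - I"] by auto
    then show "\<exists>B. basis M B \<and> I \<subseteq> ?E - B" using basis_iff I by blast
  qed
  then show ?thesis
    unfolding dual_def rank_function.of_rank_def[OF rank_function_dual] by auto
qed

lemma matroid_dual: "matroid (dual M)"
  unfolding dual_eq using rank_function.matroid_of_rank[OF rank_function_dual] .

text \<open>The additive form keeps truncated subtraction out of all later arguments, so that
  \<open>linarith\<close> applies.\<close>

lemma rk_dual_add: "X \<subseteq> ground M \<Longrightarrow> rk (dual M) X + rk M (ground M) = card X + rk M (ground M - X)"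
  unfolding dual_eq using rank_function.rk_of_rank[OF rank_function_dual, of X] rank_complement[of X] by simp

end

lemma ground_dual [simp]: "ground (dual M) = ground M"
  by (simp add: dual_def)

lemma ground_delete [simp]: "ground (delete M D) = ground M - D"
  by (simp add: delete_def)

lemma ground_contract [simp]: "ground (contract M C) = ground M - C"
  by (simp add: contract_def)

context matroid
begin

lemma rk_dual_ground: "rk (dual M) (ground M) + rk M (ground M) = card (ground M)"
  using rk_dual_add[of "ground M"] by simp

lemma dual_dual [simp]: "dual (dual M) = M"
proof (rule matroid_eqI)
  interpret D: matroid "dual M" by (rule matroid_dual)
  show "matroid (dual (dual M))" by (rule D.matroid_dual)
  show "matroid M" by unfold_locales
  show "ground (dual (dual M)) = ground M" by simp
  show "rk (dual (dual M)) X = rk M X" if "X \<subseteq> ground (dual (dual M))" for X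
  proof -
    have X: "X \<subseteq> ground M" using that by simp
    have "card X + card (ground M - X) = card (ground M)"
      using X finite_ground by (metis card_Diff_subset card_mono finite_subset_ground le_add_diff_inverse)
    moreover have "ground M - (ground M - X) = X" using X by auto
    ultimately show ?thesis
      using D.rk_dual_add[of X] rk_dual_add[of "ground M - X"] rk_dual_ground X by auto
  qed
qed

lemma matroid_contract: "matroid (contract M C)"
  unfolding contract_def using matroid_dual matroid.matroid_dual matroid.matroid_delete by blast

lemma rk_contract_add:
  assumes C: "C \<subseteq> ground M" and X: "X \<subseteq> ground M - C"
  shows "rk (contract M C) X + rk M C = rk M (X \<union> C)"
proof -
  let ?E = "ground M"
  interpret D: matroid "dual M" by (rule matroid_dual)
  interpret DC: matroid "delete (dual M) C" by (rule D.matroid_delete)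
  have "rk (contract M C) X + rk (dual M) (?E - C) = card X + rk (dual M) (?E - C - X)"
    using DC.rk_dual_add[of X] X D.rk_delete[of "?E - C - X" C] D.rk_delete[of "?E - C" C]
    by (simp add: contract_def)
  moreover have "rk (dual M) (?E - C) + rk M ?E = card (?E - C) + rk M C"
    using rk_dual_add[of "?E - C"] C by (simp add: double_diff)
  moreover have "?E - (?E - C - X) = X \<union> C" using C X by auto
  moreover from this have "rk (dual M) (?E - C - X) + rk M ?E = card (?E - C - X) + rk M (X \<union> C)"
    using rk_dual_add[of "?E - C - X"] by auto
  moreover have "card (?E - C) = card X + card (?E - C - X)"
    using X finite_ground by (metis card_Diff_subset card_mono finite_Diff finite_subset le_add_diff_inverse)
  ultimately show ?thesis by linarith
qed

lemma rk_contract1_add: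
  "x \<in> ground M \<Longrightarrow> X \<subseteq> ground M - {x} \<Longrightarrow> rk (contract M {x}) X + rk M {x} = rk M (insert x X)"
  using rk_contract_add[of "{x}" X] by simp

lemma matroid_minor: "matroid (delete (contract M C) D)"
  using matroid.matroid_delete[OF matroid_contract] .

lemma rk_minor_add:
  "C \<subseteq> ground M \<Longrightarrow> X \<subseteq> ground M - C - D \<Longrightarrow> rk (delete (contract M C) D) X + rk M C = rk M (X \<union> C)"
  using matroid.rk_delete[OF matroid_contract, of X C D] rk_contract_add[of C X] by auto

lemma contract_contract:
  assumes "C \<subseteq> ground M" "D \<subseteq> ground M - C"
  shows "contract (contract M C) D = contract M (C \<union> D)"
proof (rule matroid_eqI)
  interpret K: matroid "contract M C" by (rule matroid_contract)
  show "matroid (contract (contract M C) D)" by (rule K.matroid_contract)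
  show "matroid (contract M (C \<union> D))" by (rule matroid_contract)
  show g: "ground (contract (contract M C) D) = ground (contract M (C \<union> D))" by auto
  show "rk (contract (contract M C) D) X = rk (contract M (C \<union> D)) X"
    if "X \<subseteq> ground (contract (contract M C) D)" for X
  proof -
    have X: "X \<subseteq> ground M - C - D" using that by simp
    have "rk (contract (contract M C) D) X + rk (contract M C) D = rk (contract M C) (X \<union> D)"
      by (rule K.rk_contract_add) (use assms X in auto)
    moreover have "rk (contract M C) D + rk M C = rk M (D \<union> C)"
      by (rule rk_contract_add) (use assms X in auto)
    moreover have "rk (contract M C) (X \<union> D) + rk M C = rk M (X \<union> D \<union> C)"
      by (rule rk_contract_add) (use assms X in auto)
    moreover have "rk (contract M (C \<union> D)) X + rk M (C \<union> D) = rk M (X \<union> (C \<union> D))"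
      by (rule rk_contract_add) (use assms X in auto)
    ultimately show ?thesis by (simp add: Un_ac)
  qed
qed

lemma contract_delete:
  assumes "C \<subseteq> ground M" "C \<inter> D = {}"
  shows "contract (delete M D) C = delete (contract M C) D"
proof (rule matroid_eqI)
  interpret K: matroid "delete M D" by (rule matroid_delete)
  show "matroid (contract (delete M D) C)" by (rule K.matroid_contract)
  show "matroid (delete (contract M C) D)" by (rule matroid_minor)
  show g: "ground (contract (delete M D) C) = ground (delete (contract M C) D)" by auto
  show "rk (contract (delete M D) C) X = rk (delete (contract M C) D) X"
    if "X \<subseteq> ground (contract (delete M D) C)" for X
  proof -
    have X: "X \<subseteq> ground M - C - D" using that by auto
    have "rk (contract (delete M D) C) X + rk (delete M D) C = rk (delete M D) (X \<union> C)"
      by (rule K.rk_contract_add) (use assms X in auto)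
    moreover have "rk (delete M D) C = rk M C" "rk (delete M D) (X \<union> C) = rk M (X \<union> C)"
      using rk_delete[of C D] rk_delete[of "X \<union> C" D] assms X by auto
    moreover have "rk (delete (contract M C) D) X + rk M C = rk M (X \<union> C)"
      by (rule rk_minor_add) (use assms X in auto)
    ultimately show ?thesis by simp
  qed
qed

lemma delete_delete: "delete (delete M C) D = delete M (C \<union> D)"
  by (auto simp: delete_def)

lemma dual_delete: "dual (delete M D) = contract (dual M) D"
  by (simp add: contract_def)

lemma dual_contract: "dual (contract M C) = delete (dual M) C"
proof -
  have "matroid (delete (dual M) C)" using matroid_dual matroid.matroid_delete by blast
  then show ?thesis unfolding contract_def by (rule matroid.dual_dual)
qed

lemma is_minor_matroid: "is_minor N M \<Longrightarrow> matroid N"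
  unfolding is_minor_def using matroid_minor by blast

text \<open>Duality exchanges the contracted and the deleted set; commuting the two operations
  restores the prescribed order.\<close>

lemma is_minor_dual:
  assumes "is_minor N M"
  shows "is_minor (dual N) (dual M)"
proof -
  obtain C D where CD: "C \<subseteq> ground M" "D \<subseteq> ground M" "C \<inter> D = {}" "N = delete (contract M C) D"
    using assms unfolding is_minor_def by blast
  interpret D: matroid "dual M" by (rule matroid_dual)
  have "dual N = contract (delete (dual M) C) D"
    unfolding CD(4) using matroid.dual_delete[OF matroid_contract] dual_contract by simp
  also have "\<dots> = delete (contract (dual M) D) C"
    by (rule D.contract_delete) (use CD in auto)
  finally show ?thesis unfolding is_minor_def using CD
    by (intro exI[of _ D] exI[of _ C]) auto
qed

lemma is_minor_contract:
  assumes "is_minor N (contract M {x})" "x \<in> ground M"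
  shows "is_minor N M"
proof -
  obtain C D where CD: "C \<subseteq> ground M - {x}" "D \<subseteq> ground M - {x}" "C \<inter> D = {}"
      "N = delete (contract (contract M {x}) C) D"
    using assms unfolding is_minor_def by auto
  then have "N = delete (contract M ({x} \<union> C)) D"
    using contract_contract[of "{x}" C] assms(2) by simp
  then show ?thesis unfolding is_minor_def using CD assms(2) by (intro exI[of _ "{x} \<union> C"] exI[of _ D]) auto
qed

lemma is_minor_delete:
  assumes "is_minor N (delete M {x})" "x \<in> ground M"
  shows "is_minor N M"
proof -
  obtain C D where CD: "C \<subseteq> ground M - {x}" "D \<subseteq> ground M - {x}" "C \<inter> D = {}"
      "N = delete (contract (delete M {x}) C) D"
    using assms unfolding is_minor_def by auto
  then have "N = delete (contract M C) ({x} \<union> D)"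
    using contract_delete[of C "{x}"] matroid.delete_delete[OF matroid_contract] assms(2)
    by (metis Diff_empty Diff_insert0 Int_insert_right inf_bot_right subset_Diff_insert)
  then show ?thesis unfolding is_minor_def using CD assms(2) by (intro exI[of _ C] exI[of _ "{x} \<union> D"]) auto
qed

end


section \<open>Isomorphism\<close>

lemma matroid_isoI:
  assumes "matroid M" "matroid N" "bij_betw f (ground M) (ground N)"
    and "\<And>X. X \<subseteq> ground M \<Longrightarrow> rk N (f ` X) = rk M X"
  shows "matroid_iso M N"
proof -
  have "I \<in> indep M \<longleftrightarrow> f ` I \<in> indep N" if I: "I \<subseteq> ground M" for I
  proof -
    have "card (f ` I) = card I" "f ` I \<subseteq> ground N"
      using assms(3) I by (auto simp: bij_betw_def card_image inj_on_subset)
    then show ?thesis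
      using assms(4)[OF I] I matroid.indep_iff_rk[OF assms(1)] matroid.indep_iff_rk[OF assms(2)] by auto
  qed
  then show ?thesis unfolding matroid_iso_def using assms(3) by blast
qed

lemma matroid_iso_rk:
  assumes "matroid M" "matroid N" "matroid_iso M N"
  obtains f where "bij_betw f (ground M) (ground N)" "\<And>X. X \<subseteq> ground M \<Longrightarrow> rk N (f ` X) = rk M X"
proof -
  obtain f where f: "bij_betw f (ground M) (ground N)"
      "\<And>I. I \<subseteq> ground M \<Longrightarrow> I \<in> indep M \<longleftrightarrow> f ` I \<in> indep N"
    using assms(3) unfolding matroid_iso_def by blast
  have card: "card (f ` I) = card I" if "I \<subseteq> ground M" for I
    using f(1) that by (auto simp: bij_betw_def card_image inj_on_subset)
  have "rk N (f ` X) = rk M X" if X: "X \<subseteq> ground M" for X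
  proof (rule antisym)
    obtain I where I: "I \<in> indep M" "I \<subseteq> X" "card I = rk M X"
      using matroid.rk_attained[OF assms(1)] by blast
    then have "f ` I \<in> indep N" using f(2) X by blast
    then show "rk M X \<le> rk N (f ` X)"
      using I card[of I] X matroid.card_le_rk[OF assms(2), of "f ` I" "f ` X"] by (metis image_mono subset_trans)
    obtain J where J: "J \<in> indep N" "J \<subseteq> f ` X" "card J = rk N (f ` X)"
      using matroid.rk_attained[OF assms(2)] by blast
    obtain I' where I': "I' \<subseteq> X" "J = f ` I'" using J(2) by (meson subset_imageE)
    then have "I' \<in> indep M" using f(2) X J(1) by blast
    then show "rk N (f ` X) \<le> rk M X"
      using I' J card[of I'] X matroid.card_le_rk[OF assms(1), of I' X] by (metis subset_trans)
  qed
  then show ?thesis using that f(1) by blast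
qed

lemma matroid_iso_trans: "matroid_iso M N \<Longrightarrow> matroid_iso N K \<Longrightarrow> matroid_iso M K"
  unfolding matroid_iso_def
proof (elim exE conjE)
  fix f g
  assume f: "bij_betw f (ground M) (ground N)" "\<forall>I\<subseteq>ground M. (I \<in> indep M) = (f ` I \<in> indep N)"
    and g: "bij_betw g (ground N) (ground K)" "\<forall>I\<subseteq>ground N. (I \<in> indep N) = (g ` I \<in> indep K)"
  have "(I \<in> indep M) = ((g \<circ> f) ` I \<in> indep K)" if "I \<subseteq> ground M" for I
  proof -
    have "f ` I \<subseteq> ground N" using f(1) that by (auto simp: bij_betw_def)
    then show ?thesis using f(2) g(2) that by (simp add: image_comp)
  qed
  then show "\<exists>h. bij_betw h (ground M) (ground K) \<and> (\<forall>I\<subseteq>ground M. (I \<in> indep M) = (h ` I \<in> indep K))"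
    using bij_betw_trans[OF f(1) g(1)] by blast
qed

lemma matroid_iso_sym:
  assumes "matroid_iso M N"
  shows "matroid_iso N M"
proof -
  obtain f where f: "bij_betw f (ground M) (ground N)"
      "\<And>I. I \<subseteq> ground M \<Longrightarrow> I \<in> indep M \<longleftrightarrow> f ` I \<in> indep N"
    using assms unfolding matroid_iso_def by blast
  define g where "g = inv_into (ground M) f"
  have "J \<in> indep N \<longleftrightarrow> g ` J \<in> indep M" if "J \<subseteq> ground N" for J
  proof -
    have J: "J \<subseteq> f ` ground M" using that f(1) by (simp add: bij_betw_def)
    then have "g ` J \<subseteq> ground M" unfolding g_def by (auto intro: inv_into_into)
    then show ?thesis using f(2) image_inv_into_cancel[OF refl J] by (simp add: g_def)
  qed
  then show ?thesis
    unfolding matroid_iso_def using bij_betw_inv_into[OF f(1)] g_def by blast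
qed

lemma matroid_iso_dual:
  assumes "matroid M" "matroid N" "matroid_iso M N"
  shows "matroid_iso (dual M) (dual N)"
proof -
  obtain f where f: "bij_betw f (ground M) (ground N)"
    "\<And>X. X \<subseteq> ground M \<Longrightarrow> rk N (f ` X) = rk M X"
    using matroid_iso_rk[OF assms] by blast
  show ?thesis
  proof (rule matroid_isoI)
    show "matroid (dual M)" "matroid (dual N)" using assms matroid.matroid_dual by auto
    show "bij_betw f (ground (dual M)) (ground (dual N))" using f(1) by simp
    show "rk (dual N) (f ` X) = rk (dual M) X" if "X \<subseteq> ground (dual M)" for X
    proof -
      have X: "X \<subseteq> ground M" using that by simp
      have im: "f ` ground M = ground N" "inj_on f (ground M)" using f(1) by (auto simp: bij_betw_def)
      have "ground N - f ` X = f ` (ground M - X)"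
        using im X by (metis inj_on_image_set_diff Diff_subset)
      moreover have "card (f ` X) = card X" using im X by (metis card_image inj_on_subset)
      moreover have "f ` X \<subseteq> ground N" using im X by auto
      ultimately show ?thesis
        using matroid.rk_dual_add[OF assms(1) X] matroid.rk_dual_add[OF assms(2), of "f ` X"]
          f(2)[of "ground M - X"] f(2)[of "ground M"] im by auto
    qed
  qed
qed

lemma has_minor_iso: "has_minor M N \<Longrightarrow> matroid_iso N K \<Longrightarrow> has_minor M K"
  unfolding has_minor_def using matroid_iso_trans by blast

lemma has_minor_dual:
  assumes "matroid M" "matroid N" "has_minor M N"
  shows "has_minor (dual M) (dual N)"
proof -
  obtain K where K: "is_minor K M" "matroid_iso K N" using assms unfolding has_minor_def by blast
  then have "matroid K" using matroid.is_minor_matroid[OF assms(1)] by blast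
  then show ?thesis
    unfolding has_minor_def using K matroid.is_minor_dual[OF assms(1)] matroid_iso_dual assms by blast
qed

text \<open>The rank equation says that f identifies N with the restriction of M / C to the image of
  f; whatever lies outside C and the image is deleted. Since f need not be an inclusion, elements of
  a known minor can be replaced by others.\<close>

lemma has_minorI:
  assumes M: "matroid M" and N: "matroid N"
    and C: "C \<subseteq> ground M" and f: "inj_on f (ground N)" "f ` ground N \<subseteq> ground M - C"
    and rk: "\<And>Z. Z \<subseteq> ground N \<Longrightarrow> rk M (f ` Z \<union> C) = rk N Z + rk M C"
  shows "has_minor M N"
proof -
  interpret M: matroid M by (rule M)
  define K where "K = delete (contract M C) (ground M - C - f ` ground N)"
  have g: "ground K = f ` ground N" using f(2) by (auto simp: K_def)
  have "matroid_iso N K"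
  proof (rule matroid_isoI[OF N, where f = f])
    show "matroid K" unfolding K_def by (rule M.matroid_minor)
    show "bij_betw f (ground N) (ground K)" using f(1) g by (simp add: bij_betw_def)
    show "rk K (f ` X) = rk N X" if X: "X \<subseteq> ground N" for X
    proof -
      have "f ` X \<subseteq> ground M - C - (ground M - C - f ` ground N)" using f(2) X by blast
      then show ?thesis
        using M.rk_minor_add[OF C] rk[OF X] unfolding K_def by (metis add_right_cancel)
    qed
  qed
  moreover have "is_minor K M"
    unfolding is_minor_def K_def using C
    by (intro exI[of _ C] exI[of _ "ground M - C - f ` ground N"]) auto
  ultimately show ?thesis unfolding has_minor_def using matroid_iso_sym by blast
qed

text \<open>Contracting C factors through contracting b first; the ranks over \<open>{b}\<close>
  shift by r({b}) on both sides and cancel.\<close>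

lemma has_minor_contractI:
  assumes M: "matroid M" and N: "matroid N"
    and C: "C \<subseteq> ground M" "b \<in> C" and f: "inj_on f (ground N)" "f ` ground N \<subseteq> ground M - C"
    and rk: "\<And>Z. Z \<subseteq> ground N \<Longrightarrow> rk M (f ` Z \<union> C) = rk N Z + rk M C"
  shows "has_minor (contract M {b}) N"
proof (rule has_minorI[OF matroid.matroid_contract[OF M] N, where C = "C - {b}" and f = f])
  interpret M: matroid M by (rule M)
  show "C - {b} \<subseteq> ground (contract M {b})" "f ` ground N \<subseteq> ground (contract M {b}) - (C - {b})"
    using C f(2) by auto
  show "rk (contract M {b}) (f ` Z \<union> (C - {b})) = rk N Z + rk (contract M {b}) (C - {b})"
    if Z: "Z \<subseteq> ground N" for Z
  proof -
    have "insert b (f ` Z \<union> (C - {b})) = f ` Z \<union> C" "insert b (C - {b}) = C" using C(2) by auto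
    moreover have "b \<in> ground M" "f ` Z \<union> (C - {b}) \<subseteq> ground M - {b}" "C - {b} \<subseteq> ground M - {b}"
      using C f(2) Z by auto
    ultimately have "rk (contract M {b}) (f ` Z \<union> (C - {b})) + rk M {b} = rk M (f ` Z \<union> C)"
        "rk (contract M {b}) (C - {b}) + rk M {b} = rk M C"
      using M.rk_contract1_add[of b "f ` Z \<union> (C - {b})"] M.rk_contract1_add[of b "C - {b}"] by simp_all
    then show ?thesis using rk[OF Z] by linarith
  qed
qed (rule f(1))

section \<open>Connectivity\<close>

lemma card_le_1_subset: "finite A \<Longrightarrow> card A \<le> 1 \<Longrightarrow> \<exists>a. A \<subseteq> {a}"
  by (metis One_nat_def card_le_Suc0_iff_eq insertI1 subsetI)

context matroid
begin

lemma conn_dual: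
  assumes X: "X \<subseteq> ground M"
  shows "conn (dual M) X = conn M X"
proof -
  have "ground M - (ground M - X) = X" using X by auto
  then have "rk (dual M) (ground M - X) + rk M (ground M) = card (ground M - X) + rk M X"
    using rk_dual_add[of "ground M - X"] by simp
  moreover have "card (ground M) = card X + card (ground M - X)"
    using X finite_ground by (metis card_Diff_subset card_mono finite_subset le_add_diff_inverse)
  ultimately show ?thesis using rk_dual_add[OF X] rk_dual_ground by (simp add: conn_def)
qed

lemma n_connected_dual: "n_connected n (dual M) \<longleftrightarrow> n_connected n M"
proof -
  have "separation (dual M) k X Y \<longleftrightarrow> separation M k X Y" for k X Y
    unfolding separation_def separating_def using conn_dual[of X] by auto
  then show ?thesis by (simp add: n_connected_def)
qed

lemma three_connected_rk1:
  assumes "three_connected M" "X \<subseteq> ground M" "X \<noteq> {}" "ground M - X \<noteq> {}"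
  shows "rk M (ground M) + 1 \<le> rk M X + rk M (ground M - X)"
proof (rule ccontr)
  assume neg: "\<not> ?thesis"
  have "finite X" "finite (ground M - X)" using assms finite_subset_ground finite_ground by auto
  then have "card X \<ge> 1" "card (ground M - X) \<ge> 1" using assms by (auto simp: Suc_le_eq card_gt_0_iff)
  then have "separation M 1 X (ground M - X)"
    using neg assms by (auto simp: separation_def separating_def conn_def)
  then show False using assms(1)[unfolded n_connected_def, rule_format, of 1 X "ground M - X"] by simp
qed

lemma three_connected_rk2:
  assumes "three_connected M" "X \<subseteq> ground M" "2 \<le> card X" "2 \<le> card (ground M - X)"
  shows "rk M (ground M) + 2 \<le> rk M X + rk M (ground M - X)"
proof (rule ccontr)
  assume neg: "\<not> ?thesis"
  have "separation M 2 X (ground M - X)"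
    using neg assms by (auto simp: separation_def separating_def conn_def)
  then show False using assms(1)[unfolded n_connected_def, rule_format, of 2 X "ground M - X"] by simp
qed

lemma three_connected_rk2':
  assumes "three_connected M" "X \<union> Y = ground M" "X \<inter> Y = {}" "2 \<le> card X" "2 \<le> card Y"
  shows "rk M (ground M) + 2 \<le> rk M X + rk M Y"
proof -
  have "ground M - X = Y" using assms by auto
  then show ?thesis using three_connected_rk2[of X] assms by auto
qed

lemma not_three_connectedD:
  assumes "\<not> three_connected M"
  obtains k A B where "k = 1 \<or> k = (2::nat)" "A \<union> B = ground M" "A \<inter> B = {}" "k \<le> card A" "k \<le> card B"
    "rk M A + rk M B + 1 \<le> rk M (ground M) + k"
proof -
  obtain k A B where k: "1 \<le> k" "k < 3" "separation M k A B"
    using assms unfolding n_connected_def by blast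
  have "ground M - A = B" using k(3) by (auto simp: separation_def)
  moreover from this have "rk M A + rk M B + 1 \<le> rk M (ground M) + k"
    using k(3) by (auto simp: separation_def separating_def conn_def)
  moreover have "k = 1 \<or> k = 2" using k by auto
  ultimately show ?thesis using that k(3) by (auto simp: separation_def)
qed

lemma card_Diff_ge: "X \<subseteq> ground M \<Longrightarrow> card (ground M) = card X + card (ground M - X)"
  using finite_ground by (metis card_Diff_subset card_mono finite_subset le_add_diff_inverse)

text \<open>In r(M) + 2 \<le> r({x, y}) + r(E - {x, y}) the summands on the right are at most 2 and
  r(M), so both bounds are attained: M is simple and cosimple.\<close>

lemma
  assumes "three_connected M" "4 \<le> card (ground M)" "x \<in> ground M" "y \<in> ground M" "x \<noteq> y"
  shows rk_pair: "rk M {x, y} = 2"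
    and rk_Diff_pair: "rk M (ground M - {x, y}) = rk M (ground M)"
proof -
  have "rk M (ground M) + 2 \<le> rk M {x, y} + rk M (ground M - {x, y})"
  proof (rule three_connected_rk2[OF assms(1)])
    show "{x, y} \<subseteq> ground M" "2 \<le> card {x, y}" using assms by auto
    then show "2 \<le> card (ground M - {x, y})"
      using card_Diff_ge[of "{x, y}"] assms(2,5) by simp
  qed
  moreover have "rk M {x, y} \<le> 2" using rk_le_card[of "{x, y}"] assms by auto
  moreover have "rk M (ground M - {x, y}) \<le> rk M (ground M)" by (rule rk_mono) auto
  ultimately show "rk M {x, y} = 2" "rk M (ground M - {x, y}) = rk M (ground M)" by linarith+
qed

lemma
  assumes "three_connected M" "4 \<le> card (ground M)" "x \<in> ground M"
  shows rk_single: "rk M {x} = 1"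
    and rk_Diff_single: "rk M (ground M - {x}) = rk M (ground M)"
proof -
  have "ground M \<noteq> {x}" using assms(2) by auto
  then obtain y where y: "y \<in> ground M" "y \<noteq> x" using assms(3) by blast
  have "rk M {x, y} = 2" using rk_pair[of x y] assms y by auto
  moreover have "rk M {x, y} \<le> rk M {x} + 1" using rk_insert_le[of y "{x}"] by (simp add: insert_commute)
  ultimately show "rk M {x} = 1" using rk_singleton_le[of x] by linarith
  have "rk M (ground M - {x, y}) = rk M (ground M)" using rk_Diff_pair[of x y] assms y by auto
  moreover have "rk M (ground M - {x, y}) \<le> rk M (ground M - {x})" by (rule rk_mono) auto
  moreover have "rk M (ground M - {x}) \<le> rk M (ground M)" by (rule rk_mono) auto
  ultimately show "rk M (ground M - {x}) = rk M (ground M)" by linarith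
qed

lemma vertical_3_separation_iff:
  assumes "three_connected M"
  shows "vertical_3_separation M X e Y \<longleftrightarrow> e \<in> ground M \<and> X \<union> Y = ground M - {e} \<and> X \<inter> Y = {}
    \<and> 3 \<le> rk M X \<and> 3 \<le> rk M Y \<and> rk M (insert e X) = rk M X \<and> rk M (insert e Y) = rk M Y
    \<and> rk M X + rk M Y = rk M (ground M) + 2" (is "?L \<longleftrightarrow> ?R")
proof
  assume v: ?L
  then have s: "e \<in> ground M" "X \<union> Y = ground M - {e}" "X \<inter> Y = {}" "e \<notin> X" "e \<notin> Y"
    by (auto simp: vertical_3_separation_def)
  have c: "rk M (insert e X) = rk M X" "rk M (insert e Y) = rk M Y"
    using v by (auto simp: vertical_3_separation_def cl_def)
  have d: "ground M - X = insert e Y" using s by auto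
  have "conn M X \<le> 2" "3 \<le> rk M X" "3 \<le> rk M Y" "3 \<le> card X" "3 \<le> card (insert e Y)"
    using v by (auto simp: vertical_3_separation_def vertical_separation_def separation_def separating_def)
  moreover from this have "rk M (ground M) + 2 \<le> rk M X + rk M (ground M - X)"
    by (intro three_connected_rk2[OF assms]) (use s d in auto)
  ultimately show ?R using s c d by (auto simp: conn_def)
next
  assume R: ?R
  have sub: "X \<subseteq> ground M" "Y \<subseteq> ground M" using R by auto
  then have fin: "finite X" "finite Y" using finite_subset_ground by auto
  have ne: "e \<notin> X" "e \<notin> Y" using R by auto
  have "3 \<le> card X" "3 \<le> card Y" using R rk_le_card fin order_trans by blast+
  moreover have "ground M - X = insert e Y" "ground M - insert e X = Y" using R ne by auto
  moreover have "card (insert e X) = card X + 1" "card (insert e Y) = card Y + 1" using fin ne by auto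
  ultimately have "vertical_separation M 3 (X \<union> {e}) Y" "vertical_separation M 3 X (Y \<union> {e})"
    using R sub by (simp_all add: vertical_separation_def separation_def separating_def conn_def Un_insert_left insert_absorb, blast+)
  moreover have "e \<in> cl M X \<inter> cl M Y" using R by (simp add: cl_def)
  moreover have "X \<union> {e} \<union> Y = ground M" using R by auto
  ultimately show ?L using R ne by (simp add: vertical_3_separation_def)
qed

end

section \<open>Simplification\<close>

context matroid
begin

lemma indep_singleton_iff: "{x} \<in> indep M \<longleftrightarrow> x \<in> ground M \<and> rk M {x} = 1"
  by (auto simp: indep_iff_rk)

lemma parallel_iff:
  "parallel M x y \<longleftrightarrow> x \<in> ground M \<and> y \<in> ground M \<and> rk M {x} = 1 \<and> rk M {y} = 1 \<and> rk M {x, y} = 1"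
proof (cases "x = y")
  case True
  then show ?thesis by (auto simp: parallel_def indep_singleton_iff)
next
  case False
  have "rk M {x, y} \<le> 2" using rk_le_card[of "{x, y}"] False by auto
  moreover have "rk M {x} \<le> rk M {x, y}" by (rule rk_mono) auto
  ultimately have "rk M {x, y} = 2 \<or> rk M {x, y} = 1" if "rk M {x} = 1" using that by linarith
  then show ?thesis using False by (auto simp: parallel_def indep_iff_rk)
qed

lemma parallel_sym: "parallel M x y \<Longrightarrow> parallel M y x"
  by (simp add: parallel_iff insert_commute)

lemma parallel_trans:
  assumes "parallel M x y" "parallel M y z"
  shows "parallel M x z"
proof -
  have "rk M {x, y, z} + rk M {y} \<le> rk M {x, y} + rk M {y, z}" by (rule rk_submodular') auto
  moreover have "rk M {x, z} \<le> rk M {x, y, z}" by (rule rk_mono) auto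
  moreover have "rk M {x} \<le> rk M {x, z}" by (rule rk_mono) auto
  ultimately show ?thesis using assms by (auto simp: parallel_iff)
qed

lemma parallel_spanned:
  assumes "parallel M x y" "y \<in> X"
  shows "rk M (insert x X) = rk M X"
  by (rule rk_spanned_mono[of x "{y}"]) (use assms in \<open>auto simp: parallel_iff\<close>)

lemma ex_parallel_transversal: "\<exists>T. parallel_transversal M T"
proof -
  define rep where "rep x = (SOME y. parallel M x y)" for x
  define T where "T = rep ` {x. {x} \<in> indep M}"
  have rep: "parallel M x (rep x)" if "{x} \<in> indep M" for x
    unfolding rep_def by (rule someI[of _ x]) (use that in \<open>simp add: parallel_def\<close>)
  have "t = rep x" if "t \<in> T" "parallel M x t" for x t
  proof -
    obtain y where y: "{y} \<in> indep M" "t = rep y" using \<open>t \<in> T\<close> by (auto simp: T_def)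
    then have "parallel M x y" using rep that(2) parallel_trans parallel_sym by blast
    \<comment> \<open>Elements of one class have equal predicates, hence \<open>SOME\<close> picks
      the same representative for them.\<close>
    then have "parallel M x = parallel M y" using parallel_trans parallel_sym by blast
    then show ?thesis using y by (simp add: rep_def)
  qed
  moreover have "rep x \<in> T" if "{x} \<in> indep M" for x using that by (simp add: T_def)
  moreover have "T \<subseteq> ground M" "\<forall>t \<in> T. {t} \<in> indep M"
    using rep by (auto simp: T_def parallel_def indep_singleton_iff)
  ultimately have "parallel_transversal M T"
    unfolding parallel_transversal_def using rep by blast
  then show ?thesis by blast
qed

text \<open>Hides the choice inside \<open>si\<close>: later proofs know only that T is some
  transversal of the parallel classes carrying the ranks of M.\<close>

lemma si_cases:
  obtains T where "T \<subseteq> ground M" "ground (si M) = T" "matroid (si M)" "\<And>X. X \<subseteq> T \<Longrightarrow> rk (si M) X = rk M X"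
    "\<And>x. x \<in> ground M \<Longrightarrow> rk M {x} = 1 \<Longrightarrow> \<exists>t \<in> T. parallel M x t"
    "\<And>s t. s \<in> T \<Longrightarrow> t \<in> T \<Longrightarrow> parallel M s t \<Longrightarrow> s = t"
    "\<And>t. t \<in> T \<Longrightarrow> rk M {t} = 1"
proof -
  define T where "T = (SOME T. parallel_transversal M T)"
  have T: "parallel_transversal M T"
    unfolding T_def using ex_parallel_transversal by (rule someI_ex)
  then have sub: "T \<subseteq> ground M" by (simp add: parallel_transversal_def)
  have si: "si M = delete M (ground M - T)" by (simp add: si_def restrict_def T_def)
  have "parallel M t t" if "t \<in> T" for t
    using that T by (auto simp: parallel_transversal_def parallel_def)
  then have "s = t" if "s \<in> T" "t \<in> T" "parallel M s t" for s t
    using that T sub unfolding parallel_transversal_def by (metis subsetD)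
  moreover have "rk M {t} = 1" if "t \<in> T" for t
    using that T by (auto simp: parallel_transversal_def indep_singleton_iff)
  moreover have "\<exists>t \<in> T. parallel M x t" if "x \<in> ground M" "rk M {x} = 1" for x
    using that T unfolding parallel_transversal_def indep_singleton_iff by blast
  moreover have "rk (si M) X = rk M X" if "X \<subseteq> T" for X
    unfolding si by (rule rk_delete) (use that sub in auto)
  moreover have "ground (si M) = T" "matroid (si M)" using sub matroid_delete by (auto simp: si)
  ultimately show ?thesis using sub by (intro that[of T])
qed

text \<open>A contains the representative of every nonloop of P, and loops are spanned by the empty
  set, so A spans P.\<close>

lemma rk_transversal:
  assumes T: "T \<subseteq> ground M" "\<And>x. x \<in> ground M \<Longrightarrow> rk M {x} = 1 \<Longrightarrow> \<exists>t \<in> T. parallel M x t"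
    and A: "A \<subseteq> P" "P \<subseteq> ground M" "\<And>x t. x \<in> P \<Longrightarrow> t \<in> T \<Longrightarrow> parallel M x t \<Longrightarrow> t \<in> A"
  shows "rk M A = rk M P"
proof -
  have "rk M (insert x A) = rk M A" if x: "x \<in> P" for x
  proof (cases "rk M {x} = 1")
    case True
    then show ?thesis using T(2)[of x] A x parallel_spanned by blast
  next
    case False
    then have "rk M {x} = 0" using rk_singleton_le[of x] by linarith
    then have "rk M (insert x {}) = rk M {}" by simp
    then show ?thesis by (rule rk_spanned_mono) simp
  qed
  then have "rk M (A \<union> P) = rk M A" using rk_Un_absorb[of P A] finite_subset_ground A(2) by blast
  then show ?thesis using A(1) by (simp add: Un_absorb1)
qed

text \<open>The transversal elements spanned by P in M / x form one side of a 2-separation of the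
  simplification, unless at most one element q is left over. In that case everything outside the
  closure of P lies on the line through x and q, and a complement of rank at most 2 is incompatible
  with r(P) = r(M) + 2 - r(Q) < r(M).\<close>

lemma vertical_3_separation_imp_not_si_contract:
  assumes conn: "three_connected M" and card: "4 \<le> card (ground M)"
    and v: "vertical_3_separation M P x Q"
  shows "\<not> three_connected (si (contract M {x}))"
proof
  assume si: "three_connected (si (contract M {x}))"
  let ?E = "ground M"
  have V: "x \<in> ?E" "P \<union> Q = ?E - {x}" "P \<inter> Q = {}" "3 \<le> rk M P" "3 \<le> rk M Q"
    "rk M (insert x P) = rk M P" "rk M (insert x Q) = rk M Q" "rk M P + rk M Q = rk M ?E + 2"
    using v vertical_3_separation_iff[OF conn] by auto
  define L where "L = contract M {x}"
  interpret L: matroid L unfolding L_def by (rule matroid_contract)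
  have gL: "ground L = ?E - {x}" by (simp add: L_def)
  have rL: "rk L S + 1 = rk M (insert x S)" if "S \<subseteq> ?E - {x}" for S
    using rk_contract1_add[OF V(1) that] rk_single[OF conn card V(1)] by (simp add: L_def)
  obtain T where T: "T \<subseteq> ground L" "ground (si L) = T" "matroid (si L)" "\<And>X. X \<subseteq> T \<Longrightarrow> rk (si L) X = rk L X"
    "\<And>x. x \<in> ground L \<Longrightarrow> rk L {x} = 1 \<Longrightarrow> \<exists>t \<in> T. parallel L x t"
    "\<And>s t. s \<in> T \<Longrightarrow> t \<in> T \<Longrightarrow> parallel L s t \<Longrightarrow> s = t"
    by (rule L.si_cases) blast
  have finT: "finite T" using T(1) L.finite_subset_ground by blast
  \<comment> \<open>Taking the span of P, and not T \<inter> P, matters: a parallel class of M / x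
    may meet both P and Q and be represented in Q.\<close>
  define P1 where "P1 = {t \<in> T. rk L (insert t P) = rk L P}"
  have PP1: "rk L (P \<union> P1) = rk L P"
    by (rule L.rk_Un_absorb) (use finT in \<open>auto simp: P1_def\<close>)
  have P1: "rk L P1 = rk L (P \<union> P1)"
  proof (rule L.rk_transversal[OF T(1,5)])
    show "P1 \<subseteq> P \<union> P1" "P \<union> P1 \<subseteq> ground L" using V(2) T(1) gL by (auto simp: P1_def)
    show "t \<in> P1" if "y \<in> P \<union> P1" "t \<in> T" "parallel L y t" for y t
    proof -
      have "rk L (insert t (P \<union> P1)) = rk L (P \<union> P1)"
        using that L.parallel_spanned L.parallel_sym by blast
      moreover have "rk L (insert t P) \<le> rk L (insert t (P \<union> P1))" by (rule L.rk_mono) auto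
      moreover have "rk L P \<le> rk L (insert t P)" by (rule L.rk_mono) auto
      ultimately show ?thesis using that(2) PP1 by (auto simp: P1_def)
    qed
  qed
  have rT: "rk L T = rk L (ground L)"
    by (rule L.rk_transversal[OF T(1,5)]) (use T(1) in auto)
  have rP: "rk L P + 1 = rk M P" using rL[of P] V by auto
  have rQ: "rk L Q + 1 = rk M Q" using rL[of Q] V by auto
  have rE: "rk L (ground L) + 1 = rk M ?E" using rL[of "ground L"] V(1) gL by (simp add: insert_absorb)
  have P1T: "P1 \<subseteq> T" by (auto simp: P1_def)
  have Q1Q: "T - P1 \<subseteq> Q"
  proof
    fix t assume t: "t \<in> T - P1"
    then have "t \<notin> P" by (auto simp: P1_def insert_absorb)
    then show "t \<in> Q" using t T(1) gL V(2) by auto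
  qed
  have "2 \<le> card P1" using P1 PP1 rP V(4) L.rk_le_card[of P1] finT P1T finite_subset by fastforce
  show False
  proof (cases "2 \<le> card (T - P1)")
    case True
    have "rk (si L) T + 2 \<le> rk (si L) P1 + rk (si L) (T - P1)"
      using matroid.three_connected_rk2[OF T(3), of P1] si T(2) P1T \<open>2 \<le> card P1\<close> True by (simp add: L_def)
    then have "rk L T + 2 \<le> rk L P1 + rk L (T - P1)" using T(4)[of T] T(4)[of P1] T(4)[of "T - P1"] P1T by auto
    moreover have "rk L (T - P1) \<le> rk L Q" using Q1Q by (rule L.rk_mono)
    ultimately show False using P1 PP1 rT rP rQ rE V(8) by linarith
  next
    case False
    then have "card (T - P1) \<le> 1" by simp
    then obtain q where q: "T - P1 \<subseteq> {q}" using card_le_1_subset finT by blast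
    define U where "U = {y \<in> ?E. rk M (insert y P) = rk M P}"
    have "rk M (P \<union> U) = rk M P"
      by (rule rk_Un_absorb) (use finite_ground in \<open>auto simp: U_def\<close>)
    moreover have PU: "P \<subseteq> U"
    proof
      fix y assume "y \<in> P"
      moreover from this have "insert y P = P" by blast
      ultimately show "y \<in> U" using V(2) by (simp add: U_def, blast)
    qed
    ultimately have rU: "rk M U = rk M P" by (simp add: Un_absorb1)
    have UE: "U \<subseteq> ?E" by (auto simp: U_def)
    have xU: "x \<in> U" using V by (auto simp: U_def)
    \<comment> \<open>The representative of w cannot lie in \<open>P1\<close>, since w would then be
      spanned by P. It is therefore q, and being parallel to q in M / x means lying on the line
      through x and q in M.\<close>
    have w: "rk M (insert w {x, q}) = rk M {x, q}" if w: "w \<in> ?E - U" for w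
    proof -
      have wE: "w \<in> ground L" using w xU gL by auto
      have wP: "rk M (insert w P) \<noteq> rk M P" using w by (auto simp: U_def)
      have "rk M {x, w} = 2" using rk_pair[OF conn card V(1), of w] w xU by auto
      then have "rk L {w} = 1" using rL[of "{w}"] wE gL by (auto simp: insert_commute)
      then obtain t where t: "t \<in> T" "parallel L w t" using T(5) wE by blast
      have "t \<notin> P1"
      proof
        assume "t \<in> P1"
        then have "rk L (insert w (P \<union> P1)) = rk L (P \<union> P1)" using t L.parallel_spanned by blast
        moreover have "rk L (insert w P) \<le> rk L (insert w (P \<union> P1))" by (rule L.rk_mono) auto
        moreover have "rk L (insert w P) + 1 = rk M (insert x (insert w P))"
          by (rule rL) (use wE gL V(2) in auto)
        moreover have "rk M (insert w P) \<le> rk M (insert x (insert w P))" by (rule rk_mono) auto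
        moreover have "rk M P \<le> rk M (insert w P)" by (rule rk_mono) auto
        ultimately show False using PP1 rP wP by linarith
      qed
      then have tq: "t = q" using q t by auto
      have "rk L {w, q} = 1" "rk L {q} = 1" using t tq by (auto simp: L.parallel_iff)
      moreover have "q \<in> ?E - {x}" using t tq T(1) gL by auto
      ultimately show ?thesis using rL[of "{w, q}"] rL[of "{q}"] wE gL by (auto simp: insert_commute)
    qed
    have "rk M ({x, q} \<union> (?E - U)) = rk M {x, q}"
      by (rule rk_Un_absorb) (use w finite_ground in auto)
    moreover have "rk M {x, q} \<le> 2" using rk_Un_le[of "{x}" "{q}"] rk_singleton_le[of x] rk_singleton_le[of q] by (simp add: insert_commute)
    moreover have "rk M (?E - U) \<le> rk M ({x, q} \<union> (?E - U))" by (rule rk_mono) auto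
    ultimately have small: "rk M (?E - U) \<le> 2" by linarith
    have "P \<subseteq> ?E" using V(2) by blast
    then have "3 \<le> card P" using V(4) rk_le_card[OF finite_subset_ground[of P]] by linarith
    then have "2 \<le> card U" using PU card_mono[OF finite_subset_ground[OF UE] PU] by linarith
    have "\<not> 2 \<le> card (?E - U)"
      using three_connected_rk2[OF conn UE \<open>2 \<le> card U\<close>] small rU V(5,8) by linarith
    then have "card (?E - U) \<le> 1" by simp
    then obtain w where w: "?E - U \<subseteq> {w}" using card_le_1_subset finite_ground by blast
    have "rk M (?E - {w}) = rk M ?E"
    proof (cases "w \<in> ?E")
      case True
      then show ?thesis by (rule rk_Diff_single[OF conn card])
    qed simp
    moreover have "rk M (?E - {w}) \<le> rk M U" using w by (intro rk_mono) auto
    ultimately show False using rU V(5,8) by linarith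
  qed
qed

text \<open>A separation (A, B) of the simplification is pulled back to P, the classes represented
  in A, and its complement Q. Adding x to both sides bounds the ranks from above by r(M) + k, while
  3-connectivity with x on one side only bounds them from below by r(M) + 2. So k = 1 is impossible,
  and k = 2 forces x into both closures. Two members of a transversal are not parallel, so each side
  has rank at least 2 in M / x, hence at least 3 in M.\<close>

lemma not_si_contract_imp_vertical_3_separation:
  assumes conn: "three_connected M" and card: "4 \<le> card (ground M)" and x: "x \<in> ground M"
    and si: "\<not> three_connected (si (contract M {x}))"
  shows "\<exists>P Q. vertical_3_separation M P x Q"
proof -
  let ?E = "ground M"
  define L where "L = contract M {x}"
  interpret L: matroid L unfolding L_def by (rule matroid_contract)
  have gL: "ground L = ?E - {x}" by (simp add: L_def)
  have rL: "rk L S + 1 = rk M (insert x S)" if "S \<subseteq> ?E - {x}" for S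
    using rk_contract1_add[OF x that] rk_single[OF conn card x] by (simp add: L_def)
  obtain T where T: "T \<subseteq> ground L" "ground (si L) = T" "matroid (si L)" "\<And>X. X \<subseteq> T \<Longrightarrow> rk (si L) X = rk L X"
    "\<And>x. x \<in> ground L \<Longrightarrow> rk L {x} = 1 \<Longrightarrow> \<exists>t \<in> T. parallel L x t"
    "\<And>s t. s \<in> T \<Longrightarrow> t \<in> T \<Longrightarrow> parallel L s t \<Longrightarrow> s = t" "\<And>t. t \<in> T \<Longrightarrow> rk L {t} = 1"
    by (rule L.si_cases) blast
  obtain k A B where k: "k = 1 \<or> k = (2::nat)" and AB: "A \<union> B = T" "A \<inter> B = {}" "k \<le> card A" "k \<le> card B"
    and "rk (si L) A + rk (si L) B + 1 \<le> rk (si L) T + k"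
    using matroid.not_three_connectedD[OF T(3)] si T(2) unfolding L_def by metis
  then have le: "rk L A + rk L B + 1 \<le> rk L T + k" using T(4)[of A] T(4)[of B] T(4)[of T] by auto
  have rT: "rk L T = rk L (ground L)"
    by (rule L.rk_transversal[OF T(1,5)]) (use T(1) in auto)
  have rE: "rk L (ground L) + 1 = rk M ?E" using rL[of "ground L"] x gL by (simp add: insert_absorb)
  define P where "P = {y \<in> ground L. \<exists>t \<in> A. parallel L y t}"
  define Q where "Q = ground L - P"
  have refl: "parallel L t t" if "t \<in> T" for t using T(1,7) that by (auto simp: L.parallel_iff)
  have AP: "A \<subseteq> P" using AB(1) refl T(1) by (auto simp: P_def)
  have rA: "rk L A = rk L P"
  proof (rule L.rk_transversal[OF T(1,5) AP])
    show "P \<subseteq> ground L" by (auto simp: P_def)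
    show "t \<in> A" if "y \<in> P" "t \<in> T" "parallel L y t" for y t
      using that AB(1) T(6) L.parallel_sym L.parallel_trans unfolding P_def by blast
  qed
  have BQ: "B \<subseteq> Q"
  proof
    fix s assume s: "s \<in> B"
    have "s \<notin> P"
    proof
      assume "s \<in> P"
      then obtain t where "t \<in> A" "parallel L s t" by (auto simp: P_def)
      then show False using s T(6)[of s t] AB by auto
    qed
    then show "s \<in> Q" using s AB(1) T(1) by (auto simp: Q_def)
  qed
  have rB: "rk L B = rk L Q"
  proof (rule L.rk_transversal[OF T(1,5) BQ])
    show "Q \<subseteq> ground L" by (auto simp: Q_def)
    show "t \<in> B" if "y \<in> Q" "t \<in> T" "parallel L y t" for y t
      using that AB(1) unfolding P_def Q_def by blast
  qed
  have PQ: "P \<union> Q = ?E - {x}" "P \<inter> Q = {}" using gL by (auto simp: P_def Q_def)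
  have rP: "rk L P + 1 = rk M (insert x P)" and rQ: "rk L Q + 1 = rk M (insert x Q)"
    using rL[of P] rL[of Q] PQ by auto
  have fin: "finite P" "finite Q" using finite_ground gL by (auto simp: P_def Q_def)
  have cP: "k \<le> card P" "k \<le> card Q"
    using AB card_mono[OF fin(1) AP] card_mono[OF fin(2) BQ] by linarith+
  have xn: "x \<notin> P" "x \<notin> Q" using PQ by auto
  have sum: "card P + card Q + 1 = card ?E"
    using card_Un_disjoint[OF fin PQ(2)] PQ(1) x finite_ground card
    by (simp add: card_Diff_singleton)
  have cx: "card (insert x P) = card P + 1" "card (insert x Q) = card Q + 1" using fin xn by auto
  have mono: "rk M P \<le> rk M (insert x P)" "rk M Q \<le> rk M (insert x Q)" by (auto intro: rk_mono)
  have 1: "rk M ?E + 2 \<le> rk M P + rk M (insert x Q)" if "2 \<le> card P" "1 \<le> card Q"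
    by (rule three_connected_rk2'[OF conn]) (use PQ xn cx that x in auto)
  have 2: "rk M ?E + 2 \<le> rk M (insert x P) + rk M Q" if "1 \<le> card P" "2 \<le> card Q"
    by (rule three_connected_rk2'[OF conn]) (use PQ xn cx that x in auto)
  have ub: "rk M (insert x P) + rk M (insert x Q) \<le> rk M ?E + k"
    using le rA rB rP rQ rE rT by linarith
  from k show ?thesis
  proof
    assume "k = 1"
    then have False using 1 2 cP ub sum card mono by linarith
    then show ?thesis ..
  next
    assume k2: "k = 2"
    have r2: "2 \<le> rk L S" if S: "S \<subseteq> T" "2 \<le> card S" for S
    proof -
      obtain s t where st: "s \<in> S" "t \<in> S" "s \<noteq> t"
        using S card_le_Suc0_iff_eq[of S] L.finite_subset_ground[of S] T(1) by force
      then have "\<not> parallel L s t" using S T(6) by blast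
      moreover have "s \<in> ground L" "t \<in> ground L" "rk L {s} = 1" "rk L {t} = 1" using S st T(1,7) by auto
      ultimately have "rk L {s, t} \<noteq> 1" by (simp add: L.parallel_iff)
      moreover have "rk L {s} \<le> rk L {s, t}" by (rule L.rk_mono) auto
      moreover have "rk L {s, t} \<le> rk L S" using st by (intro L.rk_mono) auto
      ultimately show ?thesis using \<open>rk L {s} = 1\<close> by linarith
    qed
    have "2 \<le> rk L A" "2 \<le> rk L B" using r2 AB k2 by auto
    moreover have "rk M ?E + 2 \<le> rk M P + rk M (insert x Q)" "rk M ?E + 2 \<le> rk M (insert x P) + rk M Q"
      using 1 2 cP k2 by auto
    ultimately have "vertical_3_separation M P x Q"
      unfolding vertical_3_separation_iff[OF conn]
      using x PQ rA rB rP rQ mono ub k2 by auto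
    then show ?thesis by blast
  qed
qed

lemma si_contract_three_connected_iff:
  assumes "three_connected M" "4 \<le> card (ground M)" "x \<in> ground M"
  shows "three_connected (si (contract M {x})) \<longleftrightarrow> \<not> (\<exists>P Q. vertical_3_separation M P x Q)"
  using vertical_3_separation_imp_not_si_contract not_si_contract_imp_vertical_3_separation assms by blast

lemma matroid_si: "matroid (si M)"
  unfolding si_def restrict_def by (rule matroid_delete)

lemma co_delete_eq: "co (delete M {x}) = dual (si (contract (dual M) {x}))"
  by (simp add: co_def dual_delete)

text \<open>Contraction and deletion become two instances of one condition, which makes elasticity
  visibly self-dual.\<close>

lemma elastic_iff:
  assumes "three_connected M" "4 \<le> card (ground M)" "x \<in> ground M"
  shows "elastic M x \<longleftrightarrow> (\<nexists>P Q. vertical_3_separation M P x Q) \<and> (\<nexists>P Q. vertical_3_separation (dual M) P x Q)"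
proof -
  interpret D: matroid "dual M" by (rule matroid_dual)
  have "matroid (si (contract (dual M) {x}))" using matroid.matroid_si[OF D.matroid_contract] .
  then have "three_connected (co (delete M {x})) \<longleftrightarrow> three_connected (si (contract (dual M) {x}))"
    using matroid.n_connected_dual co_delete_eq by metis
  then show ?thesis
    using si_contract_three_connected_iff[OF assms] D.si_contract_three_connected_iff[of x] assms n_connected_dual
    by (simp add: elastic_def)
qed

text \<open>Every nonloop of the minor and of the contracted set C is moved to its representative;
  spans, hence ranks, do not change. Two elements of the minor with a common representative would be
  parallel in it, and one sharing its representative with an element of C would be a loop, both
  excluded because N is simple.\<close>

lemma has_minor_si:
  assumes N: "matroid N" "has_minor M N"
    and simple: "\<And>x. x \<in> ground N \<Longrightarrow> rk N {x} = 1"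
      "\<And>x y. x \<in> ground N \<Longrightarrow> y \<in> ground N \<Longrightarrow> x \<noteq> y \<Longrightarrow> rk N {x, y} = 2"
  shows "has_minor (si M) N"
proof -
  obtain C D where CD: "C \<subseteq> ground M" "D \<subseteq> ground M" "C \<inter> D = {}" and iso: "matroid_iso (delete (contract M C) D) N"
    using N(2) unfolding has_minor_def is_minor_def by blast
  define K where "K = delete (contract M C) D"
  define W where "W = ground M - C - D"
  have mK: "matroid K" unfolding K_def by (rule matroid_minor)
  have gK: "ground K = W" by (simp add: K_def W_def)
  have rK: "rk K X + rk M C = rk M (X \<union> C)" if "X \<subseteq> W" for X
    using rk_minor_add[of C X D] that CD by (simp add: K_def W_def)
  obtain f where f: "bij_betw f W (ground N)" "\<And>X. X \<subseteq> W \<Longrightarrow> rk N (f ` X) = rk K X"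
    using matroid_iso_rk[OF mK N(1)] iso gK unfolding K_def by metis
  have K1: "rk K {x} = 1" if "x \<in> W" for x
    using f(2)[of "{x}"] simple(1)[of "f x"] f(1) that by (auto simp: bij_betw_def)
  have K2: "rk K {x, y} = 2" if "x \<in> W" "y \<in> W" "x \<noteq> y" for x y
  proof -
    have "f x \<noteq> f y" "f x \<in> ground N" "f y \<in> ground N"
      using f(1) that by (auto simp: bij_betw_def inj_on_def)
    then show ?thesis using f(2)[of "{x, y}"] simple(2) that by auto
  qed
  have M1: "rk M {x} = 1" if "x \<in> W" for x
    using rK[of "{x}"] K1[OF that] rk_Un_le[of "{x}" C] rk_singleton_le[of x] that by auto
  obtain T where T: "T \<subseteq> ground M" "ground (si M) = T" "matroid (si M)" "\<And>X. X \<subseteq> T \<Longrightarrow> rk (si M) X = rk M X"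
    "\<And>x. x \<in> ground M \<Longrightarrow> rk M {x} = 1 \<Longrightarrow> \<exists>t \<in> T. parallel M x t"
    by (rule si_cases) blast
  define \<phi> where "\<phi> x = (SOME t. t \<in> T \<and> parallel M x t)" for x
  have \<phi>: "\<phi> x \<in> T" "parallel M x (\<phi> x)" if "x \<in> ground M" "rk M {x} = 1" for x
    using someI_ex[of "\<lambda>t. t \<in> T \<and> parallel M x t"] T(5)[OF that] unfolding \<phi>_def by blast+
  define C' where "C' = \<phi> ` {x \<in> C. rk M {x} = 1}"
  have WE: "W \<subseteq> ground M" by (auto simp: W_def)
  have C'T: "C' \<subseteq> T" using \<phi>(1) CD(1) by (auto simp: C'_def)
  have \<phi>T: "\<phi> ` W \<subseteq> T" using \<phi>(1) M1 WE by auto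
  have rank: "rk M (\<phi> ` Z \<union> C') = rk M (Z \<union> C)" if Z: "Z \<subseteq> W" for Z
  proof -
    have fin: "finite (\<phi> ` Z \<union> C')" "finite (Z \<union> C)"
      using Z WE CD(1) finite_subset_ground[of "Z \<union> C"] finite_subset_ground[of C] by (auto simp: C'_def)
    have "rk M (insert t (Z \<union> C)) = rk M (Z \<union> C)" if "t \<in> \<phi> ` Z \<union> C'" for t
    proof -
      obtain z where z: "t = \<phi> z" "z \<in> Z \<union> C" "z \<in> ground M" "rk M {z} = 1"
        using \<open>t \<in> \<phi> ` Z \<union> C'\<close> Z WE M1 CD(1) by (auto simp: C'_def)
      show ?thesis using parallel_spanned[OF parallel_sym[OF \<phi>(2)[OF z(3,4)]] z(2)] z(1) by simp
    qed
    then have "rk M ((Z \<union> C) \<union> (\<phi> ` Z \<union> C')) = rk M (Z \<union> C)" by (rule rk_Un_absorb[OF fin(1)])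
    moreover have "rk M (insert z (\<phi> ` Z \<union> C')) = rk M (\<phi> ` Z \<union> C')" if z: "z \<in> Z \<union> C" for z
    proof (cases "rk M {z} = 1")
      case True
      moreover have "z \<in> ground M" using z Z WE CD(1) by auto
      moreover have "\<phi> z \<in> \<phi> ` Z \<union> C'" using z True by (auto simp: C'_def)
      ultimately show ?thesis using parallel_spanned[OF \<phi>(2)] by blast
    next
      case False
      then have "rk M (insert z {}) = rk M {}" using rk_singleton_le[of z] by simp
      then show ?thesis by (rule rk_spanned_mono) simp
    qed
    then have "rk M ((\<phi> ` Z \<union> C') \<union> (Z \<union> C)) = rk M (\<phi> ` Z \<union> C')" by (rule rk_Un_absorb[OF fin(2)])
    ultimately show ?thesis by (simp add: Un_commute)
  qed
  have inj: "inj_on \<phi> W"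
  proof (rule inj_onI, rule ccontr)
    fix x y assume xy: "x \<in> W" "y \<in> W" "\<phi> x = \<phi> y" "x \<noteq> y"
    have "parallel M x y"
      using \<phi>(2)[of x] \<phi>(2)[of y] M1 xy WE parallel_sym parallel_trans by (metis subsetD)
    then have "rk M (insert x ({y} \<union> C)) = rk M ({y} \<union> C)" by (intro parallel_spanned) auto
    moreover have "insert x ({y} \<union> C) = {x, y} \<union> C" by auto
    ultimately show False
      using rK[of "{x, y}"] rK[of "{y}"] K1[of y] K2[of x y] xy by auto
  qed
  have disj: "\<phi> ` W \<inter> C' = {}"
  proof (rule ccontr)
    assume "\<phi> ` W \<inter> C' \<noteq> {}"
    then obtain x c where xc: "x \<in> W" "c \<in> C" "rk M {c} = 1" "\<phi> x = \<phi> c" by (auto simp: C'_def)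
    then have "parallel M x c"
      using \<phi>(2)[of x] \<phi>(2)[of c] M1 WE CD(1) parallel_sym parallel_trans by (metis subsetD)
    then have "rk M (insert x C) = rk M C" using xc by (intro parallel_spanned) auto
    then show False using rK[of "{x}"] K1[of x] xc by auto
  qed
  have "has_minor (si M) K"
  proof (rule has_minorI[OF T(3) mK])
    show "C' \<subseteq> ground (si M)" "\<phi> ` ground K \<subseteq> ground (si M) - C'" "inj_on \<phi> (ground K)"
      using C'T \<phi>T disj inj gK T(2) by auto
    show "rk (si M) (\<phi> ` X \<union> C') = rk K X + rk (si M) C'" if "X \<subseteq> ground K" for X
    proof -
      have X: "X \<subseteq> W" using that gK by simp
      have "\<phi> ` X \<union> C' \<subseteq> T" using C'T \<phi>T X by blast
      then have "rk (si M) C' = rk M C'" "rk (si M) (\<phi> ` X \<union> C') = rk M (\<phi> ` X \<union> C')"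
        using T(4) C'T by blast+
      moreover have "rk M C' = rk M C" using rank[of "{}"] by simp
      ultimately show ?thesis using rank[OF X] rK[OF X] by linarith
    qed
  qed
  then show ?thesis using iso has_minor_iso unfolding K_def by blast
qed

end

section \<open>Minors of small size\<close>

context matroid
begin

lemma ex_circuit:
  assumes "X \<subseteq> ground M" "X \<notin> indep M"
  shows "\<exists>C \<subseteq> X. circuit M C"
  using finite_subset_ground[OF assms(1)] assms
proof (induction X rule: finite_psubset_induct)
  case (psubset X)
  show ?case
  proof (cases "\<forall>D. D \<subset> X \<longrightarrow> D \<in> indep M")
    case True
    then show ?thesis using psubset.prems unfolding circuit_def by blast
  next
    case False
    then obtain D where "D \<subset> X" "D \<notin> indep M" by blast
    then show ?thesis using psubset by (meson psubset_imp_subset subset_trans)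
  qed
qed

lemma circuit_rk:
  assumes "circuit M C"
  shows "rk M C + 1 = card C" "D \<subset> C \<Longrightarrow> rk M D = card D" "finite C"
proof -
  have C: "C \<subseteq> ground M" "C \<notin> indep M" "\<And>D. D \<subset> C \<Longrightarrow> D \<in> indep M"
    using assms by (auto simp: circuit_def)
  show fin: "finite C" using C finite_subset_ground by blast
  show "D \<subset> C \<Longrightarrow> rk M D = card D" using C rk_indep by blast
  have "C \<noteq> {}" using C(2) empty_indep by auto
  then obtain x where x: "x \<in> C" by blast
  have "rk M (C - {x}) = card (C - {x})" using C(3)[of "C - {x}"] x rk_indep by blast
  moreover have "rk M (C - {x}) \<le> rk M C" by (rule rk_mono) auto
  moreover have "rk M C \<noteq> card C" using C indep_iff_rk by blast
  moreover have "card C = card (C - {x}) + 1" using card.remove[OF fin x] by simp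
  ultimately show "rk M C + 1 = card C" using rk_le_card[OF fin] by linarith
qed

lemma circuitI:
  assumes "C \<subseteq> ground M" "rk M C < card C" "\<And>x. x \<in> C \<Longrightarrow> rk M (C - {x}) + 1 = card C"
  shows "circuit M C"
proof -
  have fin: "finite C" using assms(1) finite_subset_ground by blast
  have "D \<in> indep M" if D: "D \<subset> C" for D
  proof -
    obtain x where "x \<in> C" "x \<notin> D" using psubset_imp_ex_mem[OF D] by blast
    then have x: "x \<in> C" "D \<subseteq> C - {x}" using D by auto
    have "rk M (C - {x}) = card (C - {x})" using assms(3)[OF x(1)] card.remove[OF fin x(1)] by linarith
    then have "C - {x} \<in> indep M" using indep_iff_rk assms(1) by blast
    then show ?thesis using x(2) indep_subset by blast
  qed
  moreover have "C \<notin> indep M" using assms(2) indep_iff_rk by force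
  ultimately show ?thesis using assms(1) by (simp add: circuit_def)
qed

text \<open>Contracting elements of a circuit leaves a smaller circuit, so a circuit has all
  nonempty circuits of at most its size as minors.\<close>

lemma has_minor_circuit:
  assumes N: "matroid N" "circuit N (ground N)" and C: "circuit M C" "card (ground N) \<le> card C"
  shows "has_minor M N"
proof -
  interpret N: matroid N by (rule N(1))
  have fC: "finite C" "rk M C + 1 = card C" using circuit_rk C(1) by blast+
  have CE: "C \<subseteq> ground M" using C(1) by (simp add: circuit_def)
  obtain f where f: "inj_on f (ground N)" "f ` ground N \<subseteq> C"
    using card_le_inj[OF N.finite_ground fC(1) C(2)] by blast
  have cf: "card (f ` Z) = card Z" if "Z \<subseteq> ground N" for Z
    using f(1) that card_image inj_on_subset by blast
  have cd: "card (f ` Z \<union> (C - f ` ground N)) = card Z + card (C - f ` ground N)" if Z: "Z \<subseteq> ground N" for Z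
  proof -
    have "finite (f ` Z)" using Z N.finite_subset_ground by blast
    then show ?thesis using card_Un_disjoint[of "f ` Z" "C - f ` ground N"] fC(1) Z cf[OF Z] by auto
  qed
  have ne: "ground N \<noteq> {}" using N(2) N.empty_indep by (auto simp: circuit_def)
  show ?thesis
  proof (rule has_minorI[where f = f and C = "C - f ` ground N"])
    show "matroid M" by unfold_locales
    show "C - f ` ground N \<subseteq> ground M" "f ` ground N \<subseteq> ground M - (C - f ` ground N)"
      using CE f(2) by auto
    have small: "rk M (C - f ` ground N) = card (C - f ` ground N)"
      by (rule circuit_rk(2)[OF C(1)]) (use f(2) ne in blast)
    show "rk M (f ` Z \<union> (C - f ` ground N)) = rk N Z + rk M (C - f ` ground N)"
      if Z: "Z \<subseteq> ground N" for Z
    proof (cases "Z = ground N")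
      case True
      then have eq: "f ` Z \<union> (C - f ` ground N) = C" using f(2) by auto
      then have "card C = card (ground N) + card (C - f ` ground N)" using cd[OF Z] True by simp
      then show ?thesis
        using eq fC(2) small N.circuit_rk(1)[OF N(2)] True by simp
    next
      case False
      then obtain x where x: "x \<in> ground N" "x \<notin> Z" using Z by blast
      then have "f x \<notin> f ` Z" using f(1) Z by (meson inj_on_image_mem_iff)
      then have "f ` Z \<union> (C - f ` ground N) \<subset> C" using f(2) Z x by blast
      then have "rk M (f ` Z \<union> (C - f ` ground N)) = card (f ` Z \<union> (C - f ` ground N))"
        using circuit_rk(2)[OF C(1)] by blast
      moreover have "rk N Z = card Z" using N.circuit_rk(2)[OF N(2)] False Z by blast
      ultimately show ?thesis using cd[OF Z] small by simp
    qed
  qed (use N f in auto)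
qed

lemma ex_circuit_card_ge_3:
  assumes conn: "three_connected M" and card: "4 \<le> card (ground M)"
  shows "\<exists>C. circuit M C \<and> 3 \<le> card C"
proof -
  have "ground M \<noteq> {}" using card by auto
  then obtain x where x: "x \<in> ground M" by blast
  have "rk M (ground M) = rk M (ground M - {x})" using rk_Diff_single[OF conn card x] by simp
  also have "\<dots> \<le> card (ground M - {x})" by (rule rk_le_card) (use finite_ground in auto)
  also have "\<dots> < card (ground M)" using x finite_ground by (meson card_Diff1_less)
  finally have "ground M \<notin> indep M" using indep_iff_rk by auto
  then obtain C where C: "C \<subseteq> ground M" "circuit M C" using ex_circuit by blast
  have "3 \<le> card C"
  proof (rule ccontr)
    assume "\<not> ?thesis"
    then consider "card C = 0" | "card C = 1" | "card C = 2" by linarith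
    then show False
    proof cases
      case 1
      then show ?thesis using circuit_rk(1)[OF C(2)] by simp
    next
      case 2
      then obtain a where "C = {a}" by (rule card_1_singletonE)
      then show ?thesis using circuit_rk(1)[OF C(2)] rk_single[OF conn card, of a] C(1) by simp
    next
      case 3
      then obtain a b where "C = {a, b}" "a \<noteq> b" by (auto simp: card_2_iff)
      then show ?thesis using circuit_rk(1)[OF C(2)] rk_pair[OF conn card, of a b] C(1) by simp
    qed
  qed
  then show ?thesis using C by blast
qed

text \<open>For n = 2 or 3 elements connectivity gives 1 \<le> r \<le> n - 1, so the rank or the
  corank equals n - 1; a single element is a loop or a coloop. These matroids need separate
  treatment because they may fail to be simple, as U_{1,3} does.\<close>

lemma small_three_connected:
  assumes conn: "three_connected M" and card: "card (ground M) \<le> 3" and ne: "ground M \<noteq> {}"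
  shows "circuit M (ground M) \<or> circuit (dual M) (ground M)"
proof -
  let ?E = "ground M"
  interpret D: matroid "dual M" by (rule matroid_dual)
  have sum: "rk (dual M) ?E + rk M ?E = card ?E" by (rule rk_dual_ground)
  have "card ?E \<noteq> 0" using ne finite_ground by simp
  then consider "card ?E = 1" | "2 \<le> card ?E" by linarith
  then show ?thesis
  proof cases
    case 1
    then obtain a where a: "?E = {a}" by (rule card_1_singletonE)
    have aux: "circuit K {a}" if "matroid K" "ground K = {a}" "rk K {a} = 0" for K
      by (rule matroid.circuitI[OF that(1)]) (use that matroid.rk_empty[OF that(1)] in auto)
    have "rk M {a} = 0 \<or> rk (dual M) {a} = 0" using sum 1 a by auto
    then show ?thesis using aux[of M] aux[of "dual M"] a matroid_axioms D.matroid_axioms by auto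
  next
    case 2
    have aux: "circuit K (ground K)" if K: "matroid K" "three_connected K" "rk K (ground K) + 1 = card (ground K)"
        "2 \<le> card (ground K)" for K :: "'a matroid"
    proof (rule matroid.circuitI[OF K(1)])
      interpret K: matroid K by (rule K(1))
      show "rk K (ground K) < card (ground K)" using K(3) by simp
      fix x assume x: "x \<in> ground K"
      have "ground K \<noteq> {x}" using K(4) by auto
      then have "ground K - {x} \<noteq> {}" using x by blast
      then have "rk K (ground K) + 1 \<le> rk K {x} + rk K (ground K - {x})"
        using K.three_connected_rk1[OF K(2), of "{x}"] x by auto
      moreover have "rk K (ground K - {x}) \<le> rk K (ground K)" by (rule K.rk_mono) auto
      ultimately show "rk K (ground K - {x}) + 1 = card (ground K)"
        using K(3) K.rk_singleton_le[of x] by linarith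
    qed simp
    obtain x where x: "x \<in> ?E" using ne by blast
    have "?E \<noteq> {x}" using 2 by auto
    then have "?E - {x} \<noteq> {}" using x by blast
    then have c: "rk M ?E + 1 \<le> rk M {x} + rk M (?E - {x})"
      using three_connected_rk1[OF conn, of "{x}"] x by auto
    have "card (?E - {x}) < card ?E" using x finite_ground by (meson card_Diff1_less)
    then have lt: "rk M ?E < card ?E"
      using c rk_singleton_le[of x] rk_le_card[of "?E - {x}"] finite_ground by fastforce
    have "rk M (?E - {x}) \<le> rk M ?E" by (rule rk_mono) auto
    moreover have "rk M {x} \<le> rk M ?E" by (rule rk_mono) (use x in auto)
    ultimately have "1 \<le> rk M ?E" using c by linarith
    then have "rk M ?E + 1 = card ?E \<or> rk (dual M) ?E + 1 = card ?E" using lt sum card by linarith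
    then show ?thesis
      using aux[of M] aux[of "dual M"] 2 conn n_connected_dual[of 3] matroid_axioms D.matroid_axioms by auto
  qed
qed

lemma has_small_minor:
  assumes conn: "three_connected M" and card: "4 \<le> card (ground M)"
    and N: "matroid N" "three_connected N" "card (ground N) \<le> 3"
  shows "has_minor M N"
proof -
  interpret D: matroid "dual M" by (rule matroid_dual)
  interpret N: matroid N by (rule N(1))
  interpret DN: matroid "dual N" by (rule N.matroid_dual)
  show ?thesis
  proof (cases "ground N = {}")
    case True
    show ?thesis
      \<comment> \<open>No element has to be mapped, so any function serves; everything is
        deleted.\<close>
      by (rule has_minorI[where C = "{}" and f = undefined]) (use True N(1) matroid_axioms in auto)
  next
    case False
    obtain C where C: "circuit M C" "3 \<le> card C" using ex_circuit_card_ge_3[OF conn card] by blast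
    obtain C' where C': "circuit (dual M) C'" "3 \<le> card C'"
      using D.ex_circuit_card_ge_3 conn card n_connected_dual by auto
    from N.small_three_connected[OF N(2,3) False] show ?thesis
    proof
      assume "circuit N (ground N)"
      then show ?thesis using has_minor_circuit[OF N(1) _ C(1)] C(2) N(3) by linarith
    next
      assume "circuit (dual N) (ground N)"
      then have "has_minor (dual M) (dual N)"
        using D.has_minor_circuit[OF DN.matroid_axioms _ C'(1)] C'(2) N(3) by simp
      then have "has_minor (dual (dual M)) (dual (dual N))"
        by (rule has_minor_dual[OF D.matroid_axioms DN.matroid_axioms])
      then show ?thesis by simp
    qed
  qed
qed


section \<open>Minors across a 2-separation\<close>

text \<open>
  If \<open>(X, Y)\<close> is a 2-separation then \<open>M\<close> is a 2-sum with a basepoint \<open>p\<close>, and \<open>s S\<close> and \<open>t T\<close> below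
  say whether \<open>S\<close> and \<open>T\<close> span \<open>p\<close>.  An element \<open>b\<close> of \<open>X\<close> that is not parallel to \<open>p\<close> can be
  contracted together with as much of \<open>X\<close> as possible so that some element of \<open>X\<close> takes the place of \<open>p\<close>.
\<close>

lemma has_minor_contract_2_separation:
  assumes XE: "X \<subseteq> ground M" and sep: "rk M X + rk M (ground M - X) = rk M (ground M) + 1"
    and N: "is_minor N M" "three_connected N" "2 \<le> card (ground N)" "card (X \<inter> ground N) \<le> 1"
    and b: "b \<in> X" "rk M (insert b (ground M - X)) = rk M (ground M - X) + rk M {b}"
  shows "has_minor (contract M {b}) N"
proof -
  define Y where "Y = ground M - X"
  have XY: "X \<union> Y = ground M" "X \<inter> Y = {}" using XE by (auto simp: Y_def)
  have finX: "finite X" using XE finite_subset_ground by blast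
  have mN: "matroid N" using N(1) is_minor_matroid by blast
  interpret N: matroid N by (rule mN)
  obtain C D where CD: "C \<subseteq> ground M" "D \<subseteq> ground M" "C \<inter> D = {}" "N = delete (contract M C) D"
    using N(1) unfolding is_minor_def by blast
  define W where "W = ground N"
  have W: "W = ground M - C - D" using CD by (auto simp: W_def)
  have rN: "rk M (Z \<union> C) = rk N Z + rk M C" if "Z \<subseteq> W" for Z
    using rk_minor_add[OF CD(1), of Z D] that CD(4) W by simp
  \<comment> \<open>These are the local connectivities of S with Y and of X with T. Each takes only
    the values 0 and 1, since the local connectivity of X with Y is 1.\<close>
  define s where "s S = rk M S + rk M Y - rk M (S \<union> Y)" for S
  define t where "t T = rk M X + rk M T - rk M (X \<union> T)" for T
  have s_eq: "rk M (S \<union> Y) + s S = rk M S + rk M Y" for S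
    using rk_Un_le[of S Y] by (simp add: s_def)
  have t_eq: "rk M (X \<union> T) + t T = rk M X + rk M T" for T
    using rk_Un_le[of X T] by (simp add: t_def)
  have sX: "s X = 1" using sep XY s_eq[of X] by (simp add: Y_def)
  have s_mono: "s S \<le> s S'" if "S \<subseteq> S'" "S' \<subseteq> X" for S S'
  proof -
    have "rk M (S' \<union> Y) + rk M S \<le> rk M S' + rk M (S \<union> Y)"
      by (rule rk_submodular') (use that in auto)
    then show ?thesis using s_eq[of S] s_eq[of S'] by linarith
  qed
  have s01: "s S = 0 \<or> s S = 1" if "S \<subseteq> X" for S using s_mono[OF that] sX by force
  have t_le: "t T \<le> 1" if "T \<subseteq> Y" for T
  proof -
    have "rk M (X \<union> Y) + rk M T \<le> rk M (X \<union> T) + rk M Y"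
      by (rule rk_submodular') (use that in auto)
    then show ?thesis using s_eq[of X] t_eq[of T] sX by linarith
  qed
  \<comment> \<open>The rank formula of a 2-sum: one unit of rank is lost exactly when both parts
    span the basepoint. The first inequality settles s = 0, the second t = 0, and the first and
    third together settle s = t = 1.\<close>
  have key: "rk M (S \<union> T) + s S * t T = rk M S + rk M T" if S: "S \<subseteq> X" and T: "T \<subseteq> Y" for S T
  proof -
    have 1: "rk M (S \<union> Y) + rk M T \<le> rk M (S \<union> T) + rk M Y"
      by (rule rk_submodular') (use that in auto)
    have 2: "rk M (X \<union> T) + rk M S \<le> rk M (S \<union> T) + rk M X"
      by (rule rk_submodular') (use that in auto)
    have 3: "rk M (X \<union> Y) + rk M (S \<union> T) \<le> rk M (S \<union> Y) + rk M (X \<union> T)"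
      by (rule rk_submodular') (use that in auto)
    consider "s S = 0" | "t T = 0" | "s S = 1" "t T = 1" using s01[OF S] t_le[OF T] by linarith
    then show ?thesis
      by cases (use 1 2 3 s_eq[of S] t_eq[of T] s_eq[of X] sX rk_Un_le[of S T] in auto)
  qed
  have "s {b} = 0" using b(2) s_eq[of "{b}"] by (simp add: Y_def)
  then have ne: "{S. S \<subseteq> X \<and> b \<in> S \<and> s S = 0} \<noteq> {}"
    using b(1) by (intro ex_in_conv[THEN iffD1] exI[of _ "{b}"]) simp
  have "finite {S. S \<subseteq> X \<and> b \<in> S \<and> s S = 0}" using finX by auto
  from finite_has_maximal[OF this ne] obtain S where "S \<in> {S. S \<subseteq> X \<and> b \<in> S \<and> s S = 0}"
      and m: "\<forall>S' \<in> {S. S \<subseteq> X \<and> b \<in> S \<and> s S = 0}. S \<subseteq> S' \<longrightarrow> S = S'"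
    by (elim bexE)
  then have S: "S \<subseteq> X" "b \<in> S" "s S = 0" by simp_all
  have max: "S = S'" if "S' \<subseteq> X" "b \<in> S'" "s S' = 0" "S \<subseteq> S'" for S'
    using m that by simp
  \<comment> \<open>By maximality of S, adding any further element of X spans the basepoint; in M /
    S the element w is thus parallel to the basepoint and can replace it.\<close>
  obtain w where w: "w \<in> X" "w \<notin> S" using S sX by (cases "S = X") auto
  have sw: "s (insert w S) = 1" using max[of "insert w S"] s01[of "insert w S"] w S by auto
  have rw: "rk M (insert w S) = rk M S + 1"
  proof (rule ccontr)
    assume "\<not> ?thesis"
    then have eq: "rk M (insert w S) = rk M S"
      using rk_insert_le[of w S] rk_mono[of S "insert w S"] by force
    then have "rk M (S \<union> Y) = rk M (insert w S \<union> Y)" by (intro rk_same_span) auto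
    then show False using s_eq[of S] s_eq[of "insert w S"] sw S(3) eq by linarith
  qed
  define C1 where "C1 = C \<inter> X"
  define C2 where "C2 = C \<inter> Y"
  have C: "C1 \<subseteq> X" "C2 \<subseteq> Y" "C = C1 \<union> C2" using CD(1) XY by (auto simp: C1_def C2_def)
  have WC: "W \<inter> C = {}" "W \<subseteq> ground M" using W by auto
  \<comment> \<open>Only the part of the contracted set inside X is changed, from \<open>C1\<close>
    to S'. It suffices that all ranks over the new set differ from those over C by a
    constant.\<close>
  have main: "has_minor (contract M {b}) N"
    if "S' \<subseteq> X" "b \<in> S'" "inj_on f W" "f ` W \<subseteq> ground M - (S' \<union> C2)"
      and rk: "\<And>Z. Z \<subseteq> W \<Longrightarrow> rk M (f ` Z \<union> (S' \<union> C2)) + rk M C = rk M (Z \<union> C) + rk M (S' \<union> C2)" for S' f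
  proof (rule has_minor_contractI[OF matroid_axioms mN])
    show "S' \<union> C2 \<subseteq> ground M" "b \<in> S' \<union> C2" "inj_on f (ground N)" "f ` ground N \<subseteq> ground M - (S' \<union> C2)"
      using that C XY by (auto simp: W_def)
    show "rk M (f ` Z \<union> (S' \<union> C2)) = rk N Z + rk M (S' \<union> C2)" if "Z \<subseteq> ground N" for Z
      using that rk[of Z] rN[of Z] by (simp add: W_def)
  qed
  have split: "rk M (A \<union> T \<union> (B \<union> C2)) + s (A \<union> B) * t (T \<union> C2) = rk M (A \<union> B) + rk M (T \<union> C2)"
    if "A \<subseteq> X" "B \<subseteq> X" "T \<subseteq> Y" for A B T
    using key[of "A \<union> B" "T \<union> C2"] that C(2) by (simp add: Un_ac)
  show ?thesis
  proof (cases "W \<inter> X = {}")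
    case True
    then have WY: "W \<subseteq> Y" using WC XY by auto
    \<comment> \<open>Here N meets only Y and sees nothing of X except whether the contracted part
      spans the basepoint; S imitates one answer, \<open>insert w S\<close> the other.\<close>
    define S' where "S' = (if s C1 = 0 then S else insert w S)"
    have S': "S' \<subseteq> X" "b \<in> S'" "s S' = s C1" using S w sw s01[OF C(1)] by (auto simp: S'_def)
    show ?thesis
    proof (rule main[of S' id])
      show "id ` W \<subseteq> ground M - (S' \<union> C2)" using WY S'(1) XY WC C by auto
      show "rk M (id ` Z \<union> (S' \<union> C2)) + rk M C = rk M (Z \<union> C) + rk M (S' \<union> C2)" if "Z \<subseteq> W" for Z
        using split[of "{}" S' Z] split[of "{}" C1 Z] split[of "{}" S' "{}"] split[of "{}" C1 "{}"]
          S' C that WY by (simp add: subset_trans)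
    qed (use S' in auto)
  next
    case False
    then obtain v where v: "v \<in> W" "v \<in> X" by blast
    have "finite (X \<inter> W)" using finX by auto
    then have WX: "W \<inter> X = {v}"
      using N(4) v card_le_1_subset[of "X \<inter> W"] unfolding W_def by blast
    define W2 where "W2 = W - {v}"
    have W2: "W = insert v W2" "v \<notin> W2" "W2 \<subseteq> Y" using v WX WC XY by (auto simp: W2_def)
    have "W2 \<noteq> {}" using N(3) W2(1) by (auto simp: W_def)
    then have "rk N W + 1 \<le> rk N {v} + rk N (W - {v})"
      using N.three_connected_rk1[OF N(2), of "{v}"] v by (auto simp: W_def W2_def)
    then have nc: "rk N W + 1 \<le> rk N {v} + rk N W2" by (simp add: W2_def)
    have r1: "rk M (insert v C) = rk N {v} + rk M C" "rk M (insert v (W2 \<union> C)) = rk N W + rk M C" "rk M (W2 \<union> C) = rk N W2 + rk M C"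
      using rN[of "{v}"] rN[of W] rN[of W2] W2 by auto
    have e1: "rk M (insert v C) + s (insert v C1) * t C2 = rk M (insert v C1) + rk M C2"
      using split[of "{v}" C1 "{}"] v C by simp
    have e2: "rk M (insert v (W2 \<union> C)) + s (insert v C1) * t (W2 \<union> C2) = rk M (insert v C1) + rk M (W2 \<union> C2)"
      using split[of "{v}" C1 W2] v C W2 by simp
    have e3: "rk M (W2 \<union> C) + s C1 * t (W2 \<union> C2) = rk M C1 + rk M (W2 \<union> C2)"
      using split[of "{}" C1 W2] C W2 by simp
    have e4: "rk M C + s C1 * t C2 = rk M C1 + rk M C2"
      using split[of "{}" C1 "{}"] C by simp
    have le1: "s C1 \<le> s (insert v C1)" using s_mono[of C1 "insert v C1"] v C by auto
    \<comment> \<open>Otherwise v makes no difference to the spanning of the basepoint, the four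
      split equations make v a separate component of N, and N is not connected.\<close>
    have s1: "s C1 = 0 \<and> s (insert v C1) = 1"
    proof (rule ccontr)
      assume "\<not> ?thesis"
      then have "s (insert v C1) = s C1" using s01[of C1] s01[of "insert v C1"] le1 v C by auto
      then show False using nc r1 e1 e2 e3 e4 by simp
    qed
    have rv: "rk M (insert v C1) = rk M C1 + 1"
    proof (rule ccontr)
      assume "\<not> ?thesis"
      then have eq: "rk M (insert v C1) = rk M C1"
        using rk_insert_le[of v C1] rk_mono[of C1 "insert v C1"] by force
      then have "rk M (C1 \<union> Y) = rk M (insert v C1 \<union> Y)" by (intro rk_same_span) auto
      then show False using s_eq[of C1] s_eq[of "insert v C1"] s1 eq by linarith
    qed
    \<comment> \<open>Both elements stand for the basepoint: v after contracting \<open>C1\<close>,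
      w after contracting S.\<close>
    define f where "f = id(v := w)"
    have fW2: "f ` Z = Z" if "Z \<subseteq> W2" for Z using that W2(2) by (force simp: f_def)
    have wW2: "w \<notin> W2" using w W2 XY by auto
    show ?thesis
    proof (rule main[of S f])
      have "inj_on f W2" using W2(2) by (auto simp: f_def inj_on_def)
      then show "inj_on f W" using W2 wW2 fW2[of W2] by (auto simp: W2(1) f_def)
      have "W2 \<inter> C2 = {}" "W2 \<inter> S = {}" "w \<notin> C2" using WC W2 C S w XY by auto
      moreover have "f ` W = insert w W2" using W2 fW2[of W2] by (simp add: f_def)
      ultimately show "f ` W \<subseteq> ground M - (S \<union> C2)" using w W2 XY by auto
      fix Z assume Z: "Z \<subseteq> W"
      have base: "rk M (S \<union> C2) = rk M S + rk M C2" using split[of "{}" S "{}"] S by simp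
      show "rk M (f ` Z \<union> (S \<union> C2)) + rk M C = rk M (Z \<union> C) + rk M (S \<union> C2)"
      proof (cases "v \<in> Z")
        case False
        then have Z2: "Z \<subseteq> W2" using Z W2 by auto
        then show ?thesis
          using split[of "{}" S Z] split[of "{}" C1 Z] fW2[OF Z2] S C W2(3) s1 e4 base by auto
      next
        case True
        define Z2 where "Z2 = Z - {v}"
        have Z2: "Z2 \<subseteq> W2" "Z = insert v Z2" using Z True W2 by (auto simp: Z2_def)
        have "f ` Z = insert w Z2" unfolding Z2(2) image_insert fW2[OF Z2(1)] by (simp add: f_def)
        moreover have "rk M (insert w Z2 \<union> (S \<union> C2)) + t (Z2 \<union> C2) = rk M (insert w S) + rk M (Z2 \<union> C2)"
          using split[of "{w}" S Z2] w S Z2 W2(3) sw by auto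
        moreover have "rk M (Z \<union> C) + t (Z2 \<union> C2) = rk M (insert v C1) + rk M (Z2 \<union> C2)"
          using split[of "{v}" C1 Z2] v C Z2 W2(3) s1 by auto
        ultimately show ?thesis using rw rv e4 base s1 by simp
      qed
    qed (use S in auto)
  qed
qed

end

section \<open>Triangles, triads and swirl-like flowers\<close>

lemma all_less_4: "(\<forall>i < (4::nat). R i) \<longleftrightarrow> R 0 \<and> R 1 \<and> R 2 \<and> R 3"
  by (auto simp: numeral_eq_Suc less_Suc_eq)

lemma local_conn_commute: "local_conn M A B = local_conn M B A"
  by (simp add: local_conn_def Un_commute)

lemma swirl_like_flower_4:
  "swirl_like_flower M [A, B, C, D] \<longleftrightarrow> A \<union> (B \<union> (C \<union> D)) = ground M
    \<and> (A \<inter> B = {} \<and> A \<inter> C = {} \<and> A \<inter> D = {} \<and> B \<inter> C = {} \<and> B \<inter> D = {} \<and> C \<inter> D = {})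
    \<and> (2 \<le> card A \<and> 2 \<le> card B \<and> 2 \<le> card C \<and> 2 \<le> card D)
    \<and> (separating M 3 A \<and> separating M 3 B \<and> separating M 3 C \<and> separating M 3 D)
    \<and> (separating M 3 (A \<union> B) \<and> separating M 3 (B \<union> C) \<and> separating M 3 (C \<union> D) \<and> separating M 3 (D \<union> A))
    \<and> (local_conn M A B = 1 \<and> local_conn M B C = 1 \<and> local_conn M C D = 1 \<and> local_conn M D A = 1)
    \<and> local_conn M A C = 0 \<and> local_conn M B D = 0"
proof -
  have len: "length [A, B, C, D] = 4" by simp
  have nth: "[A, B, C, D] ! 0 = A" "[A, B, C, D] ! 1 = B" "[A, B, C, D] ! 2 = C" "[A, B, C, D] ! 3 = D"
    by (simp_all add: numeral_eq_Suc)
  have "\<Union> (set [A, B, C, D]) = A \<union> (B \<union> (C \<union> D))" by auto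
  then show ?thesis
    unfolding swirl_like_flower_def flower_def Let_def len all_less_4 nth
    by (simp add: nth[unfolded One_nat_def] nth Int_commute local_conn_commute, auto)
qed

context matroid
begin

lemma triangle_rk: "triangle M T \<Longrightarrow> T \<subseteq> ground M \<and> card T = 3 \<and> rk M T = 2"
  using circuit_rk(1)[of T] by (auto simp: triangle_def circuit_def)

lemma triangleI:
  assumes "three_connected M" "4 \<le> card (ground M)" "x \<in> ground M" "y \<in> ground M" "z \<in> ground M"
    "x \<noteq> y" "y \<noteq> z" "x \<noteq> z" "rk M {x, y, z} \<le> 2"
  shows "triangle M {x, y, z}"
proof -
  have c: "card {x, y, z} = 3" using assms by simp
  have "circuit M {x, y, z}"
  proof (rule circuitI)
    fix w assume w: "w \<in> {x, y, z}"
    have "{x, y, z} - {x} = {y, z}" "{x, y, z} - {y} = {x, z}" "{x, y, z} - {z} = {x, y}" using assms by auto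
    then show "rk M ({x, y, z} - {w}) + 1 = card {x, y, z}"
      using w c rk_pair[OF assms(1,2)] assms(3-8) by auto
  qed (use assms c in auto)
  then show ?thesis using c by (simp add: triangle_def)
qed

lemma triad_rk:
  assumes "triad M T"
  shows "T \<subseteq> ground M \<and> card T = 3 \<and> rk M (ground M - T) + 1 = rk M (ground M)"
proof -
  interpret D: matroid "dual M" by (rule matroid_dual)
  show ?thesis using D.triangle_rk[of T] rk_dual_add[of T] assms by (auto simp: triad_def)
qed

lemma triadI:
  assumes "three_connected M" "4 \<le> card (ground M)" "x \<in> ground M" "y \<in> ground M" "z \<in> ground M"
    "x \<noteq> y" "y \<noteq> z" "x \<noteq> z" "rk M (ground M - {x, y, z}) + 1 \<le> rk M (ground M)"
  shows "triad M {x, y, z}"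
proof -
  interpret D: matroid "dual M" by (rule matroid_dual)
  have "card {x, y, z} = 3" using assms by simp
  then have "rk (dual M) {x, y, z} \<le> 2" using rk_dual_add[of "{x, y, z}"] assms by simp
  then show ?thesis using D.triangleI assms n_connected_dual by (simp add: triad_def)
qed

lemma triad_dual: "triad (dual M) T \<longleftrightarrow> triangle M T"
  by (simp add: triad_def)

lemma swirl_like_flowerI:
  assumes part: "A \<union> B \<union> C \<union> D = ground M" "A \<inter> B = {}" "A \<inter> C = {}" "A \<inter> D = {}" "B \<inter> C = {}" "B \<inter> D = {}" "C \<inter> D = {}"
    and card: "2 \<le> card A" "2 \<le> card B" "2 \<le> card C" "2 \<le> card D"
    and sep: "rk M A + rk M (B \<union> C \<union> D) \<le> rk M (ground M) + 2" "rk M B + rk M (A \<union> C \<union> D) \<le> rk M (ground M) + 2"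
      "rk M C + rk M (A \<union> B \<union> D) \<le> rk M (ground M) + 2" "rk M D + rk M (A \<union> B \<union> C) \<le> rk M (ground M) + 2"
      "rk M (A \<union> B) + rk M (C \<union> D) \<le> rk M (ground M) + 2" "rk M (B \<union> C) + rk M (D \<union> A) \<le> rk M (ground M) + 2"
    and loc: "rk M A + rk M B = rk M (A \<union> B) + 1" "rk M B + rk M C = rk M (B \<union> C) + 1"
      "rk M C + rk M D = rk M (C \<union> D) + 1" "rk M D + rk M A = rk M (D \<union> A) + 1"
      "rk M A + rk M C = rk M (A \<union> C)" "rk M B + rk M D = rk M (B \<union> D)"
  shows "swirl_like_flower M [A, B, C, D]"
proof -
  let ?E = "ground M"
  have compl: "?E - A = B \<union> C \<union> D" "?E - B = A \<union> C \<union> D" "?E - C = A \<union> B \<union> D" "?E - D = A \<union> B \<union> C"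
    "?E - (A \<union> B) = C \<union> D" "?E - (B \<union> C) = D \<union> A" "?E - (C \<union> D) = A \<union> B" "?E - (D \<union> A) = B \<union> C"
    using part by blast+
  have sub: "A \<subseteq> ?E" "B \<subseteq> ?E" "C \<subseteq> ?E" "D \<subseteq> ?E" using part(1) by auto
  have "separating M 3 A" "separating M 3 B" "separating M 3 C" "separating M 3 D" "separating M 3 (A \<union> B)"
    "separating M 3 (B \<union> C)" "separating M 3 (C \<union> D)" "separating M 3 (D \<union> A)"
    unfolding separating_def conn_def compl using sub sep by simp_all
  moreover have "local_conn M A B = 1" "local_conn M B C = 1" "local_conn M C D = 1" "local_conn M D A = 1"
    "local_conn M A C = 0" "local_conn M B D = 0"
    unfolding local_conn_def using loc by linarith+
  moreover have "A \<union> (B \<union> (C \<union> D)) = ?E" using part(1) by auto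
  ultimately show ?thesis unfolding swirl_like_flower_4 using part card by blast
qed

lemma swirl_like_flower_rev: "swirl_like_flower M [A, B, C, D] \<Longrightarrow> swirl_like_flower M [D, C, B, A]"
  unfolding swirl_like_flower_4 by (simp add: Un_ac Int_ac local_conn_commute)

end


section \<open>Four-element fans\<close>

locale four_fan = matroid +
  fixes a b c d :: 'a
  assumes conn: "three_connected M"
    and rank_ge: "4 \<le> rk M (ground M)"
    and corank_ge: "4 \<le> rk (dual M) (ground M)"
    and triangle: "triangle M {a, b, c}"
    and triad: "triad M {b, c, d}"
    and dist: "distinct [a, b, c, d]"
begin

lemma four_fan_swap: "four_fan M a c b d"
  by unfold_locales (use conn rank_ge corank_ge triangle triad dist in \<open>auto simp: insert_commute\<close>)

lemma four_fan_dual: "four_fan (dual M) d b c a"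
proof -
  interpret D: matroid "dual M" by (rule matroid_dual)
  show ?thesis
    by unfold_locales
      (use conn rank_ge corank_ge triangle triad dist n_connected_dual[of 3] in
        \<open>auto simp: triad_def insert_commute\<close>)
qed

lemma card_ge: "8 \<le> card (ground M)"
  using rk_dual_ground rank_ge corank_ge by linarith

lemma card_ge_4: "4 \<le> card (ground M)"
  using card_ge by linarith

lemma in_ground: "a \<in> ground M" "b \<in> ground M" "c \<in> ground M" "d \<in> ground M"
  using triangle_rk[OF triangle] triad_rk[OF triad] by auto

lemma rk_triangle: "rk M {a, b, c} = 2"
  using triangle_rk[OF triangle] by simp

lemma rk_hyperplane: "rk M (ground M - {b, c, d}) + 1 = rk M (ground M)"
  using triad_rk[OF triad] by simp

lemmas rk_pair' = rk_pair[OF conn card_ge_4]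
lemmas rk_Diff_pair' = rk_Diff_pair[OF conn card_ge_4]

text \<open>Orthogonality with the triad in terms of rank. The complement of the triad is a
  hyperplane, any triad element added to it spans M because pairs are coindependent, and
  submodularity passes the increase on to subsets.\<close>

lemma rk_insert_hyperplane:
  assumes S: "S \<subseteq> ground M - {b, c, d}" and x: "x \<in> {b, c, d}"
  shows "rk M (insert x S) = rk M S + 1"
proof -
  have "{b, c, d} - {b} = {c, d}" "{b, c, d} - {c} = {b, d}" "{b, c, d} - {d} = {b, c}" using dist by auto
  then have "rk M (ground M - ({b, c, d} - {x})) = rk M (ground M)"
    using x rk_Diff_pair' in_ground dist by auto
  moreover have "insert x (ground M - {b, c, d}) = ground M - ({b, c, d} - {x})" using x in_ground by auto
  ultimately have "rk M (insert x (ground M - {b, c, d})) = rk M (ground M)" by simp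
  moreover have "rk M (insert x (ground M - {b, c, d})) + rk M S \<le> rk M (ground M - {b, c, d}) + rk M (insert x S)"
    by (rule rk_submodular') (use S in auto)
  ultimately show ?thesis using rk_hyperplane rk_insert_le[of x S] by linarith
qed

text \<open>The inclusion says that X contains the other two triangle elements, whichever of the
  three x is; those two span the triangle.\<close>

lemma rk_insert_triangle:
  assumes "{a, b, c} \<subseteq> insert x X" "x \<in> {a, b, c}"
  shows "rk M (insert x X) = rk M X"
proof (rule rk_spanned_mono)
  show "{a, b, c} - {x} \<subseteq> X" using assms by auto
  have "{a, b, c} - {a} = {b, c}" "{a, b, c} - {b} = {a, c}" "{a, b, c} - {c} = {a, b}" using dist by auto
  then have "rk M ({a, b, c} - {x}) = 2" using assms(2) rk_pair' in_ground dist by auto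
  moreover have "insert x ({a, b, c} - {x}) = {a, b, c}" using assms(2) by auto
  ultimately show "rk M (insert x ({a, b, c} - {x})) = rk M ({a, b, c} - {x})" using rk_triangle by simp
qed

lemma rk_triad: "rk M {b, c, d} = 3"
proof -
  have "card {b, c, d} = 3" using dist by simp
  moreover from this have "2 \<le> card (ground M - {b, c, d})"
    using card_ge card_Diff_ge[of "{b, c, d}"] in_ground by simp
  moreover have "rk M {b, c, d} \<le> card {b, c, d}" by (rule rk_le_card) simp
  ultimately show ?thesis
    using three_connected_rk2[OF conn, of "{b, c, d}"] rk_hyperplane in_ground by auto
qed

lemma rk_fan: "rk M {a, b, c, d} = 3"
  using rk_insert_triangle[of a "{b, c, d}"] rk_triad by auto

lemma rk_co_fan: "rk M (ground M - {a, b, c, d}) + 1 = rk M (ground M)"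
proof -
  have "card {a, b, c, d} = 4" using dist by simp
  then have "2 \<le> card (ground M - {a, b, c, d})"
    using card_ge card_Diff_ge[of "{a, b, c, d}"] in_ground by simp
  then have "rk M (ground M) + 2 \<le> rk M {a, b, c, d} + rk M (ground M - {a, b, c, d})"
    using three_connected_rk2[OF conn, of "{a, b, c, d}"] in_ground \<open>card {a, b, c, d} = 4\<close> by simp
  moreover have "rk M (ground M - {a, b, c, d}) \<le> rk M (ground M - {b, c, d})" by (rule rk_mono) auto
  ultimately show ?thesis using rk_fan rk_hyperplane by linarith
qed

text \<open>The hyperplane avoiding the triad and its subset E - F have the same rank r(M) - 1, so a
  is spanned from that side, and on the other side by the pair b, c. The assumption r(M) \<ge> 4
  gives the far side rank at least 3.\<close>

lemma vertical_3_separation_end: "vertical_3_separation M {b, c, d} a (ground M - {a, b, c, d})"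
proof -
  have "insert a (ground M - {a, b, c, d}) = ground M - {b, c, d}" using in_ground dist by auto
  then show ?thesis
    unfolding vertical_3_separation_iff[OF conn]
    using in_ground dist rk_triad rk_fan rk_co_fan rk_hyperplane rank_ge by auto
qed

lemma not_elastic_first: "\<not> elastic M a"
  using vertical_3_separation_end elastic_iff[OF conn card_ge_4 in_ground(1)] by blast

lemma ex_dual_vertical_3_separation_last: "\<exists>P Q. vertical_3_separation (dual M) P d Q"
proof -
  interpret D: four_fan "dual M" d b c a by (rule four_fan_dual)
  show ?thesis using D.vertical_3_separation_end by blast
qed

lemma not_elastic_last: "\<not> elastic M d"
  using ex_dual_vertical_3_separation_last elastic_iff[OF conn card_ge_4 in_ground(4)] by blast

end

lemma (in matroid) vertical_3_separation_commute:
  "vertical_3_separation M P x Q \<Longrightarrow> three_connected M \<Longrightarrow> vertical_3_separation M Q x P"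
  by (auto simp: vertical_3_separation_iff)

section \<open>Vertical 3-separations at a middle element of a four-element fan\<close>

context four_fan
begin

text \<open>If c and d were on one side, the other side would avoid the triad and could not span b.
  If a were not with c, then c could move across: its old side loses rank by the triad, the new one
  gains none by the triangle, and a 2-separation would arise.\<close>

lemma vertical_3_separation_second:
  assumes "vertical_3_separation M P b Q"
  shows "a \<in> P \<and> c \<in> P \<and> d \<in> Q \<or> a \<in> Q \<and> c \<in> Q \<and> d \<in> P"
proof -
  have no: "\<not> (c \<in> Q \<and> d \<in> Q)" if v: "vertical_3_separation M P b Q" for P Q
  proof
    assume cd: "c \<in> Q \<and> d \<in> Q"
    have V: "P \<union> Q = ground M - {b}" "P \<inter> Q = {}" "rk M (insert b P) = rk M P"
      using v unfolding vertical_3_separation_iff[OF conn] by auto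
    have "rk M (insert b P) = rk M P + 1" by (rule rk_insert_hyperplane) (use V cd in auto)
    then show False using V by simp
  qed
  have aP: "a \<in> P" if v: "vertical_3_separation M P b Q" and cd: "c \<in> P" "d \<in> Q" for P Q
  proof (rule ccontr)
    assume "a \<notin> P"
    have V: "P \<union> Q = ground M - {b}" "P \<inter> Q = {}" "rk M (insert b Q) = rk M Q" "3 \<le> rk M P" "3 \<le> rk M Q"
      "rk M P + rk M Q = rk M (ground M) + 2"
      using v unfolding vertical_3_separation_iff[OF conn] by auto
    have fin: "finite P" "finite Q" using V(1) finite_ground by (metis finite_Diff finite_Un)+
    have aQ: "a \<in> Q" using \<open>a \<notin> P\<close> V(1) in_ground dist by auto
    have "rk M (insert c (P - {c})) = rk M (P - {c}) + 1"
      by (rule rk_insert_hyperplane) (use V cd in auto)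
    then have 1: "rk M P = rk M (P - {c}) + 1" using cd by (simp add: insert_absorb)
    have 2: "rk M (insert c (insert b Q)) = rk M (insert b Q)"
      by (rule rk_insert_triangle) (use aQ in auto)
    have nb: "b \<notin> Q" using V(1) by auto
    have "2 \<le> card (P - {c})" "2 \<le> card (insert c (insert b Q))"
      using V(4,5) rk_le_card[of P] rk_le_card[of Q] fin cd nb by (auto simp: card_insert_if)
    then have "rk M (ground M) + 2 \<le> rk M (P - {c}) + rk M (insert c (insert b Q))"
      by (intro three_connected_rk2'[OF conn]) (use V cd nb in_ground dist in auto)
    then show False using 1 2 V by linarith
  qed
  have "c \<in> P \<union> Q" "d \<in> P \<union> Q"
    using assms in_ground dist unfolding vertical_3_separation_iff[OF conn] by auto
  then show ?thesis
    using no aP assms vertical_3_separation_commute[OF _ conn] by blast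
qed

end

locale four_fan_separation = four_fan +
  fixes P Q
  assumes sep: "vertical_3_separation M P b Q"
    and side: "a \<in> P" "c \<in> P" "d \<in> Q"
begin

lemma parts: "P \<union> Q = ground M - {b}" "P \<inter> Q = {}" "b \<notin> P" "b \<notin> Q"
  and rk_sides: "3 \<le> rk M P" "3 \<le> rk M Q" "rk M (insert b P) = rk M P" "rk M (insert b Q) = rk M Q"
    "rk M P + rk M Q = rk M (ground M) + 2"
  using sep unfolding vertical_3_separation_iff[OF conn] by auto

lemma fin: "finite P" "finite Q"
  using parts(1) finite_ground by (metis finite_Diff finite_Un)+

lemma card_sides: "3 \<le> card P" "3 \<le> card Q"
  using rk_sides(1,2) rk_le_card fin by (meson order_trans)+

lemma card_petals: "card (P - {a, c}) + 2 = card P" "card (Q - {d}) + 1 = card Q"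
proof -
  have "card (P - {a, c}) = card P - card {a, c}" by (rule card_Diff_subset) (use side in auto)
  then show "card (P - {a, c}) + 2 = card P" using card_sides(1) dist by auto
  show "card (Q - {d}) + 1 = card Q" using card.remove[OF fin(2) side(3)] by simp
qed

lemma rk_P_minus_c: "rk M (P - {c}) + 1 = rk M P"
proof -
  have "rk M (insert c (P - {c})) = rk M (P - {c}) + 1"
    by (rule rk_insert_hyperplane) (use parts side in auto)
  then show ?thesis using side by (simp add: insert_absorb)
qed

lemma rk_Q_minus_d: "rk M (Q - {d}) + 1 = rk M Q"
proof -
  have "rk M (insert d (Q - {d})) = rk M (Q - {d}) + 1"
    by (rule rk_insert_hyperplane) (use parts side in auto)
  then show ?thesis using side by (simp add: insert_absorb)
qed

text \<open>A side of size 3 has rank exactly 3, so its complement \<open>insert b Q\<close> has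
  rank r(M) - 1.\<close>

lemma triad_of_card_3:
  assumes "card P = 3"
  shows "\<exists>g. P = {a, c, g} \<and> g \<noteq> a \<and> g \<noteq> c \<and> triad M {a, c, g}"
proof -
  have "card (P - {a, c}) = 1" using card_petals assms by simp
  then obtain g where "P - {a, c} = {g}" by (rule card_1_singletonE)
  then have g: "P = {a, c, g}" "g \<noteq> a" "g \<noteq> c" using side by auto
  have "ground M - {a, c, g} = insert b Q" using parts g(1) in_ground by auto
  moreover have "rk M P \<le> 3" using rk_le_card[OF fin(1)] assms by simp
  ultimately have "triad M {a, c, g}"
    using rk_sides in_ground g parts dist by (intro triadI[OF conn card_ge_4]) auto
  then show ?thesis using g by blast
qed

context
  assumes big: "card P \<noteq> 3"
begin

lemma card_A: "2 \<le> card (P - {a, c})"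
  using card_petals card_sides big by linarith

text \<open>Moving a and c across raises the rank of the other side by at most one, because Q spans
  b and the triangle is a line. By 3-connectivity P then loses at most one; removing c alone already
  costs one. The assumption on \<open>card P\<close> leaves at least two elements behind.\<close>

lemma rk_A: "rk M (P - {a, c}) + 1 = rk M P"
  and rk_QF: "rk M (Q \<union> {a, b, c}) = rk M Q + 1"
proof -
  have "rk M (Q \<union> {a, b, c}) + rk M {b} \<le> rk M (insert b Q) + rk M {a, b, c}"
    by (rule rk_submodular') auto
  then have 1: "rk M (Q \<union> {a, b, c}) \<le> rk M Q + 1"
    using rk_single[OF conn card_ge_4 in_ground(2)] rk_triangle rk_sides by linarith
  have "card Q \<le> card (Q \<union> {a, b, c})" by (rule card_mono) (use fin in auto)
  then have "2 \<le> card (Q \<union> {a, b, c})" using card_sides(2) by linarith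
  then have "rk M (ground M) + 2 \<le> rk M (P - {a, c}) + rk M (Q \<union> {a, b, c})"
    by (intro three_connected_rk2'[OF conn]) (use parts side in_ground card_A in auto)
  moreover have "rk M (P - {a, c}) \<le> rk M (P - {c})" by (rule rk_mono) auto
  ultimately show "rk M (P - {a, c}) + 1 = rk M P" "rk M (Q \<union> {a, b, c}) = rk M Q + 1"
    using 1 rk_P_minus_c rk_sides by linarith+
qed

lemma swirl: "swirl_like_flower M [P - {a, c}, {a, c}, {b, d}, Q - {d}]"
proof (rule swirl_like_flowerI)
  let ?A = "P - {a, c}" and ?Q = "Q - {d}"
  have E: "P \<union> insert b Q = ground M" using parts in_ground by auto
  show "?A \<union> {a, c} \<union> {b, d} \<union> ?Q = ground M" using E side by auto
  show "?A \<inter> {a, c} = {}" "?A \<inter> {b, d} = {}" "?A \<inter> ?Q = {}" "{a, c} \<inter> {b, d} = {}" "{a, c} \<inter> ?Q = {}" "{b, d} \<inter> ?Q = {}"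
    using parts side dist by auto
  show "2 \<le> card ?A" by (rule card_A)
  show "2 \<le> card {a, c}" "2 \<le> card {b, d}" using dist by auto
  show "2 \<le> card ?Q" using card_petals card_sides by linarith
  have pairs: "rk M {a, c} = 2" "rk M {b, d} = 2" using rk_pair' in_ground dist by auto
  have r_le: "rk M X \<le> rk M (ground M)" if "X \<subseteq> ground M" for X using that by (rule rk_mono)
  have s1: "{a, c} \<union> {b, d} \<union> ?Q = Q \<union> {a, b, c}" using side by auto
  show "rk M ?A + rk M ({a, c} \<union> {b, d} \<union> ?Q) \<le> rk M (ground M) + 2"
    unfolding s1 using rk_A rk_QF rk_sides by linarith
  have "?A \<union> {b, d} \<union> ?Q \<subseteq> ground M" "?A \<union> {a, c} \<union> ?Q \<subseteq> ground M" using parts in_ground by auto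
  then show "rk M {a, c} + rk M (?A \<union> {b, d} \<union> ?Q) \<le> rk M (ground M) + 2"
    "rk M {b, d} + rk M (?A \<union> {a, c} \<union> ?Q) \<le> rk M (ground M) + 2"
    using pairs r_le by simp_all
  have s3: "?A \<union> {a, c} \<union> {b, d} = insert d (insert b P)" using side by auto
  have s2: "?A \<union> {a, c} = P" "{b, d} \<union> ?Q = insert b Q"
    "{a, c} \<union> {b, d} = {a, b, c, d}" using side by auto
  have Pbd: "rk M (insert d (insert b P)) \<le> rk M P + 1" using rk_insert_le[of d "insert b P"] rk_sides by simp
  then show "rk M ?Q + rk M (?A \<union> {a, c} \<union> {b, d}) \<le> rk M (ground M) + 2"
    unfolding s3 using rk_Q_minus_d rk_sides by linarith
  show "rk M (?A \<union> {a, c}) + rk M ({b, d} \<union> ?Q) \<le> rk M (ground M) + 2" unfolding s2 using rk_sides by linarith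
  have QA: "?Q \<union> ?A = ground M - {a, b, c, d}" using parts side by auto
  show "rk M ({a, c} \<union> {b, d}) + rk M (?Q \<union> ?A) \<le> rk M (ground M) + 2"
    unfolding s2 QA using rk_fan rk_co_fan by linarith
  show "rk M ?A + rk M {a, c} = rk M (?A \<union> {a, c}) + 1" unfolding s2 using rk_A pairs by linarith
  show "rk M {a, c} + rk M {b, d} = rk M ({a, c} \<union> {b, d}) + 1" unfolding s2 using rk_fan pairs by linarith
  show "rk M {b, d} + rk M ?Q = rk M ({b, d} \<union> ?Q) + 1" unfolding s2 using rk_Q_minus_d rk_sides pairs by linarith
  show "rk M ?Q + rk M ?A = rk M (?Q \<union> ?A) + 1"
    unfolding QA using rk_Q_minus_d rk_A rk_co_fan rk_sides by linarith
  show "rk M ?A + rk M {b, d} = rk M (?A \<union> {b, d})"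
  proof -
    \<comment> \<open>The petal \<open>P - {a, c}\<close> has rank one less than P, so together with
      b it spans P; the rank of its union with b and d can be read off from P.\<close>
    have Ab: "rk M (insert b ?A) = rk M ?A + 1" by (rule rk_insert_hyperplane) (use parts side in auto)
    have "rk M (insert b ?A \<union> {d}) = rk M (insert b P \<union> {d})"
      by (rule rk_same_span) (use Ab rk_A rk_sides in auto)
    moreover have "rk M (ground M) + 2 \<le> rk M ?Q + rk M (insert d (insert b P))"
    proof (rule three_connected_rk2'[OF conn])
      have "card P \<le> card (insert d (insert b P))" by (rule card_mono) (use fin in auto)
      then show "2 \<le> card (insert d (insert b P))" using card_sides by linarith
      show "2 \<le> card ?Q" using card_petals card_sides by linarith
    qed (use parts side in_ground in auto)
    moreover have "insert b ?A \<union> {d} = ?A \<union> {b, d}" by auto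
    ultimately show ?thesis using Pbd rk_A rk_Q_minus_d rk_sides pairs by simp
  qed
  show "rk M {a, c} + rk M ?Q = rk M ({a, c} \<union> ?Q)"
  proof -
    \<comment> \<open>Likewise \<open>Q - {d}\<close> together with b spans Q, and the triangle
      allows b to be dropped once a and c are present.\<close>
    have Qb: "rk M (insert b ?Q) = rk M ?Q + 1" by (rule rk_insert_hyperplane) (use parts side in auto)
    have "rk M (insert b ?Q \<union> {a, c}) = rk M (insert b Q \<union> {a, c})"
      by (rule rk_same_span) (use Qb rk_Q_minus_d rk_sides in auto)
    moreover have "rk M (insert b ({a, c} \<union> ?Q)) = rk M ({a, c} \<union> ?Q)" by (rule rk_insert_triangle) auto
    moreover have "insert b Q \<union> {a, c} = Q \<union> {a, b, c}" "insert b ?Q \<union> {a, c} = insert b ({a, c} \<union> ?Q)" by auto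
    ultimately show ?thesis using rk_QF rk_Q_minus_d pairs by simp
  qed
qed

lemma dual_vertical_3_separation_c: "vertical_3_separation (dual M) (P - {c}) c (insert b Q)"
proof -
  let ?E = "ground M"
  interpret D: matroid "dual M" by (rule matroid_dual)
  have Dconn: "three_connected (dual M)" using conn n_connected_dual by blast
  have rd: "rk (dual M) X + rk M ?E = card X + rk M (?E - X)" if "X \<subseteq> ?E" for X using rk_dual_add[OF that] .
  have compl: "?E - P = insert b Q" "?E - (P - {c}) = insert c (insert b Q)" "?E - insert b Q = P"
     "?E - insert c (insert b Q) = P - {c}"
    using parts side in_ground dist by auto
  have sub: "P \<subseteq> ?E" "P - {c} \<subseteq> ?E" "insert b Q \<subseteq> ?E" "insert c (insert b Q) \<subseteq> ?E" using parts in_ground by auto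
  have cQ: "c \<notin> insert b Q" using parts side dist by auto
  have cards: "card P = card (P - {c}) + 1" "card (insert b Q) = card Q + 1" "card (insert c (insert b Q)) = card Q + 2"
    using card.remove[OF fin(1) side(2)] fin(2) cQ parts(4) by simp_all
  have "rk M (insert a (insert c (insert b Q))) = rk M (insert c (insert b Q))"
    by (rule rk_insert_triangle) auto
  moreover have "insert a (insert c (insert b Q)) = Q \<union> {a, b, c}" by auto
  ultimately have rQ: "rk M (insert c (insert b Q)) = rk M Q + 1" using rk_QF by simp
  have "rk M (P - {a, c}) \<le> card (P - {a, c})" by (rule rk_le_card) (use fin in simp)
  \<comment> \<open>The dual rank of P is |P| + 2 - r(P), so dependence of P is what makes this side
    vertical in the dual.\<close>
  then have "rk M P < card P" using rk_A card_petals by linarith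
  moreover have "rk M Q \<le> card Q" by (rule rk_le_card[OF fin(2)])
  moreover note rd[OF sub(1), unfolded compl] rd[OF sub(2), unfolded compl] rd[OF sub(3), unfolded compl] rd[OF sub(4), unfolded compl]
  moreover have "card ?E = card P + card (insert b Q)" using card_Diff_ge[OF sub(1)] compl by simp
  moreover note rk_sides cards rQ rk_P_minus_c rk_dual_ground
  ultimately have "3 \<le> rk (dual M) (P - {c})" "3 \<le> rk (dual M) (insert b Q)" "rk (dual M) P = rk (dual M) (P - {c})"
    "rk (dual M) (insert c (insert b Q)) = rk (dual M) (insert b Q)"
    "rk (dual M) (P - {c}) + rk (dual M) (insert b Q) = rk (dual M) ?E + 2"
    by linarith+
  moreover have "insert c (P - {c}) = P" "(P - {c}) \<union> insert b Q = ?E - {c}" "(P - {c}) \<inter> insert b Q = {}"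
    using side parts in_ground cQ by auto
  ultimately show ?thesis
    unfolding D.vertical_3_separation_iff[OF Dconn] using in_ground by simp
qed

end

end

section \<open>The flower of a six-element fan\<close>

context matroid
begin

text \<open>The six elements have rank at most 4, since only g6 can add to the rank of the first
  fan. The rest lies in two hyperplanes and has rank at most r(M) - 2. By 3-connectivity both bounds
  are attained, and these two values determine the local connectivities.\<close>

lemma six_fan_swirl:
  assumes F1: "four_fan M g1 g2 g3 g4" and F2: "four_fan M g3 g4 g5 g6"
    and dist: "distinct [g1, g2, g3, g4, g5, g6]"
  shows "swirl_like_flower M [ground M - {g1, g2, g3, g4, g5, g6}, {g1, g2}, {g3, g4}, {g5, g6}]"
proof -
  let ?E = "ground M"
  let ?S = "{g1, g2, g3, g4, g5, g6}"
  let ?A = "?E - ?S"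
  interpret F1: four_fan M g1 g2 g3 g4 by (rule F1)
  interpret F2: four_fan M g3 g4 g5 g6 by (rule F2)
  have S: "?S \<subseteq> ?E" "card ?S = 6" using F1.in_ground F2.in_ground dist by auto
  then have cA: "2 \<le> card ?A" using F1.card_ge card_Diff_ge[OF S(1)] by linarith
  have Su: "insert g6 (insert g5 {g1, g2, g3, g4}) = ?S" by auto
  have "rk M (insert g5 {g1, g2, g3, g4}) = rk M {g1, g2, g3, g4}"
    by (rule F2.rk_insert_triangle) auto
  then have rS: "rk M ?S \<le> 4" using rk_insert_le[of g6 "insert g5 {g1, g2, g3, g4}"] F1.rk_fan unfolding Su by linarith
  \<comment> \<open>The two triads share only g4, so the union of the complementary hyperplanes is
    everything but g4, which still spans M.\<close>
  have "rk M (?E - {g4}) + rk M ?A \<le> rk M (?E - {g2, g3, g4}) + rk M (?E - {g4, g5, g6})"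
    by (rule rk_submodular') (use dist in auto)
  then have rA: "rk M ?A + 2 \<le> rk M ?E"
    using rk_Diff_single[OF F1.conn F1.card_ge_4 F1.in_ground(4)] F1.rk_hyperplane F2.rk_hyperplane by linarith
  have "rk M ?E + 2 \<le> rk M ?S + rk M ?A"
    by (rule three_connected_rk2[OF F1.conn S(1)]) (use S(2) cA in auto)
  then have r: "rk M ?S = 4" "rk M ?A + 2 = rk M ?E" using rS rA by linarith+
  have un: "{g1, g2} \<union> {g3, g4} \<union> {g5, g6} = ?S" "?A \<union> {g1, g2} = ?E - {g3, g4, g5, g6}"
      "{g3, g4} \<union> {g5, g6} = {g3, g4, g5, g6}"
      "{g5, g6} \<union> ?A = ?E - {g1, g2, g3, g4}"
    using dist S(1) by auto
  have un2: "{g1, g2} \<union> {g3, g4} = {g1, g2, g3, g4}" by auto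
  have pair: "rk M {g1, g2} = 2" "rk M {g3, g4} = 2" "rk M {g5, g6} = 2"
    using rk_pair[OF F1.conn F1.card_ge_4] S(1) dist by auto
  have le: "rk M X \<le> rk M ?E" if "X \<subseteq> ?E" for X using that by (rule rk_mono)
  show ?thesis
  proof (rule swirl_like_flowerI)
    show "?A \<union> {g1, g2} \<union> {g3, g4} \<union> {g5, g6} = ?E" using S(1) by auto
    show "2 \<le> card ?A" by (rule cA)
    show "rk M ?A + rk M ({g1, g2} \<union> {g3, g4} \<union> {g5, g6}) \<le> rk M ?E + 2"
      unfolding un using r by linarith
    show "rk M {g1, g2} + rk M (?A \<union> {g3, g4} \<union> {g5, g6}) \<le> rk M ?E + 2"
      "rk M {g3, g4} + rk M (?A \<union> {g1, g2} \<union> {g5, g6}) \<le> rk M ?E + 2"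
      "rk M {g5, g6} + rk M (?A \<union> {g1, g2} \<union> {g3, g4}) \<le> rk M ?E + 2"
      using le[of "?A \<union> {g3, g4} \<union> {g5, g6}"] le[of "?A \<union> {g1, g2} \<union> {g5, g6}"] le[of "?A \<union> {g1, g2} \<union> {g3, g4}"]
        pair S(1) by auto
    show "rk M (?A \<union> {g1, g2}) + rk M ({g3, g4} \<union> {g5, g6}) \<le> rk M ?E + 2"
      unfolding un using F2.rk_fan F2.rk_co_fan by linarith
    show "rk M ({g1, g2} \<union> {g3, g4}) + rk M ({g5, g6} \<union> ?A) \<le> rk M ?E + 2"
      unfolding un un2 using F1.rk_fan F1.rk_co_fan by linarith
    show "rk M ?A + rk M {g1, g2} = rk M (?A \<union> {g1, g2}) + 1"
      unfolding un using r pair F2.rk_co_fan by linarith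
    show "rk M {g1, g2} + rk M {g3, g4} = rk M ({g1, g2} \<union> {g3, g4}) + 1"
      unfolding un2 using F1.rk_fan pair by linarith
    show "rk M {g3, g4} + rk M {g5, g6} = rk M ({g3, g4} \<union> {g5, g6}) + 1"
      unfolding un using F2.rk_fan pair by linarith
    show "rk M {g5, g6} + rk M ?A = rk M ({g5, g6} \<union> ?A) + 1"
      unfolding un using F1.rk_co_fan pair r by linarith
    have "rk M (insert g3 ?A) = rk M ?A + 1" by (rule F1.rk_insert_hyperplane) auto
    moreover have "rk M (insert g4 (insert g3 ?A)) = rk M (insert g3 ?A) + 1"
      by (rule F2.rk_insert_hyperplane) (use dist S(1) in auto)
    moreover have "?A \<union> {g3, g4} = insert g4 (insert g3 ?A)" by auto
    ultimately show "rk M ?A + rk M {g3, g4} = rk M (?A \<union> {g3, g4})" using r pair by simp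
    have "rk M (insert g3 {g1, g2, g5, g6}) = rk M {g1, g2, g5, g6}"
      by (rule F1.rk_insert_triangle) auto
    moreover have "rk M (insert g4 (insert g3 {g1, g2, g5, g6})) = rk M (insert g3 {g1, g2, g5, g6})"
      by (rule F2.rk_insert_triangle) auto
    moreover have "insert g4 (insert g3 {g1, g2, g5, g6}) = ?S" "{g1, g2} \<union> {g5, g6} = {g1, g2, g5, g6}" by auto
    ultimately show "rk M {g1, g2} + rk M {g5, g6} = rk M ({g1, g2} \<union> {g5, g6})" using r pair by simp
  qed (use dist in auto)
qed

end


section \<open>The cycle matroid of \<open>K\<^sub>4\<close>\<close>

text \<open>
  The edges of \<open>K\<^sub>4\<close> are listed as \<open>12, 01, 02, 03, 23, 13\<close>; the seven forbidden patterns are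
  the four triangles and the three 4-cycles.
\<close>

definition K4_acyclic :: "bool \<Rightarrow> bool \<Rightarrow> bool \<Rightarrow> bool \<Rightarrow> bool \<Rightarrow> bool \<Rightarrow> bool" where
  "K4_acyclic p1 p2 p3 p4 p5 p6 \<longleftrightarrow>
     \<not> (p1 \<and> p2 \<and> p3) \<and> \<not> (p3 \<and> p4 \<and> p5) \<and> \<not> (p2 \<and> p4 \<and> p6) \<and> \<not> (p1 \<and> p5 \<and> p6)
     \<and> \<not> (p2 \<and> p3 \<and> p5 \<and> p6) \<and> \<not> (p1 \<and> p3 \<and> p4 \<and> p6) \<and> \<not> (p1 \<and> p2 \<and> p4 \<and> p5)"

lemma complete_graph_4: "complete_graph 4 = {{1, 2}, {0, 1}, {0, 2}, {0, 3}, {2, 3}, {1, 3}}"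
proof -
  have lt: "x < 4 \<longleftrightarrow> x = 0 \<or> x = 1 \<or> x = 2 \<or> x = 3" for x :: nat by auto
  show ?thesis
  proof (intro set_eqI iffI)
    fix e assume "e \<in> complete_graph 4"
    then obtain x y where xy: "e = {x, y}" "x \<noteq> y" "x < 4" "y < 4"
      by (auto simp: complete_graph_def card_2_iff)
    then show "e \<in> {{1, 2}, {0, 1}, {0, 2}, {0, 3}, {2, 3}, {1, 3}}"
      unfolding lt by (elim disjE) (simp_all add: insert_commute)
  qed (auto simp: complete_graph_def)
qed

lemma cycle_edges_3: "cycle_edges [x, y, z] = {{x, y}, {y, z}, {z, x}}"
proof -
  have "cycle_edges [x, y, z] = (\<lambda>i. {[x, y, z] ! i, [x, y, z] ! (Suc i mod 3)}) ` {..<3}"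
    by (auto simp: cycle_edges_def)
  also have "{..<3} = {0, 1, 2 :: nat}" by auto
  finally show ?thesis by (simp add: numeral_2_eq_2)
qed

lemma cycle_edges_4: "cycle_edges [x, y, z, w] = {{x, y}, {y, z}, {z, w}, {w, x}}"
proof -
  have e: "[x, y, z, w] ! 0 = x" "[x, y, z, w] ! 1 = y" "[x, y, z, w] ! 2 = z" "[x, y, z, w] ! 3 = w"
      "Suc 0 mod 4 = 1" "Suc 1 mod 4 = 2" "Suc 2 mod 4 = 3" "Suc 3 mod 4 = (0 :: nat)"
    by simp_all
  have "cycle_edges [x, y, z, w] = (\<lambda>i. {[x, y, z, w] ! i, [x, y, z, w] ! (Suc i mod 4)}) ` {..<4}"
    by (auto simp: cycle_edges_def)
  also have "{..<4} = {0, 1, 2, 3 :: nat}" by (rule set_eqI) (simp, linarith)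
  finally show ?thesis by (simp only: image_insert image_empty e)
qed

text \<open>A cycle on four vertices has length 3 or 4, so only finitely many vertex lists have to
  be inspected.\<close>

lemma indep_cycle_matroid_K4:
  assumes I: "I \<subseteq> complete_graph 4"
  shows "I \<in> indep (cycle_matroid (complete_graph 4)) \<longleftrightarrow>
    K4_acyclic ({1, 2} \<in> I) ({0, 1} \<in> I) ({0, 2} \<in> I) ({0, 3} \<in> I) ({2, 3} \<in> I) ({1, 3} \<in> I)"
proof -
  have lt: "x < 4 \<longleftrightarrow> x = 0 \<or> x = 1 \<or> x = 2 \<or> x = 3" for x :: nat by auto
  have 1: "\<not> K4_acyclic ({1, 2} \<in> I) ({0, 1} \<in> I) ({0, 2} \<in> I) ({0, 3} \<in> I) ({2, 3} \<in> I) ({1, 3} \<in> I)"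
    if vs: "distinct vs" "3 \<le> length vs" "cycle_edges vs \<subseteq> I" for vs
  proof -
    have "vs ! i < 4" if "i < length vs" for i
    proof -
      have "{vs ! i, vs ! (Suc i mod length vs)} \<in> cycle_edges vs" using that by (auto simp: cycle_edges_def)
      then have "{vs ! i, vs ! (Suc i mod length vs)} \<in> complete_graph 4" using vs(3) I by blast
      then show ?thesis by (auto simp: complete_graph_def)
    qed
    then have sub: "set vs \<subseteq> {..<4}" by (auto simp: in_set_conv_nth)
    have "length vs = card (set vs)" using vs(1) distinct_card by metis
    also have "\<dots> \<le> 4" using card_mono[OF _ sub] by simp
    finally have "length vs = 3 \<or> length vs = 4" using vs(2) by linarith
    then consider x y z where "vs = [x, y, z]" | x y z w where "vs = [x, y, z, w]"
      by (auto simp: numeral_eq_Suc length_Suc_conv)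
    then show ?thesis
    proof cases
      case (1 x y z)
      then have e: "{x, y} \<in> I" "{y, z} \<in> I" "{z, x} \<in> I" and d: "x \<noteq> y" "y \<noteq> z" "x \<noteq> z"
        and "x < 4" "y < 4" "z < 4" using vs sub by (auto simp: cycle_edges_3)
      then show ?thesis
        unfolding lt K4_acyclic_def by (elim disjE) (simp_all add: insert_commute)
    next
      case (2 x y z w)
      then have e: "{x, y} \<in> I" "{y, z} \<in> I" "{z, w} \<in> I" "{w, x} \<in> I"
        and d: "x \<noteq> y" "y \<noteq> z" "x \<noteq> z" "x \<noteq> w" "y \<noteq> w" "z \<noteq> w"
        and "x < 4" "y < 4" "z < 4" "w < 4" using vs sub by (auto simp: cycle_edges_4)
      then show ?thesis
        unfolding lt K4_acyclic_def by (elim disjE) (simp_all add: insert_commute)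
    qed
  qed
  have 2: "\<exists>vs. distinct vs \<and> 3 \<le> length vs \<and> cycle_edges vs \<subseteq> I"
    if "\<not> K4_acyclic ({1, 2} \<in> I) ({0, 1} \<in> I) ({0, 2} \<in> I) ({0, 3} \<in> I) ({2, 3} \<in> I) ({1, 3} \<in> I)"
  proof -
    let ?cyc = "\<lambda>vs. distinct vs \<and> 3 \<le> length vs \<and> cycle_edges vs \<subseteq> I"
    \<comment> \<open>The witnessing cycles stand in the order of the seven patterns of
      \<open>K4_acyclic\<close>.\<close>
    have "?cyc [0, 1, 2] \<or> ?cyc [0, 2, 3] \<or> ?cyc [0, 1, 3] \<or> ?cyc [1, 2, 3]
      \<or> ?cyc [0, 1, 3, 2] \<or> ?cyc [0, 2, 1, 3] \<or> ?cyc [0, 1, 2, 3]"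
      using that unfolding K4_acyclic_def cycle_edges_3 cycle_edges_4 by (auto simp: insert_commute)
    then show ?thesis by blast
  qed
  show ?thesis
    using 1 2 I unfolding cycle_matroid_def by auto
qed

context matroid
begin

text \<open>The triad g2, g3, g4 becomes the star at vertex 0, and the three given triangles the
  triangles through that vertex. The fourth triangle comes for free: the six elements have rank 3,
  and g1, g5, h lie in the hyperplane avoiding the triad, hence on a line.\<close>

lemma K4_iso:
  assumes F: "four_fan M g1 g2 g3 g4" and t5: "triangle M {g3, g4, g5}" and th: "triangle M {g2, g4, h}"
    and dist: "distinct [g1, g2, g3, g4, g5, h]"
  shows "matroid_iso (restrict M {g1, g2, g3, g4, g5, h}) (cycle_matroid (complete_graph 4))"
proof -
  let ?S = "{g1, g2, g3, g4, g5, h}"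
  interpret F: four_fan M g1 g2 g3 g4 by (rule F)
  interpret F2: four_fan M g5 g4 g3 g2
    by unfold_locales (use F.conn F.rank_ge F.corank_ge F.triad t5 dist in \<open>auto simp: insert_commute\<close>)
  interpret F3: four_fan M h g2 g4 g3
    by unfold_locales (use F.conn F.rank_ge F.corank_ge F.triad th dist in \<open>auto simp: insert_commute\<close>)
  have S: "?S \<subseteq> ground M" using F.in_ground F2.in_ground F3.in_ground by auto
  have "rk M (insert g5 {g1, g2, g3, g4}) = rk M {g1, g2, g3, g4}" by (rule F2.rk_insert_triangle) auto
  moreover have "rk M (insert h (insert g5 {g1, g2, g3, g4})) = rk M (insert g5 {g1, g2, g3, g4})"
    by (rule F3.rk_insert_triangle) auto
  moreover have "insert h (insert g5 {g1, g2, g3, g4}) = ?S" by auto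
  ultimately have rS: "rk M ?S = 3" using F.rk_fan by simp
  have hyp: "rk M {x, y, z} = 3" if "x \<in> {g2, g3, g4}" "{y, z} \<subseteq> {g1, g5, h}" "y \<noteq> z" for x y z
  proof -
    have "rk M (insert x {y, z}) = rk M {y, z} + 1"
      by (rule F.rk_insert_hyperplane) (use that S dist in auto)
    then show ?thesis using rk_pair[OF F.conn F.card_ge_4, of y z] that S by auto
  qed
  have "rk M (insert g2 {g1, g5, h}) = rk M {g1, g5, h} + 1"
    by (rule F.rk_insert_hyperplane) (use S dist in auto)
  moreover have "rk M (insert g2 {g1, g5, h}) \<le> rk M ?S" by (rule rk_mono) auto
  ultimately have r4: "rk M {g1, g5, h} \<le> 2" using rS by linarith
  have span: "rk M X = 3" if "rk M (insert w X) = rk M X" "{g2, g3, g4} \<subseteq> insert w X" "X \<subseteq> ?S" for w X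
    using rk_mono[OF that(2)] rk_mono[OF that(3)] F.rk_triad that(1) rS by linarith
  have ind: "{x, y, z} \<in> indep M" if "rk M {x, y, z} = 3" "x \<in> ?S" "y \<in> ?S" "z \<in> ?S" "x \<noteq> y" "y \<noteq> z" "x \<noteq> z" for x y z
    using that S indep_iff_rk by auto
  have B0: "{g2, g3, g4} \<in> indep M" by (rule ind) (use F.rk_triad dist in auto)
  have B1: "{x, y, z} \<in> indep M" if "x \<in> {g2, g3, g4}" "{y, z} \<subseteq> {g1, g5, h}" "y \<noteq> z" for x y z
    by (rule ind[OF hyp]) (use that dist in auto)
  have B2: "{g2, g3, g5} \<in> indep M"
    by (rule ind, rule span[of g4]) (use dist in \<open>auto intro!: F2.rk_insert_triangle\<close>)
  have B3: "{g2, g3, h} \<in> indep M"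
    by (rule ind, rule span[of g4]) (use dist in \<open>auto intro!: F3.rk_insert_triangle\<close>)
  have B4: "{g3, g4, g1} \<in> indep M"
    by (rule ind, rule span[of g2]) (use dist in \<open>auto intro!: F.rk_insert_triangle\<close>)
  have B5: "{g3, g4, h} \<in> indep M"
    by (rule ind, rule span[of g2]) (use dist in \<open>auto intro!: F3.rk_insert_triangle\<close>)
  have B6: "{g2, g4, g1} \<in> indep M"
    by (rule ind, rule span[of g3]) (use dist in \<open>auto intro!: F.rk_insert_triangle\<close>)
  have B7: "{g2, g4, g5} \<in> indep M"
    by (rule ind, rule span[of g3]) (use dist in \<open>auto intro!: F2.rk_insert_triangle\<close>)
  have indep: "I \<in> indep M \<longleftrightarrow> K4_acyclic (g1 \<in> I) (g2 \<in> I) (g3 \<in> I) (g4 \<in> I) (g5 \<in> I) (h \<in> I)"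
    if I: "I \<subseteq> ?S" for I
  proof
    assume ind: "I \<in> indep M"
    have no: "\<not> C \<subseteq> I" if "rk M C < card C" for C
      using that indep_subset[OF ind] rk_indep[of C] by auto
    have four: "\<not> C \<subseteq> I" if C: "C \<subseteq> ?S" "card C = 4" for C
      using no[of C] rk_mono[OF C(1)] rS C(2) by linarith
    have "\<not> {g1, g2, g3} \<subseteq> I" "\<not> {g3, g4, g5} \<subseteq> I" "\<not> {g2, g4, h} \<subseteq> I" "\<not> {g1, g5, h} \<subseteq> I"
      by (rule no; use F.rk_triangle triangle_rk[OF t5] triangle_rk[OF th] r4 dist in simp)+
    moreover have "\<not> {g2, g3, g5, h} \<subseteq> I" "\<not> {g1, g3, g4, h} \<subseteq> I" "\<not> {g1, g2, g4, g5} \<subseteq> I"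
      by (rule four; use dist in auto)+
    ultimately show "K4_acyclic (g1 \<in> I) (g2 \<in> I) (g3 \<in> I) (g4 \<in> I) (g5 \<in> I) (h \<in> I)"
      unfolding K4_acyclic_def by simp
  next
    assume K: "K4_acyclic (g1 \<in> I) (g2 \<in> I) (g3 \<in> I) (g4 \<in> I) (g5 \<in> I) (h \<in> I)"
    \<comment> \<open>These are the sixteen spanning trees of the graph: the star itself, six trees
      with two edges of the star and nine with one.\<close>
    have "I \<subseteq> {g2, g3, g4} \<or> I \<subseteq> {g2, g3, g5} \<or> I \<subseteq> {g2, g3, h} \<or> I \<subseteq> {g3, g4, g1} \<or> I \<subseteq> {g3, g4, h}
        \<or> I \<subseteq> {g2, g4, g1} \<or> I \<subseteq> {g2, g4, g5}
        \<or> I \<subseteq> {g2, g1, g5} \<or> I \<subseteq> {g2, g1, h} \<or> I \<subseteq> {g2, g5, h}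
        \<or> I \<subseteq> {g3, g1, g5} \<or> I \<subseteq> {g3, g1, h} \<or> I \<subseteq> {g3, g5, h}
        \<or> I \<subseteq> {g4, g1, g5} \<or> I \<subseteq> {g4, g1, h} \<or> I \<subseteq> {g4, g5, h}"
    proof -
      have eq: "I \<subseteq> B \<longleftrightarrow> (\<forall>x \<in> ?S. x \<in> I \<longrightarrow> x \<in> B)" for B using I by blast
      show ?thesis
        unfolding eq using K dist unfolding K4_acyclic_def
        by (cases "g1 \<in> I"; cases "g2 \<in> I"; cases "g3 \<in> I"; cases "g4 \<in> I"; cases "g5 \<in> I"; cases "h \<in> I"; simp)
    qed
    moreover have "{g2, g1, g5} \<in> indep M" "{g2, g1, h} \<in> indep M" "{g2, g5, h} \<in> indep M"
        "{g3, g1, g5} \<in> indep M" "{g3, g1, h} \<in> indep M" "{g3, g5, h} \<in> indep M"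
        "{g4, g1, g5} \<in> indep M" "{g4, g1, h} \<in> indep M" "{g4, g5, h} \<in> indep M"
      by (rule B1; use dist in simp)+
    moreover have in_basis: "I \<in> indep M" if "I \<subseteq> B" "B \<in> indep M" for B
      using that indep_subset by blast
    ultimately show "I \<in> indep M"
      using B0 B2 B3 B4 B5 B6 B7 by (elim disjE) (erule in_basis, assumption)+
  qed
  define f :: "'a \<Rightarrow> nat set" where "f = (\<lambda>x. if x = g1 then {1, 2} else if x = g2 then {0, 1}
    else if x = g3 then {0, 2} else if x = g4 then {0, 3} else if x = g5 then {2, 3} else {1, 3})"
  have fv: "f g1 = {1, 2}" "f g2 = {0, 1}" "f g3 = {0, 2}" "f g4 = {0, 3}" "f g5 = {2, 3}" "f h = {1, 3}"
    using dist by (auto simp: f_def)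
  let ?L = "[{1, 2}, {0, 1}, {0, 2}, {0, 3}, {2, 3}, {1, 3 :: nat}]"
  have "distinct ?L" by (simp add: doubleton_eq_iff)
  moreover have fS: "f ` ?S = set ?L" by (simp only: image_insert image_empty fv list.set)
  ultimately have "card (f ` ?S) = card ?S" using distinct_card[of ?L] distinct_card[OF dist] by simp
  then have inj: "inj_on f ?S" by (intro eq_card_imp_inj_on) auto
  have im: "f ` ?S = complete_graph 4" using fS by (simp add: complete_graph_4)
  have bij: "bij_betw f ?S (complete_graph 4)" using inj im by (simp add: bij_betw_def)
  have ground: "ground (restrict M ?S) = ?S" "ground (cycle_matroid (complete_graph 4)) = complete_graph 4"
    using S by (auto simp: restrict_def cycle_matroid_def)
  have "I \<in> indep (restrict M ?S) \<longleftrightarrow> f ` I \<in> indep (cycle_matroid (complete_graph 4))" if I: "I \<subseteq> ?S" for I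
  proof -
    have mem: "f x \<in> f ` I \<longleftrightarrow> x \<in> I" if "x \<in> ?S" for x
      using inj I that by (meson inj_on_image_mem_iff)
    have "f ` I \<subseteq> complete_graph 4" using I im by blast
    then have "f ` I \<in> indep (cycle_matroid (complete_graph 4)) \<longleftrightarrow>
        K4_acyclic (f g1 \<in> f ` I) (f g2 \<in> f ` I) (f g3 \<in> f ` I) (f g4 \<in> f ` I) (f g5 \<in> f ` I) (f h \<in> f ` I)"
      unfolding fv by (rule indep_cycle_matroid_K4)
    also have "\<dots> \<longleftrightarrow> I \<in> indep M" using mem indep[OF I] by simp
    also have "\<dots> \<longleftrightarrow> I \<in> indep (restrict M ?S)" using I by (auto simp: restrict_def delete_def)
    finally show ?thesis by blast
  qed
  then show ?thesis unfolding matroid_iso_def ground using bij by blast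
qed

end

section \<open>Elements in the middle of a fan\<close>

context four_fan
begin

lemma second_vertical_3_separation:
  assumes "vertical_3_separation M P b Q"
  shows "(\<exists>A B. swirl_like_flower M [A, {a, c}, {b, d}, B])
      \<and> (\<exists>P' Q'. vertical_3_separation (dual M) P' c Q')
    \<or> (\<exists>g. g \<in> ground M \<and> g \<notin> {a, b, c, d} \<and> triad M {g, a, c})"
proof -
  obtain P Q where "four_fan_separation M a b c d P Q"
    using assms vertical_3_separation_second[OF assms] vertical_3_separation_commute[OF assms conn]
    unfolding four_fan_separation_def four_fan_separation_axioms_def
    using four_fan_axioms by blast
  then interpret S: four_fan_separation M a b c d P Q .
  show ?thesis
  proof (cases "card P = 3")
    case True
    then obtain g where g: "P = {a, c, g}" "g \<noteq> a" "g \<noteq> c" "triad M {a, c, g}" using S.triad_of_card_3 by blast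
    have "g \<in> P" using g by simp
    then have "g \<notin> {a, b, c, d}" "g \<in> ground M" using g S.parts S.side by auto
    moreover have "triad M {g, a, c}" using g(4) by (simp add: insert_commute)
    ultimately show ?thesis by blast
  next
    case False
    then show ?thesis using S.swirl[OF False] S.dual_vertical_3_separation_c[OF False] by blast
  qed
qed

text \<open>Inelasticity spreads from b to c unless the fan prolongs: the separation at b in one of
  \<open>M\<close> and its dual produces, along with the flower, a separation at c in the
  other.\<close>

lemma second_not_elastic:
  assumes "\<not> elastic M b"
  shows "\<not> elastic M c \<and> ((\<exists>A B. swirl_like_flower M [A, {a, c}, {b, d}, B])
      \<or> (\<exists>A B. swirl_like_flower (dual M) [A, {a, b}, {c, d}, B]))
    \<or> (\<exists>g. g \<in> ground M \<and> g \<notin> {a, b, c, d} \<and> (triad M {g, a, c} \<or> triangle M {g, d, c}))"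
proof -
  interpret D: four_fan "dual M" d b c a by (rule four_fan_dual)
  have el: "elastic M x \<longleftrightarrow> (\<nexists>P Q. vertical_3_separation M P x Q) \<and> (\<nexists>P Q. vertical_3_separation (dual M) P x Q)"
    if "x \<in> ground M" for x using elastic_iff[OF conn card_ge_4 that] .
  consider P Q where "vertical_3_separation M P b Q" | P Q where "vertical_3_separation (dual M) P b Q"
    using assms el[OF in_ground(2)] by blast
  then show ?thesis
  proof cases
    case (1 P Q)
    then show ?thesis using second_vertical_3_separation[OF 1] el[OF in_ground(3)] by blast
  next
    case (2 P Q)
    \<comment> \<open>The dual fan runs from d to a, so its flower is read backwards to follow the
      original order.\<close>
    have "swirl_like_flower (dual M) [B, {a, b}, {c, d}, A]"
      if "swirl_like_flower (dual M) [A, {d, c}, {b, a}, B]" for A B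
      using D.swirl_like_flower_rev[OF that] by (simp add: insert_commute)
    moreover have "(\<exists>A B. swirl_like_flower (dual M) [A, {d, c}, {b, a}, B])
        \<and> (\<exists>P' Q'. vertical_3_separation M P' c Q')
      \<or> (\<exists>g. g \<in> ground M \<and> g \<notin> {d, b, c, a} \<and> triangle M {g, d, c})"
      using D.second_vertical_3_separation[OF 2] by (simp add: triad_dual)
    moreover have "{d, b, c, a} = {a, b, c, d}" by auto
    ultimately show ?thesis using el[OF in_ground(3)] by metis
  qed
qed

text \<open>The middle element c belongs to two four-element fans sharing the triad, and a
  separation at c must respect both. In M the flower then arises, since a side of size 3 would
  prolong the fan; in the dual both fans act on the same side and leave it no room beyond three
  elements.\<close>

lemma five_fan:
  assumes t5: "triangle M {c, d, f}" and f: "f \<notin> {a, b, c, d}"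
    and ne: "\<not> elastic M c"
    and maximal: "\<And>g. g \<in> ground M \<Longrightarrow> g \<notin> {a, b, c, d, f} \<Longrightarrow> \<not> triad M {g, a, b}"
  shows "(\<exists>A B. swirl_like_flower M [A, {a, b}, {c, d}, B])
    \<or> (\<exists>h. h \<in> ground M \<and> h \<notin> {a, b, c, d, f} \<and> triangle M {b, d, h})"
proof -
  interpret F: four_fan M a c b d by (rule four_fan_swap)
  interpret G: four_fan M f c d b
    by unfold_locales (use conn rank_ge corank_ge t5 triad dist f in \<open>auto simp: insert_commute\<close>)
  interpret DF: four_fan "dual M" d c b a by (rule F.four_fan_dual)
  interpret DG: four_fan "dual M" b c d f by (rule G.four_fan_dual)
  consider P Q where "vertical_3_separation M P c Q" | P Q where "vertical_3_separation (dual M) P c Q"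
    using ne elastic_iff[OF conn card_ge_4 in_ground(3)] by blast
  then show ?thesis
  proof cases
    case (1 P Q)
    obtain P Q where v: "four_fan_separation M a c b d P Q"
      using 1 F.vertical_3_separation_second[OF 1] vertical_3_separation_commute[OF 1 conn]
      unfolding four_fan_separation_def four_fan_separation_axioms_def
      using F.four_fan_axioms by blast
    then interpret S: four_fan_separation M a c b d P Q .
    \<comment> \<open>In the second fan the end f lies on the same side as d.\<close>
    have fQ: "f \<in> Q" using G.vertical_3_separation_second[OF S.sep] S.side S.parts by blast
    have "card P \<noteq> 3"
    proof
      assume "card P = 3"
      then obtain g where g: "P = {a, b, g}" "g \<noteq> a" "g \<noteq> b" "triad M {a, b, g}" using S.triad_of_card_3 by blast
      have "g \<in> P" using g by simp
      then have "g \<notin> {a, b, c, d, f}" "g \<in> ground M" using g S.parts S.side fQ by auto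
      moreover have "triad M {g, a, b}" using g(4) by (simp add: insert_commute)
      ultimately show False using maximal by blast
    qed
    from S.swirl[OF this] show ?thesis by blast
  next
    case (2 P Q)
    obtain P Q where v: "four_fan_separation (dual M) d c b a P Q"
      using 2 DF.vertical_3_separation_second[OF 2] DF.vertical_3_separation_commute[OF 2 DF.conn]
      unfolding four_fan_separation_def four_fan_separation_axioms_def
      using DF.four_fan_axioms by blast
    then interpret S: four_fan_separation "dual M" d c b a P Q .
    have fQ: "f \<in> Q" using DG.vertical_3_separation_second[OF S.sep] S.side S.parts by blast
    interpret S2: four_fan_separation "dual M" b c d f P Q
      by unfold_locales (use S.sep S.side fQ in auto)
    have "card P = 3"
    proof (rule ccontr)
      assume big: "card P \<noteq> 3"
      \<comment> \<open>Two triads of the dual meet P in single elements, b and d, so removing both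
        costs two units of rank, whereas a side with more than three elements would lose only
        one.\<close>
      have "rk (dual M) P + rk (dual M) (P - {d, b}) \<le> rk (dual M) (P - {b}) + rk (dual M) (P - {d})"
        by (rule DF.rk_submodular') (use dist in auto)
      then show False using S.rk_P_minus_c S2.rk_P_minus_c S.rk_A[OF big] by linarith
    qed
    then obtain g where g: "P = {d, b, g}" "g \<noteq> d" "g \<noteq> b" "triad (dual M) {d, b, g}" using S.triad_of_card_3 by blast
    have "g \<in> P" using g by simp
    then have "g \<notin> {a, b, c, d, f}" "g \<in> ground M" using g S.parts S.side fQ by auto
    moreover have "triangle M {b, d, g}" using g(4) by (simp add: triad_dual insert_commute)
    ultimately show ?thesis by blast
  qed
qed

end


section \<open>Keeping a minor\<close>

lemma (in matroid) three_connected_iso: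
  assumes N: "matroid N" "matroid_iso M N" "three_connected N"
  shows "three_connected M"
proof (rule ccontr)
  interpret N: matroid N by (rule N(1))
  assume "\<not> three_connected M"
  then obtain k A B where k: "k = 1 \<or> k = (2::nat)" and AB: "A \<union> B = ground M" "A \<inter> B = {}" "k \<le> card A" "k \<le> card B"
    and r: "rk M A + rk M B + 1 \<le> rk M (ground M) + k" by (rule not_three_connectedD)
  obtain f where f: "bij_betw f (ground M) (ground N)" "\<And>X. X \<subseteq> ground M \<Longrightarrow> rk N (f ` X) = rk M X"
    using matroid_iso_rk[OF matroid_axioms N(1,2)] by blast
  have inj: "inj_on f (ground M)" and im: "f ` ground M = ground N" using f(1) by (auto simp: bij_betw_def)
  have "card (f ` A) = card A" "card (f ` B) = card B"
    using card_image inj AB(1) by (metis Un_upper1 Un_upper2 inj_on_subset)+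
  moreover have "f ` A \<union> f ` B = ground N" using im AB(1) by (metis image_Un)
  moreover have "f ` A \<inter> f ` B = {}" using inj AB(1,2) by (metis Un_upper1 Un_upper2 image_empty inj_on_image_Int)
  moreover have "rk N (f ` A) = rk M A" "rk N (f ` B) = rk M B" "rk N (ground N) = rk M (ground M)"
    using f(2) AB(1) im by (metis Un_upper1 Un_upper2 order_refl)+
  ultimately have *: "f ` A \<union> f ` B = ground N" "f ` A \<inter> f ` B = {}" "k \<le> card (f ` A)" "k \<le> card (f ` B)"
    "rk N (f ` A) + rk N (f ` B) + 1 \<le> rk N (ground N) + k" using AB r by simp_all
  from k show False
  proof
    assume "k = 1"
    moreover from this have "f ` A \<noteq> {}" "f ` B \<noteq> {}" using *(3,4) by force+
    moreover have "ground N - f ` A = f ` B" using *(1,2) by blast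
    ultimately show False using N.three_connected_rk1[OF N(3), of "f ` A"] * by auto
  next
    assume "k = 2"
    then show False using N.three_connected_rk2'[OF N(3) *(1,2)] * by simp
  qed
qed

context four_fan
begin

text \<open>The simplification has rank at least 3. On at most three elements such a matroid would
  split off an element, contrary to connectivity. The bound is what the treatment of small N asks
  for.\<close>

lemma card_si_contract:
  assumes x: "x \<in> ground M" and si: "three_connected (si (contract M {x}))"
  shows "4 \<le> card (ground (si (contract M {x})))"
proof (rule ccontr)
  define L where "L = contract M {x}"
  interpret L: matroid L unfolding L_def by (rule matroid_contract)
  obtain T where T: "T \<subseteq> ground L" "ground (si L) = T" "matroid (si L)" "\<And>X. X \<subseteq> T \<Longrightarrow> rk (si L) X = rk L X"
    "\<And>x. x \<in> ground L \<Longrightarrow> rk L {x} = 1 \<Longrightarrow> \<exists>t \<in> T. parallel L x t"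
    by (rule L.si_cases) blast
  interpret S: matroid "si L" by (rule T(3))
  assume "\<not> ?thesis"
  then have small: "card T \<le> 3" using T(2) by (simp add: L_def)
  have "rk L T = rk L (ground L)" by (rule L.rk_transversal[OF T(1,5)]) (use T(1) in auto)
  moreover have "rk L (ground L) + 1 = rk M (ground M)"
    using rk_contract1_add[OF x, of "ground M - {x}"] rk_single[OF conn card_ge_4 x] x
    by (simp add: L_def insert_absorb)
  ultimately have r: "3 \<le> rk (si L) T" using rank_ge T(4)[of T] by simp
  then obtain t where t: "t \<in> T" using S.rk_empty by fastforce
  have fT: "finite T" using S.finite_ground T(2) by simp
  have "card (T - {t}) \<le> 2" using small t card.remove[OF fT t] by linarith
  then have le: "rk (si L) (T - {t}) \<le> 2" using S.rk_le_card[of "T - {t}"] fT by simp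
  moreover have "T - {t} \<noteq> {}"
  proof
    assume "T - {t} = {}"
    then have "T = {t}" using t by blast
    then show False using r S.rk_singleton_le[of t] by simp
  qed
  ultimately show False
    using S.three_connected_rk1[of "{t}"] si t T(2) r S.rk_singleton_le[of t] by (simp add: L_def)
qed

lemma contract_second_has_minor:
  assumes v: "vertical_3_separation M X e Y" and sub: "{b, c, d} \<subseteq> X"
    and N: "is_minor N (contract M {e})" "three_connected N" "2 \<le> card (ground N)" "card (X \<inter> ground N) \<le> 1"
  shows "has_minor (contract M {b}) N"
    and "(\<nexists>P Q. vertical_3_separation (dual M) P b Q) \<Longrightarrow> has_minor (contract (dual M) {b}) (dual N)"
proof -
  let ?E = "ground M"
  have V: "e \<in> ?E" "X \<union> Y = ?E - {e}" "X \<inter> Y = {}" "3 \<le> rk M X" "3 \<le> rk M Y"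
    "rk M (insert e X) = rk M X" "rk M (insert e Y) = rk M Y" "rk M X + rk M Y = rk M ?E + 2"
    using v unfolding vertical_3_separation_iff[OF conn] by auto
  have bX: "b \<in> X" and eX: "e \<notin> X" "e \<notin> Y" using sub V(2) by auto
  interpret D: matroid "dual M" by (rule matroid_dual)
  have Dconn: "three_connected (dual M)" using conn n_connected_dual by blast
  define L where "L = contract M {e}"
  interpret L: matroid L unfolding L_def by (rule matroid_contract)
  have gL: "ground L = ?E - {e}" by (simp add: L_def)
  have XL: "X \<subseteq> ground L" "ground L - X = Y" using V(2,3) gL by auto
  have rL: "rk L S + 1 = rk M (insert e S)" if "S \<subseteq> ?E - {e}" for S
    using rk_contract1_add[OF V(1) that] rk_single[OF conn card_ge_4 V(1)] by (simp add: L_def)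
  have YE: "Y \<subseteq> ?E - {e}" "X \<subseteq> ?E - {e}" "{b} \<subseteq> ?E - {e}" "insert b Y \<subseteq> ?E - {e}"
    using V(2) bX by auto
  have "insert e (?E - {e}) = ?E" using V(1) by auto
  then have rLE: "rk L (ground L) + 1 = rk M ?E" using rL[of "?E - {e}"] gL by simp
  have sepL: "rk L X + rk L (ground L - X) = rk L (ground L) + 1"
    unfolding XL(2) using rL[OF YE(1)] rL[OF YE(2)] rLE V by linarith
  have hyp: "rk M (insert b (insert e Y)) = rk M Y + 1"
    using rk_insert_hyperplane[of "insert e Y" b] V sub by auto
  have "rk M {e, b} = 2" using rk_pair' V(1) bX eX in_ground by auto
  then have bL: "rk L (insert b (ground L - X)) = rk L (ground L - X) + rk L {b}"
    unfolding XL(2) using rL[OF YE(4)] rL[OF YE(3)] rL[OF YE(1)] hyp V(7) by (simp add: insert_commute)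
  have "has_minor (contract L {b}) N"
    by (rule L.has_minor_contract_2_separation[OF XL(1) sepL]) (use N bX bL in \<open>auto simp: L_def\<close>)
  moreover have "contract L {b} = contract (contract M {b}) {e}"
    using contract_contract[of "{e}" "{b}"] contract_contract[of "{b}" "{e}"] V(1) YE(3) in_ground(2)
    by (simp add: L_def insert_commute)
  ultimately show "has_minor (contract M {b}) N"
    unfolding has_minor_def using matroid.is_minor_contract[OF matroid_contract, of _ "{b}" e] V(1) YE(3) by auto
  assume no: "\<nexists>P Q. vertical_3_separation (dual M) P b Q"
  \<comment> \<open>In the dual of M / e the element b raises the rank of Y exactly when e and X -
    {b} span b in M; this is the dual of the condition verified above for contracting b.\<close>
  have span: "rk M (insert e (X - {b})) = rk M X"
  proof (rule ccontr)
    assume neg: "rk M (insert e (X - {b})) \<noteq> rk M X"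
    have "rk M (insert e (X - {b})) \<le> rk M (insert e X)" by (rule rk_mono) auto
    then have lt: "rk M (insert e (X - {b})) < rk M X" using neg V(6) by linarith
    \<comment> \<open>On the other side a would span b together with c, against the rank
      drop.\<close>
    have aY: "a \<in> Y"
    proof (rule ccontr)
      assume "a \<notin> Y"
      then have "a \<in> insert e X" using V(2) in_ground by auto
      then have "rk M (insert b (insert e (X - {b}))) = rk M (insert e (X - {b}))"
        by (intro rk_insert_triangle) (use sub dist in auto)
      moreover have "insert b (insert e (X - {b})) = insert e X" using bX by auto
      ultimately show False using lt V(6) by simp
    qed
    have "rk M (insert b (X - {b})) \<le> rk M (X - {b}) + 1" by (rule rk_insert_le)
    moreover have "insert b (X - {b}) = X" using bX by auto
    moreover have "rk M (X - {b}) \<le> rk M (insert e (X - {b}))" by (rule rk_mono) auto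
    ultimately have r: "rk M (X - {b}) + 1 = rk M X" "rk M (insert e (X - {b})) + 1 = rk M X" using lt by auto
    show False
    proof (cases "X = {b, c, d}")
      case True
      have "e \<notin> {a, b, c, d}" using eX aY True by auto
      moreover have "X - {b} = {c, d}" using True dist by auto
      ultimately have "triangle M {e, d, c}"
        using r(2) rk_triad True V(1) in_ground dist
        by (intro triangleI[OF conn card_ge_4]) (auto simp: insert_commute)
      \<comment> \<open>Now b is the last element of this fan, and such an end always has a vertical
        3-separation in the dual.\<close>
      then interpret G: four_fan M e d c b
        by unfold_locales (use conn rank_ge corank_ge triad dist \<open>e \<notin> {a, b, c, d}\<close> in \<open>auto simp: insert_commute\<close>)
      show False using G.ex_dual_vertical_3_separation_last no by blast
    next
      case False
      have finX: "finite X" "finite Y" using YE finite_ground finite_subset by blast+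
      have "card {b, c} = 2" using dist by simp
      then have cX: "card (X - {b, c}) + 2 = card X"
        using card_Diff_subset[of "{b, c}" X] card_mono[OF finX(1), of "{b, c}"] sub by auto
      have "card {b, c, d} < card X" using False sub finX by (simp add: psubset_card_mono psubsetI)
      moreover have "card {b, c, d} = 3" using dist by simp
      ultimately have "2 \<le> card (X - {b, c})" using cX by linarith
      moreover have "2 \<le> card (insert c (insert b (insert e Y)))"
      proof -
        have "card {b, c} \<le> card (insert c (insert b (insert e Y)))" by (rule card_mono) (use finX in auto)
        then show ?thesis using \<open>card {b, c} = 2\<close> by simp
      qed
      moreover have "(X - {b, c}) \<union> insert c (insert b (insert e Y)) = ?E"
        "(X - {b, c}) \<inter> insert c (insert b (insert e Y)) = {}"
        using V(1,2,3) sub eX in_ground by auto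
      ultimately have "rk M ?E + 2 \<le> rk M (X - {b, c}) + rk M (insert c (insert b (insert e Y)))"
        by (intro three_connected_rk2'[OF conn])
      moreover have "rk M (insert c (insert b (insert e Y))) = rk M (insert b (insert e Y))"
        by (rule rk_insert_triangle) (use aY in auto)
      moreover have "rk M (X - {b, c}) \<le> card (X - {b, c})" by (rule rk_le_card) (use finX in simp)
      \<comment> \<open>Since a is in Y, moving b and c across raises the rank there by one only, so
        X - {b, c} has rank at least r(X) - 1 but size |X| - 2. Dependence of X makes its dual rank
        at least 3.\<close>
      ultimately have dep: "rk M X < card X" using hyp V(8) cX by linarith
      have rd: "rk (dual M) S + rk M ?E = card S + rk M (?E - S)" if "S \<subseteq> ?E" for S using rk_dual_add[OF that] .
      have compl: "?E - X = insert e Y" "?E - (X - {b}) = insert b (insert e Y)" "?E - insert e Y = X"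
        "?E - insert b (insert e Y) = X - {b}"
        using V(1,2,3) bX eX in_ground by auto
      have sub': "X \<subseteq> ?E" "X - {b} \<subseteq> ?E" "insert e Y \<subseteq> ?E" "insert b (insert e Y) \<subseteq> ?E"
        using YE V(1) in_ground by auto
      have bY: "b \<notin> insert e Y" using bX V(3) eX by auto
      have cards: "card X = card (X - {b}) + 1" "card (insert e Y) = card Y + 1" "card (insert b (insert e Y)) = card Y + 2"
        using card.remove[OF finX(1) bX] finX(2) bY eX by simp_all
      have "card ?E = card X + card (insert e Y)" using card_Diff_ge[OF sub'(1)] compl by simp
      moreover note rd[OF sub'(1), unfolded compl] rd[OF sub'(2), unfolded compl] rd[OF sub'(3), unfolded compl]
        rd[OF sub'(4), unfolded compl]
      moreover have "rk M Y \<le> card Y" by (rule rk_le_card[OF finX(2)])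
      moreover note cards dep r hyp V(4-8) rk_dual_ground
      ultimately have "3 \<le> rk (dual M) (X - {b})" "3 \<le> rk (dual M) (insert e Y)" "rk (dual M) X = rk (dual M) (X - {b})"
        "rk (dual M) (insert b (insert e Y)) = rk (dual M) (insert e Y)"
        "rk (dual M) (X - {b}) + rk (dual M) (insert e Y) = rk (dual M) ?E + 2"
        by linarith+
      moreover have "insert b (X - {b}) = X" "(X - {b}) \<union> insert e Y = ?E - {b}" "(X - {b}) \<inter> insert e Y = {}"
        using V(1,2,3) bX eX in_ground by auto
      ultimately have "vertical_3_separation (dual M) (X - {b}) b (insert e Y)"
        unfolding D.vertical_3_separation_iff[OF Dconn] using in_ground by simp
      then show False using no by blast
    qed
  qed
  \<comment> \<open>This is the dual of M with e deleted; as connectivity is self-dual, (X, Y) is a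
    2-separation here too and the same transfer of minors applies.\<close>
  define L' where "L' = dual L"
  have L': "L' = delete (dual M) {e}" by (simp add: L'_def L_def dual_contract)
  interpret L': matroid L' unfolding L'_def by (rule L.matroid_dual)
  have gL': "ground L' = ground L" by (simp add: L'_def)
  have rL': "rk L' S = rk (dual M) S" if "S \<subseteq> ?E - {e}" for S
    unfolding L' using D.rk_delete[of S "{e}"] that by simp
  have "conn L' X = conn L X" unfolding L'_def by (rule L.conn_dual[OF XL(1)])
  then have sepL': "rk L' X + rk L' (ground L' - X) = rk L' (ground L') + 1"
    using sepL gL' by (simp add: conn_def)
  have finY: "finite Y" using YE finite_ground finite_subset by blast
  have "rk (dual M) (insert b Y) = rk (dual M) Y + rk (dual M) {b}"
  proof -
    have "?E - insert b Y = insert e (X - {b})" "?E - Y = insert e X" using V(1,2,3) bX eX by auto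
    moreover have "insert b Y \<subseteq> ?E" "Y \<subseteq> ?E" "b \<notin> Y" using YE bX V(3) by auto
    moreover have "rk (dual M) {b} = 1" using D.rk_single[OF Dconn] card_ge_4 in_ground by simp
    ultimately show ?thesis using rk_dual_add[of "insert b Y"] rk_dual_add[of Y] span V(6) finY by simp
  qed
  then have bL': "rk L' (insert b (ground L' - X)) = rk L' (ground L' - X) + rk L' {b}"
    unfolding gL' XL(2) using rL' YE by simp
  have "is_minor N L" using N(1) by (simp add: L_def)
  then have "is_minor (dual N) L'" unfolding L'_def by (rule L.is_minor_dual)
  moreover have "matroid N" using \<open>is_minor N L\<close> L.is_minor_matroid by blast
  then have "three_connected (dual N)" using N(2) matroid.n_connected_dual by blast
  ultimately have "has_minor (contract L' {b}) (dual N)"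
    by (intro L'.has_minor_contract_2_separation[of X]) (use XL(1) gL' sepL' N bX bL' in auto)
  moreover have "contract L' {b} = delete (contract (dual M) {b}) {e}"
    unfolding L' by (rule D.contract_delete) (use in_ground bX eX in auto)
  ultimately show "has_minor (contract (dual M) {b}) (dual N)"
    unfolding has_minor_def using matroid.is_minor_delete[OF D.matroid_contract, of _ "{b}" e] V(1) YE(3) by auto
qed

lemma second_N_elastic:
  assumes v: "vertical_3_separation M X e Y" and sub: "{b, c, d} \<subseteq> X"
    and N: "matroid N" "three_connected N"
    and N': "is_minor N' (contract M {e})" "matroid_iso N' N" "card (X \<inter> ground N') \<le> 1"
    and el: "elastic M b"
  shows "N_elastic N M b"
proof -
  interpret N: matroid N by (rule N(1))
  interpret DN: matroid "dual N" by (rule N.matroid_dual)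
  interpret D: four_fan "dual M" d b c a by (rule four_fan_dual)
  have b: "b \<in> ground M" by (rule in_ground)
  have no: "\<nexists>P Q. vertical_3_separation M P b Q" "\<nexists>P Q. vertical_3_separation (dual M) P b Q"
    using el elastic_iff[OF conn card_ge_4 b] by blast+
  have si: "three_connected (si (contract M {b}))" "three_connected (si (contract (dual M) {b}))"
    using no si_contract_three_connected_iff[OF conn card_ge_4 b]
      D.si_contract_three_connected_iff[OF D.conn D.card_ge_4, of b] b by auto
  have mC: "matroid (contract M {b})" "matroid (contract (dual M) {b})"
    using matroid_contract D.matroid_contract by blast+
  have mS: "matroid (si (contract M {b}))" "matroid (si (contract (dual M) {b}))"
    using mC matroid.matroid_si by blast+
  have DNconn: "three_connected (dual N)" using N(2) N.n_connected_dual by blast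
  have "has_minor (si (contract M {b})) N \<and> has_minor (si (contract (dual M) {b})) (dual N)"
  proof (cases "card (ground N) \<le> 3")
    \<comment> \<open>Such N may have parallel elements or loops, so nothing is transported;
      3-connectivity of the simplifications yields N and its dual directly.\<close>
    case True
    then show ?thesis
      using matroid.has_small_minor[OF mS(1) si(1) card_si_contract[OF b si(1)] N(1,2)]
        matroid.has_small_minor[OF mS(2) si(2) D.card_si_contract[OF _ si(2)] DN.matroid_axioms DNconn] b
      by simp
  next
    case False
    then have card: "4 \<le> card (ground N)" by simp
    have mN': "matroid N'" using matroid.is_minor_matroid[OF matroid_contract N'(1)] .
    have "card (ground N') = card (ground N)"
      using N'(2) bij_betw_same_card unfolding matroid_iso_def by blast
    then have c2: "2 \<le> card (ground N')" using card by simp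
    have conn': "three_connected N'" using matroid.three_connected_iso[OF mN' N(1) N'(2) N(2)] .
    have "has_minor (contract M {b}) N'" "has_minor (contract (dual M) {b}) (dual N')"
      using contract_second_has_minor[OF v sub N'(1) conn' c2 N'(3)] no(2) by blast+
    then have "has_minor (contract M {b}) N" "has_minor (contract (dual M) {b}) (dual N)"
      using has_minor_iso N'(2) matroid_iso_dual[OF mN' N(1) N'(2)] by blast+
    moreover have "rk N {x} = 1" if "x \<in> ground N" for x using N.rk_single[OF N(2) card that] .
    moreover have "rk N {x, y} = 2" if "x \<in> ground N" "y \<in> ground N" "x \<noteq> y" for x y
      using N.rk_pair[OF N(2) card that] .
    moreover have "rk (dual N) {x} = 1" if "x \<in> ground N" for x using DN.rk_single[OF DNconn, of x] card that by simp
    moreover have "rk (dual N) {x, y} = 2" if "x \<in> ground N" "y \<in> ground N" "x \<noteq> y" for x y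
      using DN.rk_pair[OF DNconn, of x y] card that by simp
    ultimately show ?thesis
      using matroid.has_minor_si[OF mC(1) N(1)] matroid.has_minor_si[OF mC(2) DN.matroid_axioms] by simp
  qed
  moreover from this have "has_minor (co (delete M {b})) N"
    using has_minor_dual[OF mS(2) DN.matroid_axioms] co_delete_eq by simp
  ultimately show ?thesis using el by (simp add: N_elastic_def)
qed

end

section \<open>Fans\<close>

lemma fan_triple_Cons: "fan_triple (g # gs) (Suc i) = fan_triple gs i"
  by (simp add: fan_triple_def)

locale three_connected_matroid = matroid +
  assumes conn: "three_connected M"
    and rank_ge: "4 \<le> rk M (ground M)"
    and corank_ge: "4 \<le> rk (dual M) (ground M)"
begin

lemma three_connected_matroid_dual: "three_connected_matroid (dual M)"
proof -
  interpret D: matroid "dual M" by (rule matroid_dual)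
  show ?thesis by unfold_locales (use conn rank_ge corank_ge n_connected_dual in auto)
qed

lemma four_fanI:
  "triangle M {a, b, c} \<Longrightarrow> triad M {b, c, d} \<Longrightarrow> distinct [a, b, c, d] \<Longrightarrow> four_fan M a b c d"
  by unfold_locales (use conn rank_ge corank_ge in auto)

lemma card_ge_8: "8 \<le> card (ground M)"
  using rk_dual_ground rank_ge corank_ge by linarith

lemma elastic_dual: "x \<in> ground M \<Longrightarrow> elastic (dual M) x \<longleftrightarrow> elastic M x"
  using elastic_iff[OF conn, of x] matroid.elastic_iff[OF matroid_dual, of x] conn n_connected_dual card_ge_8
  by auto

text \<open>Such a set would have rank 2 and a complement of rank r(M) - 1, one short of what
  3-connectivity demands. This makes the alternation in a fan unambiguous.\<close>

lemma not_triangle_and_triad: "\<not> (triangle M T \<and> triad M T)"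
proof
  assume T: "triangle M T \<and> triad M T"
  then have r: "T \<subseteq> ground M" "card T = 3" "rk M T = 2" "rk M (ground M - T) + 1 = rk M (ground M)"
    using triangle_rk triad_rk by blast+
  then have "2 \<le> card (ground M - T)" using card_Diff_ge[of T] card_ge_8 by linarith
  then show False using three_connected_rk2[OF conn r(1)] r by linarith
qed

lemma fan_dual: "fan (dual M) gs \<longleftrightarrow> fan M gs"
  unfolding fan_def by (auto simp: triad_dual triad_def)

text \<open>Alternation is defined by two implications; for the new first triple one of them is
  given and the other is vacuous, since no set is both a triangle and a triad.\<close>

lemma fan_Cons:
  assumes gs: "fan M gs" and g: "g \<in> ground M" "g \<notin> set gs"
    and t: "triad M {g, gs ! 0, gs ! 1} \<and> triangle M (fan_triple gs 0)
      \<or> triangle M {g, gs ! 0, gs ! 1} \<and> triad M (fan_triple gs 0)"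
  shows "fan M (g # gs)"
proof -
  have 0: "fan_triple (g # gs) 0 = {g, gs ! 0, gs ! 1}" by (simp add: fan_triple_def)
  have f: "distinct gs" "set gs \<subseteq> ground M" "3 \<le> length gs"
    "\<And>i. i + 2 < length gs \<Longrightarrow> triangle M (fan_triple gs i) \<or> triad M (fan_triple gs i)"
    "\<And>i. i + 3 < length gs \<Longrightarrow>
          (triangle M (fan_triple gs i) \<longrightarrow> triad M (fan_triple gs (i + 1)))
        \<and> (triad M (fan_triple gs i) \<longrightarrow> triangle M (fan_triple gs (i + 1)))"
    using gs by (auto simp: fan_def)
  have "triangle M (fan_triple (g # gs) i) \<or> triad M (fan_triple (g # gs) i)" if "i + 2 < length (g # gs)" for i
  proof (cases i)
    case 0
    then show ?thesis using t \<open>fan_triple (g # gs) 0 = _\<close> by auto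
  next
    case (Suc j)
    then show ?thesis using f(4)[of j] that by (simp add: fan_triple_Cons)
  qed
  moreover have "(triangle M (fan_triple (g # gs) i) \<longrightarrow> triad M (fan_triple (g # gs) (i + 1)))
        \<and> (triad M (fan_triple (g # gs) i) \<longrightarrow> triangle M (fan_triple (g # gs) (i + 1)))"
    if "i + 3 < length (g # gs)" for i
  proof (cases i)
    case 0
    then show ?thesis
      using t \<open>fan_triple (g # gs) 0 = _\<close> not_triangle_and_triad by (auto simp: fan_triple_Cons)
  next
    case (Suc j)
    then show ?thesis using f(5)[of j] that by (simp add: fan_triple_Cons)
  qed
  ultimately show ?thesis using f(1-3) g by (simp add: fan_def)
qed

lemma fan_four_fan:
  assumes gs: "fan M gs" and i: "i + 3 < length gs" and t: "triangle M (fan_triple gs i)"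
  shows "four_fan M (gs ! i) (gs ! (i + 1)) (gs ! (i + 2)) (gs ! (i + 3))"
proof (rule four_fanI)
  show "triangle M {gs ! i, gs ! (i + 1), gs ! (i + 2)}" using t by (simp add: fan_triple_def)
  have "triad M (fan_triple gs (i + 1))" using gs i t by (simp add: fan_def)
  then show "triad M {gs ! (i + 1), gs ! (i + 2), gs ! (i + 3)}" by (simp add: fan_triple_def numeral_3_eq_3)
  show "distinct [gs ! i, gs ! (i + 1), gs ! (i + 2), gs ! (i + 3)]"
    using gs i by (simp add: fan_def nth_eq_iff_index_eq)
qed

lemma fan_triangle_or_triad:
  assumes "fan M gs" "i + 2 < length gs"
  shows "triangle M (fan_triple gs i) \<or> triangle (dual M) (fan_triple gs i)"
  using assms by (auto simp: fan_def triad_def)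

text \<open>Any four consecutive fan elements form a four-element fan of M or of its dual, and
  elasticity is self-dual.\<close>

lemma fan_ends_not_elastic:
  assumes gs: "fan M gs" and i: "i + 3 < length gs"
  shows "\<not> elastic M (gs ! i)" "\<not> elastic M (gs ! (i + 3))"
proof -
  interpret D: three_connected_matroid "dual M" by (rule three_connected_matroid_dual)
  have sub: "gs ! i \<in> ground M" "gs ! (i + 3) \<in> ground M" using gs i nth_mem[of _ gs] by (auto simp: fan_def)
  have "triangle M (fan_triple gs i) \<or> triangle (dual M) (fan_triple gs i)"
    using fan_triangle_or_triad[OF gs] i by simp
  then have "\<not> elastic M (gs ! i) \<and> \<not> elastic M (gs ! (i + 3))"
  proof
    assume "triangle M (fan_triple gs i)"
    note f = fan_four_fan[OF gs i this]
    show ?thesis using four_fan.not_elastic_first[OF f] four_fan.not_elastic_last[OF f] by blast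
  next
    assume "triangle (dual M) (fan_triple gs i)"
    moreover have "fan (dual M) gs" using gs fan_dual by blast
    ultimately have f: "four_fan (dual M) (gs ! i) (gs ! (i + 1)) (gs ! (i + 2)) (gs ! (i + 3))"
      using D.fan_four_fan[OF _ i] by blast
    show ?thesis
      using four_fan.not_elastic_first[OF f] four_fan.not_elastic_last[OF f] elastic_dual sub by blast
  qed
  then show "\<not> elastic M (gs ! i)" "\<not> elastic M (gs ! (i + 3))" by simp_all
qed

text \<open>Windows of four exclude every index that has three elements after it or three before it.
  A remaining index satisfies length - 3 \<le> j \<le> 2, so with length at least 5 only the middle
  of a five-element fan survives.\<close>

lemma fan_elastic_index:
  assumes gs: "fan M gs" and x: "j < length gs" "elastic M (gs ! j)" and len: "5 \<le> length gs"
  shows "length gs = 5" "j = 2"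
proof -
  have "\<not> j + 3 < length gs" using fan_ends_not_elastic(1)[OF gs] x(2) by blast
  moreover have "j < 3"
  proof (rule ccontr)
    assume "\<not> j < 3"
    then have "j - 3 + 3 = j" by simp
    then show False using fan_ends_not_elastic(2)[OF gs, of "j - 3"] x by simp
  qed
  ultimately show "length gs = 5" "j = 2" using len by linarith+
qed

section \<open>Flowers and restrictions obtained from longer fans\<close>

lemma swirl_like_along_dual: "swirl_like_along (dual M) gs \<longleftrightarrow> swirl_like_along M gs"
  by (auto simp: swirl_like_along_def)

lemma K4_restriction_dual: "K4_restriction (dual M) F \<longleftrightarrow> K4_restriction M F"
  by (auto simp: K4_restriction_def)

lemma fan_ge_6_swirl_aux:
  assumes gs: "fan M gs" and len: "6 \<le> length gs" and t: "triangle M (fan_triple gs 0)"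
  shows "swirl_like_along M gs"
proof -
  have alt: "(triangle M (fan_triple gs i) \<longrightarrow> triad M (fan_triple gs (i + 1)))
        \<and> (triad M (fan_triple gs i) \<longrightarrow> triangle M (fan_triple gs (i + 1)))" if "i + 3 < length gs" for i
    using gs that by (simp add: fan_def)
  \<comment> \<open>By alternation the triple two places on is again a triangle, so two four-element
    fans overlap in two elements.\<close>
  have "triangle M (fan_triple gs 2)" using alt[of 0] alt[of 1] t len by (simp add: numeral_2_eq_2)
  then have "four_fan M (gs ! 2) (gs ! 3) (gs ! 4) (gs ! 5)"
    using fan_four_fan[OF gs, of 2] len by simp
  moreover have "four_fan M (gs ! 0) (gs ! 1) (gs ! 2) (gs ! 3)"
    using fan_four_fan[OF gs, of 0] t len by (simp add: numeral_2_eq_2 numeral_3_eq_3)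
  moreover have "gs ! i \<noteq> gs ! j" if "i < 6" "j < 6" "i \<noteq> j" for i j
    using gs len that by (simp add: fan_def nth_eq_iff_index_eq)
  then have "distinct [gs ! 0, gs ! 1, gs ! 2, gs ! 3, gs ! 4, gs ! 5]" by simp
  ultimately have "swirl_like_flower M [ground M - {gs ! 0, gs ! 1, gs ! 2, gs ! 3, gs ! 4, gs ! 5},
      {gs ! 0, gs ! 1}, {gs ! 2, gs ! 3}, {gs ! 4, gs ! 5}]"
    by (intro six_fan_swirl)
  then show ?thesis unfolding swirl_like_along_def by blast
qed

lemma fan_ge_6_swirl:
  assumes gs: "fan M gs" and len: "6 \<le> length gs"
  shows "swirl_like_along M gs"
proof -
  interpret D: three_connected_matroid "dual M" by (rule three_connected_matroid_dual)
  show ?thesis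
    using fan_triangle_or_triad[OF gs, of 0] fan_ge_6_swirl_aux[OF gs len] D.fan_ge_6_swirl_aux[of gs] len gs
      fan_dual swirl_like_along_dual by auto
qed

lemma list_5_conv_nth: "length gs = 5 \<Longrightarrow> gs = [gs ! 0, gs ! 1, gs ! 2, gs ! 3, gs ! 4]"
  by (rule nth_equalityI) (auto simp: less_Suc_eq numeral_eq_Suc)

text \<open>Quantifying over F and x covers both positions of a four-element portion in the fan. The
  assumption \<open>max\<close> is needed at the front only, because the triad to be excluded
  attaches there.\<close>

lemma fan_5_swirl_or_K4_aux:
  assumes gs: "fan M gs" and len: "length gs = 5" and t: "triangle M (fan_triple gs 0)"
    and ne: "\<not> elastic M (gs ! 2)" and max: "\<And>g. \<not> fan M (g # gs)"
  shows "swirl_like_along M gs \<or> (\<forall>F. \<forall>x. F \<union> {x} = set gs \<and> x \<in> set gs \<longrightarrow> K4_restriction M F)"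
proof -
  define g1 where "g1 = gs ! 0"
  define g2 where "g2 = gs ! 1"
  define g3 where "g3 = gs ! 2"
  define g4 where "g4 = gs ! 3"
  define g5 where "g5 = gs ! 4"
  note g = g1_def g2_def g3_def g4_def g5_def
  have eq: "gs = [g1, g2, g3, g4, g5]" unfolding g by (rule list_5_conv_nth[OF len])
  have sub: "set gs \<subseteq> ground M" and dist: "distinct gs" using gs by (auto simp: fan_def)
  have F: "four_fan M g1 g2 g3 g4"
    using fan_four_fan[OF gs, of 0] t len by (simp add: g numeral_2_eq_2)
  interpret F: four_fan M g1 g2 g3 g4 by (rule F)
  have "triad M (fan_triple gs 1)" using F.triad by (simp add: eq fan_triple_def insert_commute)
  moreover have "Suc 0 + 3 < length gs" using len by simp
  ultimately have "triangle M (fan_triple gs (1 + 1))" using gs unfolding fan_def by (metis One_nat_def)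
  then have t5: "triangle M {g3, g4, g5}" by (simp add: eq fan_triple_def)
  have "\<not> triad M {x, g1, g2}" if x: "x \<in> ground M" "x \<notin> {g1, g2, g3, g4, g5}" for x
  proof
    assume "triad M {x, g1, g2}"
    then have "fan M (x # gs)"
      using t by (intro fan_Cons[OF gs]) (use x in \<open>auto simp: eq\<close>)
    then show False using max by blast
  qed
  moreover have "g5 \<notin> {g1, g2, g3, g4}" "\<not> elastic M g3" using dist ne by (auto simp: eq)
  ultimately have "(\<exists>A B. swirl_like_flower M [A, {g1, g2}, {g3, g4}, B])
    \<or> (\<exists>h. h \<in> ground M \<and> h \<notin> {g1, g2, g3, g4, g5} \<and> triangle M {g2, g4, h})"
    by (intro F.five_fan[OF t5])
  then show ?thesis
  proof
    assume "\<exists>A B. swirl_like_flower M [A, {g1, g2}, {g3, g4}, B]"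
    then show ?thesis unfolding swirl_like_along_def g by blast
  next
    assume "\<exists>h. h \<in> ground M \<and> h \<notin> {g1, g2, g3, g4, g5} \<and> triangle M {g2, g4, h}"
    then obtain h where h: "h \<in> ground M" "h \<notin> {g1, g2, g3, g4, g5}" "triangle M {g2, g4, h}" by blast
    have iso: "matroid_iso (restrict M {g1, g2, g3, g4, g5, h}) (cycle_matroid (complete_graph 4))"
      by (rule K4_iso[OF F t5 h(3)]) (use dist h(2) eq in auto)
    have "K4_restriction M F" if "F \<union> {x} = set gs" "x \<in> set gs" for F x
    proof -
      \<comment> \<open>The two elements added to F are the fifth fan element and the third point of
        the triangle on g2 and g4.\<close>
      have "F \<union> {x, h} = (F \<union> {x}) \<union> {h}" by auto
      also have "\<dots> = {g1, g2, g3, g4, g5, h}" unfolding that(1) eq by auto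
      finally show ?thesis
        unfolding K4_restriction_def using iso h(1) that(2) sub by (metis insertI1 subsetD)
    qed
    then show ?thesis by blast
  qed
qed

lemma fan_5_swirl_or_K4:
  assumes gs: "fan M gs" and len: "length gs = 5"
    and ne: "\<not> elastic M (gs ! 2)" and max: "\<And>g. \<not> fan M (g # gs)"
    and F: "F \<union> {x} = set gs" "x \<in> set gs"
  shows "swirl_like_along M gs \<or> K4_restriction M F"
proof -
  interpret D: three_connected_matroid "dual M" by (rule three_connected_matroid_dual)
  have "gs ! 2 \<in> ground M" using gs len nth_mem[of 2 gs] by (auto simp: fan_def)
  then have "\<not> elastic (dual M) (gs ! 2)" using ne elastic_dual by blast
  moreover have "triangle M (fan_triple gs 0) \<or> triangle (dual M) (fan_triple gs 0)"
    using fan_triangle_or_triad[OF gs, of 0] len by simp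
  ultimately show ?thesis
    using fan_5_swirl_or_K4_aux[OF gs len _ ne max] D.fan_5_swirl_or_K4_aux[of gs] F gs len max
    unfolding fan_dual swirl_like_along_dual K4_restriction_dual by blast
qed

lemma four_fan_imp_fan:
  assumes "four_fan M a b c d"
  shows "fan M [a, b, c, d]"
proof -
  interpret F: four_fan M a b c d by (rule assms)
  have t: "fan_triple [a, b, c, d] 0 = {a, b, c}" "fan_triple [a, b, c, d] (Suc 0) = {b, c, d}"
    by (simp_all add: fan_triple_def numeral_2_eq_2)
  have "triangle M (fan_triple [a, b, c, d] i) \<or> triad M (fan_triple [a, b, c, d] i)" if "i + 2 < length [a, b, c, d]" for i
  proof -
    have "i = 0 \<or> i = Suc 0" using that by auto
    then show ?thesis using t F.triangle F.triad by (elim disjE) simp_all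
  qed
  moreover have "(triangle M (fan_triple [a, b, c, d] i) \<longrightarrow> triad M (fan_triple [a, b, c, d] (i + 1)))
      \<and> (triad M (fan_triple [a, b, c, d] i) \<longrightarrow> triangle M (fan_triple [a, b, c, d] (i + 1)))"
    if "i + 3 < length [a, b, c, d]" for i
  proof -
    have "i = 0" using that by simp
    then show ?thesis using t F.triangle F.triad not_triangle_and_triad[of "{a, b, c}"] by simp
  qed
  ultimately show ?thesis unfolding fan_def using F.dist F.in_ground by simp
qed

end

section \<open>Prolonging a four-element fan, and the assembly\<close>

lemma (in four_fan) three_connected_matroid: "three_connected_matroid M"
  by unfold_locales (use conn rank_ge corank_ge in auto)

text \<open>A triad on a and c attaches to the reordered fan (a, c, b, d), a triangle on d and c to
  the reversed one (d, c, b, a); extension of the set F admits either ordering.\<close>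

lemma (in four_fan) extends_to_five_fan:
  assumes g: "g \<in> ground M" "g \<notin> {a, b, c, d}" and t: "triad M {g, a, c} \<or> triangle M {g, d, c}"
  shows "extends_to_fan_of_size M {a, b, c, d} 5"
proof -
  interpret T: three_connected_matroid M by (rule three_connected_matroid)
  interpret D: three_connected_matroid "dual M" by (rule T.three_connected_matroid_dual)
  from t show ?thesis
  proof
    assume t: "triad M {g, a, c}"
    have "fan M [a, c, b, d]" by (rule T.four_fan_imp_fan[OF four_fan_swap])
    then have "fan M (g # [a, c, b, d])"
      by (rule T.fan_Cons) (use g t triangle in \<open>auto simp: fan_triple_def insert_commute\<close>)
    moreover have "g # [a, c, b, d] = [g] @ [a, c, b, d] @ []" "set [a, c, b, d] = {a, b, c, d}" by auto
    ultimately have "fan_extension M {a, b, c, d} (g # [a, c, b, d])" unfolding fan_extension_def by blast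
    then show ?thesis unfolding extends_to_fan_of_size_def by fastforce
  next
    assume t: "triangle M {g, d, c}"
    have "fan (dual M) [d, c, b, a]" by (rule D.four_fan_imp_fan[OF four_fan.four_fan_swap[OF four_fan_dual]])
    then have "fan M [d, c, b, a]" by (simp add: T.fan_dual)
    then have "fan M (g # [d, c, b, a])"
      by (rule T.fan_Cons) (use g t triad in \<open>auto simp: fan_triple_def insert_commute\<close>)
    moreover have "g # [d, c, b, a] = [g] @ [d, c, b, a] @ []" "set [d, c, b, a] = {a, b, c, d}" by auto
    ultimately have "fan_extension M {a, b, c, d} (g # [d, c, b, a])" unfolding fan_extension_def by blast
    then show ?thesis unfolding extends_to_fan_of_size_def by fastforce
  qed
qed

lemma fan_extension_card_4:
  assumes "fan_extension M F gs" "card F = 4"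
  shows "fan M gs" "F \<subseteq> set gs" "length gs = 5 \<Longrightarrow> gs ! 2 \<in> F \<and> (\<exists>x \<in> set gs. F \<union> {x} = set gs)"
proof -
  obtain as bs cs where gs: "fan M gs" "gs = as @ bs @ cs" "set bs = F"
    using assms(1) unfolding fan_extension_def by blast
  show "fan M gs" "F \<subseteq> set gs" using gs by auto
  have "distinct bs" using gs by (auto simp: fan_def)
  then have bs: "length bs = 4" using distinct_card gs(3) assms(2) by metis
  assume "length gs = 5"
  then have len: "length as + length cs = 1" using gs(2) bs by simp
  \<comment> \<open>At most one element precedes the portion, so the middle of a five-element fan is
    index 2 or 1 of the portion and belongs to F.\<close>
  then have "gs ! 2 = bs ! (2 - length as)" using gs(2) bs by (auto simp: nth_append)
  then have "gs ! 2 \<in> F" using gs(3) bs nth_mem[of "2 - length as" bs] by simp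
  moreover have "length (as @ cs) = 1" using len by simp
  then obtain x where "as @ cs = [x]" by (metis One_nat_def length_0_conv length_Suc_conv)
  then have "set gs = F \<union> {x}" using gs(2,3) by (cases as) auto
  ultimately show "gs ! 2 \<in> F \<and> (\<exists>x \<in> set gs. F \<union> {x} = set gs)" by auto
qed

theorem theorem1p4:
  fixes M N :: "'a matroid"
    and X Y X' Y' F :: "'a set"
    and e e' f1 f2 f3 f4 :: 'a
  assumes "matroid M" and "three_connected M"
    and "rk M (ground M) \<ge> 4" and "rk (dual M) (ground M) \<ge> 4"
    and "matroid N" and "three_connected N" and "is_minor N M"
    and "vertical_3_separation M X e Y"
    and "\<exists>N'. is_minor N' (contract M {e}) \<and> matroid_iso N' N \<and> card (X \<inter> ground N') \<le> 1"
    and "vertical_3_separation M X' e' Y'"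
    and "Y \<union> {e} \<subseteq> Y' \<union> {e'}" and "maximal_side M e' Y'"
    and "F = X' \<union> {e'}" and "F = {f1, f2, f3, f4}"
    and "fan M [f1, f2, f3, f4]" and "e' = f1"
  shows
    "((\<exists>m \<ge> 6. extends_to_fan_of_size M F m) \<longrightarrow> elastic_elements M F = {})
   \<and> (extends_to_fan_of_size M F 5 \<and> \<not> extends_to_fan_of_size M F 6 \<longrightarrow>
        (\<forall>gs. fan_extension M F gs \<and> length gs = 5 \<longrightarrow>
           elastic_elements M F = {gs ! 2} \<and> N_elastic N M (gs ! 2)
           \<or> elastic_elements M F = {}))
   \<and> (\<not> (\<exists>m > 4. extends_to_fan_of_size M F m) \<longrightarrow>
        elastic_elements M F = {f2, f3} \<and> N_elastic N M f2 \<and> N_elastic N M f3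
        \<or> elastic_elements M F = {})
   \<and> (elastic_elements M F = {} \<longrightarrow>
        K4_restriction M F
        \<or> (if \<exists>m > 4. extends_to_fan_of_size M F m
           then \<forall>gs. fan_extension M F gs
                  \<and> (length gs \<ge> 6 \<or> length gs = 5 \<and> \<not> extends_to_fan_of_size M F 6)
                  \<longrightarrow> swirl_like_along M gs
           else swirl_like_along M [f1, f2, f3, f4] \<or> swirl_like_along M [f1, f3, f2, f4]))"
proof -
  interpret three_connected_matroid M
    by (intro three_connected_matroid.intro three_connected_matroid_axioms.intro) (use assms in auto)
  have dist: "distinct [f1, f2, f3, f4]" using assms(15) by (simp add: fan_def)
  have v: "3 \<le> rk M X'" "X' \<union> Y' = ground M - {f1}" "X' \<inter> Y' = {}"
    using assms(10,16) unfolding vertical_3_separation_iff[OF conn] by auto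
  have X': "X' = {f2, f3, f4}" using assms(13,14,16) dist v(2) by auto
  have XY: "X \<union> Y = ground M - {e}" using assms(8) unfolding vertical_3_separation_iff[OF conn] by auto
  have X'X: "{f2, f3, f4} \<subseteq> X"
  proof
    fix x assume "x \<in> {f2, f3, f4}"
    then have "x \<in> X'" by (simp add: X')
    then have "x \<in> ground M" "x \<notin> Y' \<union> {f1}" using v(2,3) by blast+
    moreover from this have "x \<notin> Y \<union> {e}" using assms(11,16) by blast
    ultimately show "x \<in> X" using XY by blast
  qed
  have t1: "fan_triple [f1, f2, f3, f4] 1 = {f2, f3, f4}" by (simp add: fan_triple_def)
  \<comment> \<open>A vertical side has rank at least 3, so the second triple is a triad and the fan
    starts with a triangle.\<close>
  have "\<not> triangle M {f2, f3, f4}" using triangle_rk[of "{f2, f3, f4}"] v(1) X' by auto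
  moreover have "triangle M (fan_triple [f1, f2, f3, f4] 0) \<or> triad M (fan_triple [f1, f2, f3, f4] 0)"
    "triad M (fan_triple [f1, f2, f3, f4] 0) \<longrightarrow> triangle M (fan_triple [f1, f2, f3, f4] (0 + 1))"
    using assms(15) unfolding fan_def by simp_all
  ultimately have "triangle M (fan_triple [f1, f2, f3, f4] 0)" using t1 by auto
  from fan_four_fan[OF assms(15) _ this] have F: "four_fan M f1 f2 f3 f4" by simp
  interpret F: four_fan M f1 f2 f3 f4 by (rule F)
  interpret G: four_fan M f1 f3 f2 f4 by (rule F.four_fan_swap)
  obtain N' where N': "is_minor N' (contract M {e})" "matroid_iso N' N" "card (X \<inter> ground N') \<le> 1"
    using assms(9) by blast
  have N2: "N_elastic N M f2" if "elastic M f2"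
    using F.second_N_elastic[OF assms(8) X'X assms(5,6) N' that] .
  have N3: "N_elastic N M f3" if "elastic M f3"
    using G.second_N_elastic[OF assms(8) _ assms(5,6) N' that] X'X by simp
  have F_eq: "F = {f1, f2, f3, f4}" by (rule assms(14))
  have ends: "\<not> elastic M f1" "\<not> elastic M f4" by (rule F.not_elastic_first, rule F.not_elastic_last)
  have el_sub: "elastic_elements M F = {x \<in> {f2, f3}. elastic M x}"
    using ends by (auto simp: elastic_elements_def F_eq)
  have cF: "card F = 4" using dist by (simp add: F_eq)
  note ext = fan_extension_card_4[OF _ cF]
  have part1: "elastic_elements M F = {}" if "fan_extension M F gs" "6 \<le> length gs" for gs
  proof -
    have "\<not> elastic M x" if "x \<in> F" for x
    proof
      assume "elastic M x"
      moreover obtain j where "j < length gs" "gs ! j = x"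
        using ext(2)[OF \<open>fan_extension M F gs\<close>] \<open>x \<in> F\<close> by (metis in_set_conv_nth subsetD)
      ultimately show False
        using fan_elastic_index(1)[OF ext(1)[OF \<open>fan_extension M F gs\<close>], of j] \<open>6 \<le> length gs\<close> by simp
    qed
    then show ?thesis by (auto simp: elastic_elements_def)
  qed
  have part2: "elastic_elements M F = {gs ! 2} \<and> N_elastic N M (gs ! 2) \<or> elastic_elements M F = {}"
    if gs: "fan_extension M F gs" "length gs = 5" for gs
  proof (cases "elastic M (gs ! 2)")
    case False
    have "\<not> elastic M x" if "x \<in> F" for x
    proof
      assume "elastic M x"
      moreover obtain j where "j < length gs" "gs ! j = x"
        using ext(2)[OF gs(1)] \<open>x \<in> F\<close> by (metis in_set_conv_nth subsetD)
      ultimately show False using fan_elastic_index(2)[OF ext(1)[OF gs(1)], of j] gs(2) False by simp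
    qed
    then show ?thesis by (auto simp: elastic_elements_def)
  next
    case True
    have "x = gs ! 2" if "x \<in> F" "elastic M x" for x
    proof -
      obtain j where "j < length gs" "gs ! j = x"
        using ext(2)[OF gs(1)] \<open>x \<in> F\<close> by (metis in_set_conv_nth subsetD)
      then show ?thesis using fan_elastic_index(2)[OF ext(1)[OF gs(1)], of j] gs(2) that(2) by simp
    qed
    moreover have "gs ! 2 \<in> F" using ext(3)[OF gs] by blast
    ultimately have "elastic_elements M F = {gs ! 2}" using True unfolding elastic_elements_def by blast
    moreover have "gs ! 2 = f2 \<or> gs ! 2 = f3" using \<open>gs ! 2 \<in> F\<close> True ends unfolding F_eq by fastforce
    ultimately show ?thesis using N2 N3 True by metis
  qed
  have second: "\<not> elastic M f3 \<and> (swirl_like_along M [f1, f2, f3, f4] \<or> swirl_like_along M [f1, f3, f2, f4])"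
    if no: "\<not> (\<exists>m > 4. extends_to_fan_of_size M F m)" and ne: "\<not> elastic M f2"
  proof -
    have "\<not> extends_to_fan_of_size M F 5" using no by auto
    then have "\<not> (\<exists>g. g \<in> ground M \<and> g \<notin> {f1, f2, f3, f4} \<and> (triad M {g, f1, f3} \<or> triangle M {g, f4, f3}))"
      using F.extends_to_five_fan F_eq by blast
    \<comment> \<open>A flower of M has petals {f1, f3} and {f2, f4} and follows the exchanged
      ordering; a flower of the dual has petals {f1, f2} and {f3, f4} and follows the given
      one.\<close>
    then show ?thesis
      using F.second_not_elastic[OF ne] by (fastforce simp: swirl_like_along_def)
  qed
  have third: "\<not> elastic M f2" if no: "\<not> (\<exists>m > 4. extends_to_fan_of_size M F m)" and ne: "\<not> elastic M f3"
  proof -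
    have "\<not> extends_to_fan_of_size M F 5" using no by auto
    moreover have "F = {f1, f3, f2, f4}" using F_eq by auto
    ultimately have "\<not> (\<exists>g. g \<in> ground M \<and> g \<notin> {f1, f3, f2, f4} \<and> (triad M {g, f1, f2} \<or> triangle M {g, f4, f2}))"
      using G.extends_to_five_fan by blast
    then show ?thesis using G.second_not_elastic[OF ne] by blast
  qed
  have part3: "elastic_elements M F = {f2, f3} \<and> N_elastic N M f2 \<and> N_elastic N M f3 \<or> elastic_elements M F = {}"
    if "\<not> (\<exists>m > 4. extends_to_fan_of_size M F m)"
    using second[OF that] third[OF that] N2 N3 unfolding el_sub by blast
  have part4: "K4_restriction M F \<or> swirl_like_along M gs"
    if none: "elastic_elements M F = {}" and gs: "fan_extension M F gs"
      and len: "6 \<le> length gs \<or> length gs = 5 \<and> \<not> extends_to_fan_of_size M F 6" for gs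
    using len
  proof
    assume "6 \<le> length gs"
    then show ?thesis using fan_ge_6_swirl[OF ext(1)[OF gs]] by blast
  next
    assume 5: "length gs = 5 \<and> \<not> extends_to_fan_of_size M F 6"
    obtain x where x: "gs ! 2 \<in> F" "x \<in> set gs" "F \<union> {x} = set gs" using ext(3)[OF gs] 5 by blast
    have "\<not> elastic M (gs ! 2)" using none x(1) by (auto simp: elastic_elements_def)
    moreover have "\<not> fan M (g # gs)" for g
    proof
      assume "fan M (g # gs)"
      moreover obtain as bs cs where "gs = as @ bs @ cs" "set bs = F" using gs unfolding fan_extension_def by blast
      then have "g # gs = (g # as) @ bs @ cs" "set bs = F" by auto
      \<comment> \<open>Prepending an element keeps F a consecutive portion, so a longer fan would
        be an extension of size six.\<close>
      ultimately have "fan_extension M F (g # gs)" unfolding fan_extension_def by blast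
      moreover have "length (g # gs) = 6" using 5 by simp
      ultimately show False using 5 unfolding extends_to_fan_of_size_def by blast
    qed
    ultimately show ?thesis using fan_5_swirl_or_K4[OF ext(1)[OF gs]] 5 x by blast
  qed
  have part5: "swirl_like_along M [f1, f2, f3, f4] \<or> swirl_like_along M [f1, f3, f2, f4]"
    if "elastic_elements M F = {}" "\<not> (\<exists>m > 4. extends_to_fan_of_size M F m)"
    using second[OF that(2)] that(1) unfolding el_sub by blast
  show ?thesis
  proof (intro conjI impI)
    show "elastic_elements M F = {}" if "\<exists>m \<ge> 6. extends_to_fan_of_size M F m"
      using that part1 unfolding extends_to_fan_of_size_def by blast
    show "\<forall>gs. fan_extension M F gs \<and> length gs = 5 \<longrightarrow>
           elastic_elements M F = {gs ! 2} \<and> N_elastic N M (gs ! 2) \<or> elastic_elements M F = {}"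
      using part2 by blast
    show "elastic_elements M F = {f2, f3} \<and> N_elastic N M f2 \<and> N_elastic N M f3 \<or> elastic_elements M F = {}"
      if "\<not> (\<exists>m > 4. extends_to_fan_of_size M F m)" by (rule part3[OF that])
    show "K4_restriction M F \<or> (if \<exists>m > 4. extends_to_fan_of_size M F m
           then \<forall>gs. fan_extension M F gs \<and> (length gs \<ge> 6 \<or> length gs = 5 \<and> \<not> extends_to_fan_of_size M F 6)
                  \<longrightarrow> swirl_like_along M gs
           else swirl_like_along M [f1, f2, f3, f4] \<or> swirl_like_along M [f1, f3, f2, f4])"
      if none: "elastic_elements M F = {}"
      using part4[OF none] part5[OF none] by auto
  qed
qed

end
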